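(* Let $(M^{n+1},g)$ be a smooth closed oriented Riemannian manifold of dimension $3\le n+1\le 7$. Let $\mathcal{S}$ be the set of smooth Morse functions $h:M\to\mathbb{R}$ such that the zero set $\Sigma_0:=\{h=0\}$ is a smooth closed (possibly empty) embedded hypersurface and the mean curvature of $\Sigma_0$ vanishes to at most finite order (i.e. at no point of $\Sigma_0$ does it vanish to infinite order). Then $\mathcal{S}$ is open and dense in $C^\infty(M)$.
   Context: $C^\infty(M)$ carries the usual $C^\infty$ topology. The mean curvature of $\Sigma_0$ is a smooth function on $\Sigma_0$ (defined locally up to a sign given by the choice of unit normal); it vanishes to infinite order at a point if it and all of its derivatives along $\Sigma_0$ vanish at that point. *)

theory Defs
  imports "HOL-Analysis.Analysis"
begin

subsection \<open>Calculus on open subsets of Euclidean space\<close>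

fun Ck_on :: "nat \<Rightarrow> 'a::real_normed_vector set \<Rightarrow> ('a \<Rightarrow> 'b::real_normed_vector) \<Rightarrow> bool" where
  "Ck_on 0 S f \<longleftrightarrow> continuous_on S f"
| "Ck_on (Suc k) S f \<longleftrightarrow>
     (\<forall>x\<in>S. f differentiable (at x)) \<and> (\<forall>v. Ck_on k S (\<lambda>x. frechet_derivative f (at x) v))"

definition smooth_on :: "'a::real_normed_vector set \<Rightarrow> ('a \<Rightarrow> 'b::real_normed_vector) \<Rightarrow> bool" where
  "smooth_on S f \<longleftrightarrow> (\<forall>k. Ck_on k S f)"

text \<open>The partial derivative only sees \<open>f\<close> on the coordinate line through \<open>x\<close>.  Hence iterated partial
  derivatives in directions other than \<open>i\<close> are intrinsic to the hyperplanes \<open>x $ i = const\<close>.\<close>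

definition partial_deriv :: "'d::finite \<Rightarrow> (real^'d \<Rightarrow> real) \<Rightarrow> real^'d \<Rightarrow> real" where
  "partial_deriv j f x = deriv (\<lambda>t. f (x + t *\<^sub>R axis j 1)) 0"

definition partial_derivs :: "'d::finite list \<Rightarrow> (real^'d \<Rightarrow> real) \<Rightarrow> real^'d \<Rightarrow> real" where
  "partial_derivs js f = foldr partial_deriv js f"

subsection \<open>Smooth manifolds\<close>

text \<open>The manifold is the whole type \<open>'m\<close>; its dimension is \<open>CARD('d)\<close>.  A chart is a pair of its
  domain and its coordinate map, whose values outside the domain are irrelevant.\<close>

type_synonym ('m, 'd) chart = "'m set \<times> ('m \<Rightarrow> real^'d)"

definition chart_inv :: "('m, 'd::finite) chart \<Rightarrow> real^'d \<Rightarrow> 'm" where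
  "chart_inv c = inv_into (fst c) (snd c)"

definition chart_image :: "('m, 'd::finite) chart \<Rightarrow> (real^'d) set" where
  "chart_image c = snd c ` fst c"

definition is_chart :: "('m::topological_space, 'd::finite) chart \<Rightarrow> bool" where
  "is_chart c \<longleftrightarrow> open (fst c) \<and> open (chart_image c) \<and>
     homeomorphism (fst c) (chart_image c) (snd c) (chart_inv c)"

definition overlap :: "('m, 'd::finite) chart \<Rightarrow> ('m, 'd) chart \<Rightarrow> (real^'d) set" where
  "overlap c c' = snd c ` (fst c \<inter> fst c')"

definition transition :: "('m, 'd::finite) chart \<Rightarrow> ('m, 'd) chart \<Rightarrow> real^'d \<Rightarrow> real^'d" where
  "transition c c' = snd c' \<circ> chart_inv c"

definition compatible :: "('m, 'd::finite) chart \<Rightarrow> ('m, 'd) chart \<Rightarrow> bool" where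
  "compatible c c' \<longleftrightarrow>
     smooth_on (overlap c c') (transition c c') \<and> smooth_on (overlap c' c) (transition c' c)"

definition smooth_atlas :: "('m::topological_space, 'd::finite) chart set \<Rightarrow> bool" where
  "smooth_atlas \<A> \<longleftrightarrow> (\<forall>c\<in>\<A>. is_chart c) \<and> (\<Union>c\<in>\<A>. fst c) = UNIV \<and>
     (\<forall>c\<in>\<A>. \<forall>c'\<in>\<A>. compatible c c')"

definition oriented_smooth_atlas :: "('m::topological_space, 'd::finite) chart set \<Rightarrow> bool" where
  "oriented_smooth_atlas \<A> \<longleftrightarrow> smooth_atlas \<A> \<and>
     (\<forall>c\<in>\<A>. \<forall>c'\<in>\<A>. \<forall>x\<in>overlap c c'. det (jacobian (transition c c') (at x)) > 0)"

text \<open>The maximal smooth atlas containing \<open>\<A>\<close>; its charts need not respect the orientation.\<close>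

definition smooth_charts :: "('m::topological_space, 'd::finite) chart set \<Rightarrow> ('m, 'd) chart set" where
  "smooth_charts \<A> = {c. is_chart c \<and> (\<forall>c'\<in>\<A>. compatible c c')}"

definition smooth_functions :: "('m::topological_space, 'd::finite) chart set \<Rightarrow> ('m \<Rightarrow> real) set" where
  "smooth_functions \<A> = {f. \<forall>c\<in>\<A>. smooth_on (chart_image c) (f \<circ> chart_inv c)}"

subsection \<open>The smooth topology on the space of smooth functions\<close>

definition Cinf_nbhd ::
  "('m::topological_space, 'd::finite) chart set \<Rightarrow> ('m \<Rightarrow> real) \<Rightarrow> ('m, 'd) chart \<Rightarrow>
   (real^'d) set \<Rightarrow> nat \<Rightarrow> real \<Rightarrow> ('m \<Rightarrow> real) set" where
  "Cinf_nbhd \<A> f c K k \<epsilon> = {f' \<in> smooth_functions \<A>. \<forall>x\<in>K. \<forall>js. length js \<le> k \<longrightarrow>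
     \<bar>partial_derivs js (f' \<circ> chart_inv c) x - partial_derivs js (f \<circ> chart_inv c) x\<bar> < \<epsilon>}"

definition Cinf_topology ::
  "('m::topological_space, 'd::finite) chart set \<Rightarrow> ('m \<Rightarrow> real) topology" where
  "Cinf_topology \<A> = topology_generated_by
     {Cinf_nbhd \<A> f c K k \<epsilon> | f c K k \<epsilon>.
        f \<in> smooth_functions \<A> \<and> c \<in> smooth_charts \<A> \<and>
        compact K \<and> K \<subseteq> chart_image c \<and> \<epsilon> > 0}"

lemma topspace_Cinf_topology:
  assumes "smooth_atlas \<A>"
  shows "topspace (Cinf_topology \<A>) = smooth_functions \<A>"
proof -
  obtain c where "c \<in> \<A>"
    using assms by (auto simp: smooth_atlas_def)
  hence c: "c \<in> smooth_charts \<A>"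
    using assms by (auto simp: smooth_atlas_def smooth_charts_def)
  have "f \<in> \<Union>{Cinf_nbhd \<A> f c K k \<epsilon> | f c K k \<epsilon>. f \<in> smooth_functions \<A> \<and>
      c \<in> smooth_charts \<A> \<and> compact K \<and> K \<subseteq> chart_image c \<and> \<epsilon> > 0}"
    if "f \<in> smooth_functions \<A>" for f
  proof
    show "f \<in> Cinf_nbhd \<A> f c {} 0 1"
      using that by (simp add: Cinf_nbhd_def)
    show "Cinf_nbhd \<A> f c {} 0 1 \<in> {Cinf_nbhd \<A> f c K k \<epsilon> | f c K k \<epsilon>. f \<in> smooth_functions \<A> \<and>
      c \<in> smooth_charts \<A> \<and> compact K \<and> K \<subseteq> chart_image c \<and> \<epsilon> > 0}"
      using that c by (intro CollectI exI[of _ f] exI[of _ c] exI[of _ "{}"] exI[of _ 0] exI[of _ 1]) simp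
  qed
  thus ?thesis
    unfolding Cinf_topology_def topology_generated_by_topspace
    by (auto simp: Cinf_nbhd_def)
qed

subsection \<open>Morse functions\<close>

definition critical_in_chart :: "('m, 'd::finite) chart \<Rightarrow> ('m \<Rightarrow> real) \<Rightarrow> 'm \<Rightarrow> bool" where
  "critical_in_chart c h p \<longleftrightarrow> (\<forall>j. partial_deriv j (h \<circ> chart_inv c) (snd c p) = 0)"

definition hessian_in_chart :: "('m, 'd::finite) chart \<Rightarrow> ('m \<Rightarrow> real) \<Rightarrow> 'm \<Rightarrow> real^'d^'d" where
  "hessian_in_chart c h p =
     (\<chi> j k. partial_deriv j (partial_deriv k (h \<circ> chart_inv c)) (snd c p))"

definition morse :: "('m::topological_space, 'd::finite) chart set \<Rightarrow> ('m \<Rightarrow> real) \<Rightarrow> bool" where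
  "morse \<A> h \<longleftrightarrow> h \<in> smooth_functions \<A> \<and>
     (\<forall>c\<in>\<A>. \<forall>p\<in>fst c. critical_in_chart c h p \<longrightarrow> det (hessian_in_chart c h p) \<noteq> 0)"

subsection \<open>Riemannian metrics\<close>

text \<open>A metric is given by its component matrices \<open>g c x $ j $ k\<close> in every chart \<open>c\<close> of the maximal
  atlas, as functions of the coordinates \<open>x\<close> and related by the transformation law of a
  covariant 2-tensor.\<close>

type_synonym ('m, 'd) metric = "('m, 'd) chart \<Rightarrow> real^'d \<Rightarrow> real^'d^'d"

definition riemannian_metric ::
  "('m::topological_space, 'd::finite) chart set \<Rightarrow> ('m, 'd) metric \<Rightarrow> bool" where
  "riemannian_metric \<A> g \<longleftrightarrow>
     (\<forall>c\<in>smooth_charts \<A>. smooth_on (chart_image c) (g c) \<and>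
        (\<forall>x\<in>chart_image c. transpose (g c x) = g c x \<and> (\<forall>v. v \<noteq> 0 \<longrightarrow> v \<bullet> (g c x *v v) > 0))) \<and>
     (\<forall>c\<in>smooth_charts \<A>. \<forall>c'\<in>smooth_charts \<A>. \<forall>x\<in>overlap c c'.
        g c x = transpose (jacobian (transition c c') (at x)) ** g c' (transition c c' x)
                  ** jacobian (transition c c') (at x))"

text \<open>Christoffel symbols of the Levi-Civita connection; \<open>l\<close> is the upper index.\<close>

definition christoffel ::
  "('m, 'd::finite) metric \<Rightarrow> ('m, 'd) chart \<Rightarrow> 'd \<Rightarrow> 'd \<Rightarrow> 'd \<Rightarrow> real^'d \<Rightarrow> real" where
  "christoffel g c l j k x = (\<Sum>m\<in>UNIV. matrix_inv (g c x) $ l $ m *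
     (partial_deriv j (\<lambda>y. g c y $ m $ k) x + partial_deriv k (\<lambda>y. g c y $ m $ j) x
        - partial_deriv m (\<lambda>y. g c y $ j $ k) x)) / 2"

subsection \<open>Hypersurfaces and mean curvature\<close>

definition slice_chart ::
  "('m::topological_space, 'd::finite) chart set \<Rightarrow> 'm set \<Rightarrow> ('m, 'd) chart \<Rightarrow> 'd \<Rightarrow> bool" where
  "slice_chart \<A> \<Sigma> c i \<longleftrightarrow>
     c \<in> smooth_charts \<A> \<and> snd c ` (fst c \<inter> \<Sigma>) = {x \<in> chart_image c. x $ i = 0}"

definition closed_embedded_hypersurface ::
  "('m::topological_space, 'd::finite) chart set \<Rightarrow> 'm set \<Rightarrow> bool" where
  "closed_embedded_hypersurface \<A> \<Sigma> \<longleftrightarrow>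
     compact \<Sigma> \<and> (\<forall>p\<in>\<Sigma>. \<exists>c i. slice_chart \<A> \<Sigma> c i \<and> p \<in> fst c)"

text \<open>The following three notions are meant for a slice chart, in which the hypersurface is
  \<open>x $ i = 0\<close> with tangent frame \<open>\<partial>\<^sub>j\<close>, \<open>j \<noteq> i\<close>.  The unit normal is the one pointing to \<open>x $ i > 0\<close>;
  the other choice changes the sign of the mean curvature.\<close>

definition unit_normal :: "('m, 'd::finite) metric \<Rightarrow> ('m, 'd) chart \<Rightarrow> 'd \<Rightarrow> real^'d \<Rightarrow> real^'d" where
  "unit_normal g c i x = (THE \<nu>. (\<forall>v. v $ i = 0 \<longrightarrow> v \<bullet> (g c x *v \<nu>) = 0) \<and>
     \<nu> \<bullet> (g c x *v \<nu>) = 1 \<and> \<nu> $ i > 0)"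

text \<open>The second fundamental form \<open>g (\<nabla>\<^bsub>\<partial>\<^sub>j\<^esub> \<partial>\<^sub>k, \<nu>)\<close>.\<close>

definition second_fundamental_form ::
  "('m, 'd::finite) metric \<Rightarrow> ('m, 'd) chart \<Rightarrow> 'd \<Rightarrow> 'd \<Rightarrow> 'd \<Rightarrow> real^'d \<Rightarrow> real" where
  "second_fundamental_form g c i j k x =
     (\<chi> l. christoffel g c l j k x) \<bullet> (g c x *v unit_normal g c i x)"

text \<open>The induced metric on the tangent frame, padded to a square matrix over \<open>'d\<close> by a unit entry at
  \<open>(i, i)\<close>.  Its inverse restricts to the inverse of the induced metric.\<close>

definition induced_metric ::
  "('m, 'd::finite) metric \<Rightarrow> ('m, 'd) chart \<Rightarrow> 'd \<Rightarrow> real^'d \<Rightarrow> real^'d^'d" where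
  "induced_metric g c i x =
     (\<chi> j k. if j \<noteq> i \<and> k \<noteq> i then g c x $ j $ k else if j = k then 1 else 0)"

definition mean_curvature ::
  "('m, 'd::finite) metric \<Rightarrow> ('m, 'd) chart \<Rightarrow> 'd \<Rightarrow> real^'d \<Rightarrow> real" where
  "mean_curvature g c i x = (\<Sum>j\<in>-{i}. \<Sum>k\<in>-{i}.
     matrix_inv (induced_metric g c i x) $ j $ k * second_fundamental_form g c i j k x)"

text \<open>All derivatives along the hypersurface are expressed in the coordinates \<open>x $ j\<close>, \<open>j \<noteq> i\<close>, of
  slice charts; \<open>js = []\<close> gives the mean curvature itself.  The vanishing does not depend on the
  slice chart at \<open>p\<close>.\<close>

definition mean_curvature_vanishes_to_infinite_order ::
  "('m::topological_space, 'd::finite) chart set \<Rightarrow> ('m, 'd) metric \<Rightarrow> 'm set \<Rightarrow> 'm \<Rightarrow> bool" where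
  "mean_curvature_vanishes_to_infinite_order \<A> g \<Sigma> p \<longleftrightarrow>
     (\<forall>c i. slice_chart \<A> \<Sigma> c i \<and> p \<in> fst c \<longrightarrow>
        (\<forall>js. set js \<subseteq> -{i} \<longrightarrow> partial_derivs js (mean_curvature g c i) (snd c p) = 0))"

definition good_functions ::
  "('m::topological_space, 'd::finite) chart set \<Rightarrow> ('m, 'd) metric \<Rightarrow> ('m \<Rightarrow> real) set" where
  "good_functions \<A> g = {h. morse \<A> h \<and> closed_embedded_hypersurface \<A> {p. h p = 0} \<and>
     (\<forall>p. h p = 0 \<longrightarrow> \<not> mean_curvature_vanishes_to_infinite_order \<A> g {p. h p = 0} p)}"

end

theory Submission
  imports Defs
begin

text \<open>
The conditions on a good function \<open>h\<close> are brought into pointwise form: \<open>h\<close> is Morse at every point,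
\<open>0\<close> is a regular value, and the mean curvature of the zero set has finite order at every zero.
The regularity of \<open>0\<close> replaces the embeddedness of the zero set (\<open>good_functions_eq\<close>): a regular zero
set has slice charts in which \<open>h\<close> itself is a coordinate, and conversely, in a slice chart the Hessian
of a Morse function at a critical zero would vanish on a hyperplane, which a nondegenerate form in
dimension at least \<open>3\<close> cannot do (\<open>regular_on_hypersurface\<close>).

Everything about the mean curvature rests on one computation.  If \<open>\<partial>\<^sub>i f \<noteq> 0\<close> in some chart, replacing
the coordinate \<open>x $ i\<close> by \<open>f x\<close> gives another chart, in which the level sets of \<open>f\<close> are slices.  Its
coordinate fields are, in the old coordinates, explicit rational functions of the gradient of \<open>f\<close>, and
the mean curvature of the level sets becomes the trace of minus the covariant Hessian of \<open>f\<close> over the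
tangential fields, divided by the length of the gradient (\<open>mean_curvature_new_chart\<close>).  As flatness
is a statement about all slice charts, only these adapted charts have to be used in order to refute it.

Openness is local, because the manifold is compact (\<open>tube\<close>).  For the finite order of the mean curvature
one starts from a nonzero tangential derivative in an arbitrary slice chart.  The chart adapted to \<open>h\<^sub>0\<close>
has the same tangential coordinates on the zero set, hence up to a sign the same derivatives
(\<open>mean_curvature_derivs_on_slice\<close>), and in the charts adapted to functions \<open>h\<close> near \<open>h\<^sub>0\<close> these derivatives
depend continuously on \<open>h\<close> and the point (\<open>open_finite_order_at\<close>).

Density is reduced to small pieces of the manifold by perturbing piece after piece: by openness, small
later perturbations do not spoil what was achieved before (\<open>dense_from_local\<close>).  On one piece, a
finite-dimensional linear family of functions, cut off by a bump function, is added to \<open>h\<close>, and the bad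
parameters form a negligible set (\<open>generic_perturbation\<close>).  The dimension counts are made explicit by
solving for parameters: the bad ones are the values of a differentiable map on a space of smaller
dimension, or on a null set.  Affine functions make \<open>0\<close> a regular value (\<open>negligible_singular_zero\<close>), and
polynomials of degree two make the critical points nondegenerate (\<open>negligible_degenerate\<close>).  For the mean
curvature already the simultaneous vanishing of \<open>h\<close>, of the mean curvature and of its first
tangential derivatives is avoided (\<open>negligible_flat\<close>): these are \<open>d + 1\<close> equations for a point of a \<open>d\<close>-dimensional manifold.
The perturbations are sums of cubic polynomials in the single tangential coordinates; a second-order
coefficient is then determined by the vanishing of the mean curvature, and the cubic coefficients
by that of its derivatives.
\<close>

section \<open>Smooth families of functions\<close>

lemma matrix_inv_mult:
  fixes A :: "real^'n^'n"
  assumes "det A \<noteq> 0" shows "A ** matrix_inv A = mat 1" "matrix_inv A ** A = mat 1"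
  using assms invertible_det_nz[of A] someI_ex[of "\<lambda>B. A ** B = mat 1 \<and> B ** A = mat 1"]
  unfolding invertible_def matrix_inv_def by blast+

lemma matrix_inv_cramer:
  fixes M :: "real^'n^'n"
  assumes "det M \<noteq> 0"
  shows "matrix_inv M $ j $ k = det (\<chi> a b. if b = j then axis k 1 $ a else M $ a $ b) / det M"
proof -
  have "M ** matrix_inv M = mat 1" by (rule matrix_inv_mult(1)[OF assms])
  hence "M *v (matrix_inv M *v axis k 1) = axis k 1"
    by (simp add: matrix_vector_mul_assoc)
  hence "matrix_inv M *v axis k 1 = (\<chi> j. det (\<chi> a b. if b = j then axis k 1 $ a else M $ a $ b) / det M)"
    using cramer[OF assms] by blast
  thus ?thesis
    by (simp add: vec_eq_iff matrix_vector_mult_basis column_def)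
qed

lemma frechet_derivative_Basis_sum:
  fixes f :: "'a::euclidean_space \<Rightarrow> real"
  assumes "f differentiable (at x)"
  shows "frechet_derivative f (at x) v = (\<Sum>b\<in>Basis. (v \<bullet> b) * frechet_derivative f (at x) b)"
proof -
  interpret linear "frechet_derivative f (at x)"
    using assms by (simp add: linear_frechet_derivative)
  show ?thesis
    by (subst (1) euclidean_representation[of v, symmetric]) (simp add: sum scaleR)
qed

text \<open>A family of functions \<open>\<Theta> t\<close> is considered near the parameter \<open>t\<^sub>0\<close>, where convergence of the parameters is
described by the filter \<open>F\<close>.  In the application the parameters are themselves smooth functions on the
manifold and \<open>F\<close> is the neighbourhood filter of the smooth topology.\<close>

locale deformation =
  fixes F :: "'p filter" and N :: "'p set" and t\<^sub>0 :: 'p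
  assumes ev_N: "eventually (\<lambda>t. t \<in> N) F" and base_in: "t\<^sub>0 \<in> N"
begin

text \<open>Continuity is required in the parameter and the variable jointly, but only at \<open>t\<^sub>0\<close>; this is what lets a
derivative that is nonzero at \<open>(t\<^sub>0, x)\<close> stay nonzero nearby.\<close>

definition fam_C0 :: "'a::euclidean_space set \<Rightarrow> ('p \<Rightarrow> 'a \<Rightarrow> real) \<Rightarrow> bool" where
  "fam_C0 U \<Theta> \<longleftrightarrow> (\<forall>x\<in>U. ((\<lambda>z. \<Theta> (fst z) (snd z)) \<longlongrightarrow> \<Theta> t\<^sub>0 x) (F \<times>\<^sub>F nhds x))"

fun fam_Ck :: "nat \<Rightarrow> 'a::euclidean_space set \<Rightarrow> ('p \<Rightarrow> 'a \<Rightarrow> real) \<Rightarrow> bool" where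
  "fam_Ck 0 U \<Theta> \<longleftrightarrow> fam_C0 U \<Theta>"
| "fam_Ck (Suc k) U \<Theta> \<longleftrightarrow> fam_C0 U \<Theta> \<and> (\<forall>t\<in>N. \<forall>x\<in>U. \<Theta> t differentiable (at x)) \<and>
     (\<forall>v. fam_Ck k U (\<lambda>t x. frechet_derivative (\<Theta> t) (at x) v))"

definition fam_smooth :: "'a::euclidean_space set \<Rightarrow> ('p \<Rightarrow> 'a \<Rightarrow> real) \<Rightarrow> bool" where
  "fam_smooth U \<Theta> \<longleftrightarrow> (\<forall>k. fam_Ck k U \<Theta>)"

lemma fam_C0_cong:
  assumes "open U" "\<And>t x. t \<in> N \<Longrightarrow> x \<in> U \<Longrightarrow> \<Theta> t x = \<Psi> t x" "fam_C0 U \<Theta>"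
  shows "fam_C0 U \<Psi>"
  unfolding fam_C0_def
proof
  fix x assume x: "x \<in> U"
  have "eventually (\<lambda>z. fst z \<in> N \<and> snd z \<in> U) (F \<times>\<^sub>F nhds x)"
    using eventually_prodI[OF ev_N eventually_nhds_in_open[OF assms(1) x]] .
  hence "eventually (\<lambda>z. \<Theta> (fst z) (snd z) = \<Psi> (fst z) (snd z)) (F \<times>\<^sub>F nhds x)"
    by (rule eventually_mono) (use assms(2) in auto)
  moreover have "((\<lambda>z. \<Theta> (fst z) (snd z)) \<longlongrightarrow> \<Theta> t\<^sub>0 x) (F \<times>\<^sub>F nhds x)"
    using assms(3) x by (auto simp: fam_C0_def)
  ultimately have "((\<lambda>z. \<Psi> (fst z) (snd z)) \<longlongrightarrow> \<Theta> t\<^sub>0 x) (F \<times>\<^sub>F nhds x)"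
    using tendsto_cong by fast
  thus "((\<lambda>z. \<Psi> (fst z) (snd z)) \<longlongrightarrow> \<Psi> t\<^sub>0 x) (F \<times>\<^sub>F nhds x)"
    using assms(2)[OF base_in x] by simp
qed

lemma fam_Ck_cong:
  assumes "open U" "\<And>t x. t \<in> N \<Longrightarrow> x \<in> U \<Longrightarrow> \<Theta> t x = \<Psi> t x" "fam_Ck k U \<Theta>"
  shows "fam_Ck k U \<Psi>"
  using assms(2,3)
proof (induction k arbitrary: \<Theta> \<Psi>)
  case 0
  thus ?case using fam_C0_cong[OF assms(1), of \<Theta> \<Psi>] by simp
next
  case (Suc k)
  have d: "\<Psi> t differentiable (at x)" if "t \<in> N" "x \<in> U" for t x
  proof -
    have "(\<Theta> t has_derivative frechet_derivative (\<Theta> t) (at x)) (at x)"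
      using Suc.prems(2) that by (auto simp: frechet_derivative_works[symmetric])
    hence "(\<Psi> t has_derivative frechet_derivative (\<Theta> t) (at x)) (at x)"
      by (rule has_derivative_transform_within_open[OF _ assms(1)]) (use Suc.prems(1) that in auto)
    thus ?thesis by (auto simp: differentiable_def)
  qed
  have eq: "frechet_derivative (\<Theta> t) (at x) v = frechet_derivative (\<Psi> t) (at x) v"
    if "t \<in> N" "x \<in> U" for t x v
    using frechet_derivative_transform_within_open[of "\<Theta> t" x U "\<Psi> t"] assms(1) that Suc.prems by auto
  show ?case
    using Suc.prems(2) fam_C0_cong[OF assms(1), of \<Theta> \<Psi>] Suc.prems(1) d Suc.IH[OF eq] by simp
qed

lemma fam_Ck_SucD: "fam_Ck (Suc k) U \<Theta> \<Longrightarrow> fam_Ck k U \<Theta>"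
proof (induction k arbitrary: \<Theta>)
  case (Suc k)
  have "fam_Ck k U (\<lambda>t x. frechet_derivative (\<Theta> t) (at x) v)" for v
    by (rule Suc.IH) (use Suc.prems in auto)
  thus ?case using Suc.prems by auto
qed auto

lemma fam_smooth_cong:
  "open U \<Longrightarrow> (\<And>t x. t \<in> N \<Longrightarrow> x \<in> U \<Longrightarrow> \<Theta> t x = \<Psi> t x) \<Longrightarrow> fam_smooth U \<Theta> \<Longrightarrow> fam_smooth U \<Psi>"
  unfolding fam_smooth_def using fam_Ck_cong by blast

lemma fam_smooth_iff:
  "fam_smooth U \<Theta> \<longleftrightarrow> fam_C0 U \<Theta> \<and> (\<forall>t\<in>N. \<forall>x\<in>U. \<Theta> t differentiable (at x)) \<and>
     (\<forall>v. fam_smooth U (\<lambda>t x. frechet_derivative (\<Theta> t) (at x) v))"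
proof
  assume *: "fam_smooth U \<Theta>"
  hence "fam_Ck (Suc k) U \<Theta>" for k by (auto simp: fam_smooth_def)
  thus "fam_C0 U \<Theta> \<and> (\<forall>t\<in>N. \<forall>x\<in>U. \<Theta> t differentiable (at x)) \<and>
     (\<forall>v. fam_smooth U (\<lambda>t x. frechet_derivative (\<Theta> t) (at x) v))"
    by (simp add: fam_smooth_def)
next
  assume *: "fam_C0 U \<Theta> \<and> (\<forall>t\<in>N. \<forall>x\<in>U. \<Theta> t differentiable (at x)) \<and>
     (\<forall>v. fam_smooth U (\<lambda>t x. frechet_derivative (\<Theta> t) (at x) v))"
  have "fam_Ck k U \<Theta>" for k
    using * by (cases k) (auto simp: fam_smooth_def)
  thus "fam_smooth U \<Theta>" by (simp add: fam_smooth_def)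
qed

lemma fam_smooth_C0: "fam_smooth U \<Theta> \<Longrightarrow> fam_C0 U \<Theta>"
  and fam_smooth_differentiable: "fam_smooth U \<Theta> \<Longrightarrow> t \<in> N \<Longrightarrow> x \<in> U \<Longrightarrow> \<Theta> t differentiable (at x)"
  and fam_smooth_frechet: "fam_smooth U \<Theta> \<Longrightarrow> fam_smooth U (\<lambda>t x. frechet_derivative (\<Theta> t) (at x) v)"
  using fam_smooth_iff[of U \<Theta>] by simp_all

lemma fam_C0_subset: "V \<subseteq> U \<Longrightarrow> fam_C0 U \<Theta> \<Longrightarrow> fam_C0 V \<Theta>"
  unfolding fam_C0_def by blast

lemma fam_Ck_subset: "V \<subseteq> U \<Longrightarrow> fam_Ck k U \<Theta> \<Longrightarrow> fam_Ck k V \<Theta>"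
proof (induction k arbitrary: \<Theta>)
  case (Suc k)
  have "fam_Ck k V (\<lambda>t x. frechet_derivative (\<Theta> t) (at x) v)" for v
    by (rule Suc.IH) (use Suc.prems in auto)
  thus ?case using Suc.prems fam_C0_subset by auto
qed (auto intro: fam_C0_subset)

lemma fam_smooth_subset: "V \<subseteq> U \<Longrightarrow> fam_smooth U \<Theta> \<Longrightarrow> fam_smooth V \<Theta>"
  unfolding fam_smooth_def using fam_Ck_subset by blast

lemma fam_Ck_const: "fam_Ck k U (\<lambda>t x. c)"
  by (induction k arbitrary: c) (auto simp: fam_C0_def)

lemma fam_Ck_add:
  assumes "open U" "fam_Ck k U \<Theta>" "fam_Ck k U \<Psi>"
  shows "fam_Ck k U (\<lambda>t x. \<Theta> t x + \<Psi> t x)"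
  using assms(2,3)
proof (induction k arbitrary: \<Theta> \<Psi>)
  case 0
  thus ?case by (auto simp: fam_C0_def intro!: tendsto_add)
next
  case (Suc k)
  have "fam_Ck k U (\<lambda>t x. frechet_derivative (\<lambda>x. \<Theta> t x + \<Psi> t x) (at x) v)" for v
  proof (rule fam_Ck_cong[OF assms(1)])
    show "fam_Ck k U (\<lambda>t x. frechet_derivative (\<Theta> t) (at x) v + frechet_derivative (\<Psi> t) (at x) v)"
      using Suc by auto
    fix t x assume "t \<in> N" "x \<in> U"
    hence "(\<Theta> t has_derivative frechet_derivative (\<Theta> t) (at x)) (at x)"
       "(\<Psi> t has_derivative frechet_derivative (\<Psi> t) (at x)) (at x)"
      using Suc.prems by (auto simp: frechet_derivative_works[symmetric])
    from frechet_derivative_at[OF has_derivative_add[OF this]]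
    show "frechet_derivative (\<Theta> t) (at x) v + frechet_derivative (\<Psi> t) (at x) v =
      frechet_derivative (\<lambda>x. \<Theta> t x + \<Psi> t x) (at x) v" by metis
  qed
  moreover have "fam_C0 U (\<lambda>t x. \<Theta> t x + \<Psi> t x)"
    using Suc.prems by (auto simp: fam_C0_def intro!: tendsto_add)
  ultimately show ?case using Suc.prems by auto
qed

lemma fam_Ck_mult:
  assumes "open U" "fam_Ck k U \<Theta>" "fam_Ck k U \<Psi>"
  shows "fam_Ck k U (\<lambda>t x. \<Theta> t x * \<Psi> t x)"
  using assms(2,3)
proof (induction k arbitrary: \<Theta> \<Psi>)
  case 0
  thus ?case by (auto simp: fam_C0_def intro!: tendsto_mult)
next
  case (Suc k)
  have "fam_Ck k U (\<lambda>t x. frechet_derivative (\<lambda>x. \<Theta> t x * \<Psi> t x) (at x) v)" for v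
  proof (rule fam_Ck_cong[OF assms(1)])
    show "fam_Ck k U (\<lambda>t x. \<Theta> t x * frechet_derivative (\<Psi> t) (at x) v + frechet_derivative (\<Theta> t) (at x) v * \<Psi> t x)"
      by (intro fam_Ck_add[OF assms(1)] Suc.IH) (use Suc.prems fam_Ck_SucD[OF Suc.prems(1)] fam_Ck_SucD[OF Suc.prems(2)] in simp_all)
    fix t x assume "t \<in> N" "x \<in> U"
    hence "(\<Theta> t has_derivative frechet_derivative (\<Theta> t) (at x)) (at x)"
       "(\<Psi> t has_derivative frechet_derivative (\<Psi> t) (at x)) (at x)"
      using Suc.prems by (auto simp: frechet_derivative_works[symmetric])
    from frechet_derivative_at[OF has_derivative_mult[OF this]]
    show "\<Theta> t x * frechet_derivative (\<Psi> t) (at x) v + frechet_derivative (\<Theta> t) (at x) v * \<Psi> t x =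
      frechet_derivative (\<lambda>x. \<Theta> t x * \<Psi> t x) (at x) v" by metis
  qed
  moreover have "fam_C0 U (\<lambda>t x. \<Theta> t x * \<Psi> t x)"
    using Suc.prems by (auto simp: fam_C0_def intro!: tendsto_mult)
  ultimately show ?case using Suc.prems by auto
qed

lemma fam_Ck_inverse:
  assumes "open U" "fam_Ck k U \<Theta>" "\<And>t x. t \<in> N \<Longrightarrow> x \<in> U \<Longrightarrow> \<Theta> t x \<noteq> 0"
  shows "fam_Ck k U (\<lambda>t x. inverse (\<Theta> t x))"
  using assms(2)
proof (induction k)
  case 0
  thus ?case using assms(3) base_in by (auto simp: fam_C0_def intro!: tendsto_inverse)
next
  case (Suc k)
  have d: "((\<lambda>x. inverse (\<Theta> t x)) has_derivative
      (\<lambda>h. - (inverse (\<Theta> t x) * frechet_derivative (\<Theta> t) (at x) h * inverse (\<Theta> t x)))) (at x)"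
    if "t \<in> N" "x \<in> U" for t x
    by (rule Deriv.has_derivative_inverse) (use Suc.prems assms(3) that in \<open>auto simp: frechet_derivative_works[symmetric]\<close>)
  have "fam_Ck k U (\<lambda>t x. frechet_derivative (\<lambda>x. inverse (\<Theta> t x)) (at x) v)" for v
  proof (rule fam_Ck_cong[OF assms(1)])
    show "fam_Ck k U (\<lambda>t x. (-1) * (inverse (\<Theta> t x) * frechet_derivative (\<Theta> t) (at x) v * inverse (\<Theta> t x)))"
      by (intro fam_Ck_mult[OF assms(1)] fam_Ck_const Suc.IH) (use Suc.prems fam_Ck_SucD[OF Suc.prems] in simp_all)
    fix t x assume "t \<in> N" "x \<in> U"
    from frechet_derivative_at[OF d[OF this]]
    show "(-1) * (inverse (\<Theta> t x) * frechet_derivative (\<Theta> t) (at x) v * inverse (\<Theta> t x)) =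
      frechet_derivative (\<lambda>x. inverse (\<Theta> t x)) (at x) v" by (metis mult_minus1)
  qed
  moreover have "fam_C0 U (\<lambda>t x. inverse (\<Theta> t x))"
    using Suc.prems assms(3) base_in by (auto simp: fam_C0_def intro!: tendsto_inverse)
  ultimately show ?case using d by (auto simp: differentiable_def)
qed

lemma fam_Ck_sqrt:
  assumes "open U" "fam_Ck k U \<Theta>" "\<And>t x. t \<in> N \<Longrightarrow> x \<in> U \<Longrightarrow> \<Theta> t x > 0"
  shows "fam_Ck k U (\<lambda>t x. sqrt (\<Theta> t x))"
  using assms(2)
proof (induction k)
  case 0
  thus ?case by (auto simp: fam_C0_def intro!: tendsto_real_sqrt)
next
  case (Suc k)
  have d: "((\<lambda>x. sqrt (\<Theta> t x)) has_derivative
      (\<lambda>h. frechet_derivative (\<Theta> t) (at x) h * (inverse (sqrt (\<Theta> t x)) / 2))) (at x)"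
    if "t \<in> N" "x \<in> U" for t x
    by (rule DERIV_compose_FDERIV[where f = sqrt])
       (use Suc.prems assms(3) that in \<open>auto simp: frechet_derivative_works[symmetric] intro!: DERIV_real_sqrt\<close>)
  have "fam_Ck k U (\<lambda>t x. frechet_derivative (\<lambda>x. sqrt (\<Theta> t x)) (at x) v)" for v
  proof (rule fam_Ck_cong[OF assms(1)])
    have "sqrt (\<Theta> t x) \<noteq> 0" if "t \<in> N" "x \<in> U" for t x
      using assms(3)[OF that] by simp
    thus "fam_Ck k U (\<lambda>t x. frechet_derivative (\<Theta> t) (at x) v * (inverse (sqrt (\<Theta> t x)) * (1/2)))"
      by (intro fam_Ck_mult[OF assms(1)] fam_Ck_const fam_Ck_inverse[OF assms(1)] Suc.IH)
         (use Suc.prems fam_Ck_SucD[OF Suc.prems] in simp_all)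
    fix t x assume "t \<in> N" "x \<in> U"
    from frechet_derivative_at[OF d[OF this]]
    have "frechet_derivative (\<lambda>x. sqrt (\<Theta> t x)) (at x) v = frechet_derivative (\<Theta> t) (at x) v * (inverse (sqrt (\<Theta> t x)) / 2)"
      by metis
    thus "frechet_derivative (\<Theta> t) (at x) v * (inverse (sqrt (\<Theta> t x)) * (1/2)) =
      frechet_derivative (\<lambda>x. sqrt (\<Theta> t x)) (at x) v" by simp
  qed
  moreover have "fam_C0 U (\<lambda>t x. sqrt (\<Theta> t x))"
    using Suc.prems by (auto simp: fam_C0_def intro!: tendsto_real_sqrt)
  ultimately show ?case using d by (auto simp: differentiable_def)
qed

lemma fam_smooth_const [intro]: "fam_smooth U (\<lambda>t x. c)"
  and fam_smooth_add: "open U \<Longrightarrow> fam_smooth U \<Theta> \<Longrightarrow> fam_smooth U \<Psi> \<Longrightarrow> fam_smooth U (\<lambda>t x. \<Theta> t x + \<Psi> t x)"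
  and fam_smooth_mult: "open U \<Longrightarrow> fam_smooth U \<Theta> \<Longrightarrow> fam_smooth U \<Psi> \<Longrightarrow> fam_smooth U (\<lambda>t x. \<Theta> t x * \<Psi> t x)"
  and fam_smooth_inverse: "open U \<Longrightarrow> fam_smooth U \<Theta> \<Longrightarrow> (\<And>t x. t \<in> N \<Longrightarrow> x \<in> U \<Longrightarrow> \<Theta> t x \<noteq> 0) \<Longrightarrow>
     fam_smooth U (\<lambda>t x. inverse (\<Theta> t x))"
  and fam_smooth_sqrt: "open U \<Longrightarrow> fam_smooth U \<Theta> \<Longrightarrow> (\<And>t x. t \<in> N \<Longrightarrow> x \<in> U \<Longrightarrow> \<Theta> t x > 0) \<Longrightarrow>
     fam_smooth U (\<lambda>t x. sqrt (\<Theta> t x))"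
  unfolding fam_smooth_def
  by (auto intro: fam_Ck_const fam_Ck_add fam_Ck_mult fam_Ck_inverse fam_Ck_sqrt)

lemma fam_smooth_minus: "open U \<Longrightarrow> fam_smooth U \<Theta> \<Longrightarrow> fam_smooth U (\<lambda>t x. - \<Theta> t x)"
  using fam_smooth_mult[OF _ fam_smooth_const[where c = "-1"]] by fastforce

lemma fam_smooth_diff:
  "open U \<Longrightarrow> fam_smooth U \<Theta> \<Longrightarrow> fam_smooth U \<Psi> \<Longrightarrow> fam_smooth U (\<lambda>t x. \<Theta> t x - \<Psi> t x)"
  using fam_smooth_add[OF _ _ fam_smooth_minus] by fastforce

lemma fam_smooth_divide:
  "open U \<Longrightarrow> fam_smooth U \<Theta> \<Longrightarrow> fam_smooth U \<Psi> \<Longrightarrow> (\<And>t x. t \<in> N \<Longrightarrow> x \<in> U \<Longrightarrow> \<Psi> t x \<noteq> 0) \<Longrightarrow>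
     fam_smooth U (\<lambda>t x. \<Theta> t x / \<Psi> t x)"
  unfolding divide_inverse by (intro fam_smooth_mult fam_smooth_inverse)

lemma fam_smooth_sum:
  "open U \<Longrightarrow> (\<And>a. a \<in> A \<Longrightarrow> fam_smooth U (\<Theta> a)) \<Longrightarrow> fam_smooth U (\<lambda>t x. \<Sum>a\<in>A. \<Theta> a t x)"
proof (induction A rule: infinite_finite_induct)
  case (insert a A)
  thus ?case by (auto intro!: fam_smooth_add)
qed (auto intro!: fam_smooth_const)

lemma fam_smooth_prod:
  "open U \<Longrightarrow> (\<And>a. a \<in> A \<Longrightarrow> fam_smooth U (\<Theta> a)) \<Longrightarrow> fam_smooth U (\<lambda>t x. \<Prod>a\<in>A. \<Theta> a t x)"
proof (induction A rule: infinite_finite_induct)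
  case (insert a A)
  thus ?case by (auto intro!: fam_smooth_mult)
qed (auto intro!: fam_smooth_const)

lemma fam_smooth_det:
  fixes M :: "'p \<Rightarrow> 'a::euclidean_space \<Rightarrow> real^'n^'n"
  assumes "open U" "\<And>j k. fam_smooth U (\<lambda>t x. M t x $ j $ k)"
  shows "fam_smooth U (\<lambda>t x. det (M t x))"
  unfolding det_def by (intro fam_smooth_sum fam_smooth_mult fam_smooth_prod fam_smooth_const assms)

text \<open>Cramer's rule makes the inverse of a matrix a rational function of its entries.\<close>

lemma fam_smooth_matrix_inv:
  fixes M :: "'p \<Rightarrow> 'a::euclidean_space \<Rightarrow> real^'n^'n"
  assumes "open U" "\<And>j k. fam_smooth U (\<lambda>t x. M t x $ j $ k)"
    and "\<And>t x. t \<in> N \<Longrightarrow> x \<in> U \<Longrightarrow> det (M t x) \<noteq> 0"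
  shows "fam_smooth U (\<lambda>t x. matrix_inv (M t x) $ j $ k)"
proof (rule fam_smooth_cong[OF assms(1)])
  show "fam_smooth U (\<lambda>t x. det (\<chi> a b. if b = j then axis k 1 $ a else M t x $ a $ b) / det (M t x))"
  proof (intro fam_smooth_divide[OF assms(1)] fam_smooth_det[OF assms(1)] assms)
    fix a b
    show "fam_smooth U (\<lambda>t x. (\<chi> a b. if b = j then axis k 1 $ a else M t x $ a $ b) $ a $ b)"
      using assms(2) by (cases "b = j") auto
  qed
qed (simp add: assms(3) matrix_inv_cramer)

lemma fam_Ck_compose:
  fixes \<sigma> :: "'b::euclidean_space \<Rightarrow> 'a::euclidean_space"
  assumes "open V" "open U" "\<sigma> ` U \<subseteq> V" "fam_Ck k V \<Theta>"
    and "\<And>b. b \<in> Basis \<Longrightarrow> fam_Ck k U (\<lambda>t x. \<sigma> x \<bullet> b)"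
    and "continuous_on U \<sigma>"
  shows "fam_Ck k U (\<lambda>t x. \<Theta> t (\<sigma> x))"
  using assms(4,5)
proof (induction k arbitrary: \<Theta>)
  have C0: "fam_C0 U (\<lambda>t x. \<Theta> t (\<sigma> x))" if "fam_C0 V \<Theta>" for \<Theta>
    unfolding fam_C0_def
  proof
    fix x assume x: "x \<in> U"
    have "isCont \<sigma> x" using assms(2,6) x continuous_on_eq_continuous_at by blast
    hence "filterlim \<sigma> (nhds (\<sigma> x)) (nhds x)"
      by (simp add: isCont_def tendsto_at_iff_tendsto_nhds)
    hence "filterlim (\<lambda>z. (fst z, \<sigma> (snd z))) (F \<times>\<^sub>F nhds (\<sigma> x)) (F \<times>\<^sub>F nhds x)"
      by (intro filterlim_Pair filterlim_fst filterlim_compose[OF _ filterlim_snd])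
    from filterlim_compose[OF _ this, of "\<lambda>z. \<Theta> (fst z) (snd z)" "nhds (\<Theta> t\<^sub>0 (\<sigma> x))"]
    show "((\<lambda>z. \<Theta> (fst z) (\<sigma> (snd z))) \<longlongrightarrow> \<Theta> t\<^sub>0 (\<sigma> x)) (F \<times>\<^sub>F nhds x)"
      using that x assms(3) by (auto simp: fam_C0_def)
  qed
  {
    case 0
    thus ?case using C0 by simp
  next
    case (Suc k)
    have d\<sigma>: "\<sigma> differentiable (at x)" if "x \<in> U" for x
      using Suc.prems(2) that base_in by (subst differentiable_componentwise_within) auto
    have d: "((\<lambda>x. \<Theta> t (\<sigma> x)) has_derivative
        frechet_derivative (\<Theta> t) (at (\<sigma> x)) \<circ> frechet_derivative \<sigma> (at x)) (at x)"
      if "t \<in> N" "x \<in> U" for t x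
      using diff_chain_at[of \<sigma> "frechet_derivative \<sigma> (at x)" x "\<Theta> t"] d\<sigma> that Suc.prems(1) assms(3)
      by (auto simp: frechet_derivative_works[symmetric] o_def image_subset_iff)
    have \<sigma>': "frechet_derivative \<sigma> (at x) v \<bullet> b = frechet_derivative (\<lambda>x. \<sigma> x \<bullet> b) (at x) v" if "x \<in> U" for x b v
    proof -
      have "((\<lambda>x. \<sigma> x \<bullet> b) has_derivative (\<lambda>v. frechet_derivative \<sigma> (at x) v \<bullet> b)) (at x)"
        using d\<sigma>[OF that] by (intro has_derivative_inner_left) (simp add: frechet_derivative_works[symmetric])
      from frechet_derivative_at[OF this] show ?thesis by metis
    qed
    have "fam_Ck k U (\<lambda>t x. frechet_derivative (\<lambda>x. \<Theta> t (\<sigma> x)) (at x) v)" for v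
    proof (rule fam_Ck_cong[OF assms(2)])
      have sm: "fam_Ck k U (\<lambda>t x. \<Sum>b\<in>A. h b t x)" if "\<And>b. b \<in> A \<Longrightarrow> fam_Ck k U (h b)" for A :: "'a set" and h
        using that by (induction A rule: infinite_finite_induct) (auto intro: fam_Ck_const fam_Ck_add[OF assms(2)])
      show "fam_Ck k U (\<lambda>t x. \<Sum>b\<in>Basis. frechet_derivative (\<lambda>x. \<sigma> x \<bullet> b) (at x) v * frechet_derivative (\<Theta> t) (at (\<sigma> x)) b)"
      proof (intro sm fam_Ck_mult[OF assms(2)])
        fix b :: 'a assume b: "b \<in> Basis"
        show "fam_Ck k U (\<lambda>t x. frechet_derivative (\<lambda>x. \<sigma> x \<bullet> b) (at x) v)"
          using Suc.prems(2)[OF b] by simp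
        show "fam_Ck k U (\<lambda>t x. frechet_derivative (\<Theta> t) (at (\<sigma> x)) b)"
          by (rule Suc.IH) (use Suc.prems fam_Ck_SucD[OF Suc.prems(2)] in simp_all)
      qed
      fix t x assume tx: "t \<in> N" "x \<in> U"
      have "\<Theta> t differentiable (at (\<sigma> x))" using Suc.prems(1) tx assms(3) by auto
      note sum_rep = frechet_derivative_Basis_sum[OF this, of "frechet_derivative \<sigma> (at x) v"]
      have "frechet_derivative (\<lambda>x. \<Theta> t (\<sigma> x)) (at x) v
          = frechet_derivative (\<Theta> t) (at (\<sigma> x)) (frechet_derivative \<sigma> (at x) v)"
        using fun_cong[OF frechet_derivative_at[OF d[OF tx]], of v] by simp
      thus "(\<Sum>b\<in>Basis. frechet_derivative (\<lambda>x. \<sigma> x \<bullet> b) (at x) v * frechet_derivative (\<Theta> t) (at (\<sigma> x)) b)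
        = frechet_derivative (\<lambda>x. \<Theta> t (\<sigma> x)) (at x) v"
        using \<sigma>'[OF tx(2)] sum_rep by simp
    qed
    thus ?case using d C0 Suc.prems by (auto simp: differentiable_def)
  }
qed

end

text \<open>The one-point parameter space turns statements on families into statements on single functions, so the
calculus is developed only once.\<close>

interpretation plain: deformation "top :: unit filter" UNIV "()"
  by standard auto

lemma Ck_on_cong:
  assumes "open U" "\<And>x. x \<in> U \<Longrightarrow> f x = g x" "Ck_on k U f"
  shows "Ck_on k U g"
  using assms(2,3)
proof (induction k arbitrary: f g)
  case 0
  thus ?case using continuous_on_cong[of U U f g] by simp
next
  case (Suc k)
  have d: "g differentiable (at x)" if "x \<in> U" for x
    using has_derivative_transform_within_open[OF _ assms(1) that, of f "frechet_derivative f (at x)" UNIV g] Suc.prems that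
    by (auto simp: frechet_derivative_works[symmetric] differentiable_def frechet_derivative_works)
  have "Ck_on k U (\<lambda>x. frechet_derivative g (at x) v)" for v
  proof (rule Suc.IH)
    show "Ck_on k U (\<lambda>x. frechet_derivative f (at x) v)" using Suc.prems by simp
    fix x assume "x \<in> U"
    thus "frechet_derivative f (at x) v = frechet_derivative g (at x) v"
      using frechet_derivative_transform_within_open[of f x U g] assms(1) Suc.prems by simp
  qed
  with d show ?case by simp
qed

text \<open>Differentiability at a point refers to the whole space, so only continuity needs the neighbourhood.\<close>

lemma Ck_on_local:
  assumes "\<And>x. x \<in> U \<Longrightarrow> \<exists>V. open V \<and> x \<in> V \<and> Ck_on k V f"
  shows "Ck_on k U f"
  using assms
proof (induction k arbitrary: f)
  case 0
  thus ?case
    by (metis Ck_on.simps(1) continuous_at_imp_continuous_on continuous_on_eq_continuous_at)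
next
  case (Suc k)
  have "Ck_on k U (\<lambda>x. frechet_derivative f (at x) v)" for v
    by (rule Suc.IH) (use Suc.prems in fastforce)
  thus ?case using Suc.prems by fastforce
qed

lemma Ck_on_componentwise:
  fixes f :: "'a::euclidean_space \<Rightarrow> 'b::euclidean_space"
  assumes "open U"
  shows "Ck_on k U f \<longleftrightarrow> (\<forall>b\<in>Basis. Ck_on k U (\<lambda>x. f x \<bullet> b))"
proof (induction k arbitrary: f)
  case 0
  show ?case by (simp add: continuous_on_componentwise[of U f])
next
  case (Suc k)
  have eq: "frechet_derivative f (at x) v \<bullet> b = frechet_derivative (\<lambda>x. f x \<bullet> b) (at x) v"
    if "f differentiable (at x)" for x v b
  proof -
    have "((\<lambda>x. f x \<bullet> b) has_derivative (\<lambda>v. frechet_derivative f (at x) v \<bullet> b)) (at x)"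
      using that by (intro has_derivative_inner_left) (simp add: frechet_derivative_works[symmetric])
    from fun_cong[OF frechet_derivative_at[OF this]] show ?thesis .
  qed
  have *: "f differentiable (at x) \<longleftrightarrow> (\<forall>b\<in>Basis. (\<lambda>x. f x \<bullet> b) differentiable (at x))" for x
    by (rule differentiable_componentwise_within)
  show ?case
  proof (cases "\<forall>x\<in>U. f differentiable (at x)")
    case True
    have "Ck_on k U (\<lambda>x. frechet_derivative f (at x) v \<bullet> b) = Ck_on k U (\<lambda>x. frechet_derivative (\<lambda>x. f x \<bullet> b) (at x) v)" for v b
      using Ck_on_cong[OF assms] eq True by (metis (no_types, lifting))
    thus ?thesis using True * by (auto simp: Suc.IH)
  next
    case False
    thus ?thesis using * by auto
  qed
qed

lemma plain_C0_iff:
  assumes "open U"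
  shows "plain.fam_C0 U (\<lambda>_. f) \<longleftrightarrow> continuous_on U f"
proof -
  have "((\<lambda>z. f (snd z)) \<longlongrightarrow> f x) ((top :: unit filter) \<times>\<^sub>F nhds x) \<longleftrightarrow> isCont f x" for x
  proof
    assume *: "((\<lambda>z. f (snd z)) \<longlongrightarrow> f x) ((top :: unit filter) \<times>\<^sub>F nhds x)"
    have "filterlim (\<lambda>y. ((), y)) ((top :: unit filter) \<times>\<^sub>F nhds x) (nhds x)"
      by (intro filterlim_Pair filterlim_ident) simp
    from filterlim_compose[OF * this] show "isCont f x"
      by (simp add: isCont_def tendsto_at_iff_tendsto_nhds)
  next
    assume "isCont f x"
    hence "(f \<longlongrightarrow> f x) (nhds x)" by (simp add: isCont_def tendsto_at_iff_tendsto_nhds)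
    from filterlim_compose[OF this filterlim_snd]
    show "((\<lambda>z. f (snd z)) \<longlongrightarrow> f x) ((top :: unit filter) \<times>\<^sub>F nhds x)" .
  qed
  thus ?thesis using assms by (simp add: plain.fam_C0_def continuous_on_eq_continuous_at)
qed

lemma plain_Ck_iff:
  assumes "open U"
  shows "plain.fam_Ck k U (\<lambda>_. f) \<longleftrightarrow> Ck_on k U f"
proof (induction k arbitrary: f)
  case (Suc k)
  have "continuous_on U f" if "\<forall>x\<in>U. f differentiable (at x)"
    using that by (meson continuous_at_imp_continuous_on differentiable_imp_continuous_within)
  thus ?case by (auto simp: Suc.IH plain_C0_iff[OF assms])
qed (simp add: plain_C0_iff[OF assms])

lemma plain_smooth_iff: "open U \<Longrightarrow> plain.fam_smooth U (\<lambda>_. f) \<longleftrightarrow> smooth_on U f"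
  by (simp add: plain.fam_smooth_def smooth_on_def plain_Ck_iff)

lemma smooth_on_cong: "open U \<Longrightarrow> (\<And>x. x \<in> U \<Longrightarrow> f x = g x) \<Longrightarrow> smooth_on U f \<Longrightarrow> smooth_on U g"
  unfolding smooth_on_def using Ck_on_cong by blast

lemma smooth_on_local:
  "(\<And>x. x \<in> U \<Longrightarrow> \<exists>V. open V \<and> x \<in> V \<and> smooth_on V f) \<Longrightarrow> smooth_on U f"
  unfolding smooth_on_def by (meson Ck_on_local)

lemma smooth_on_componentwise:
  fixes f :: "'a::euclidean_space \<Rightarrow> 'b::euclidean_space"
  shows "open U \<Longrightarrow> smooth_on U f \<longleftrightarrow> (\<forall>b\<in>Basis. smooth_on U (\<lambda>x. f x \<bullet> b))"
  unfolding smooth_on_def using Ck_on_componentwise by blast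

lemma smooth_on_vec_iff:
  fixes f :: "'a::euclidean_space \<Rightarrow> 'b::euclidean_space^'d"
  assumes "open U" shows "smooth_on U f \<longleftrightarrow> (\<forall>j. smooth_on U (\<lambda>x. f x $ j))"
proof -
  have "(\<forall>b\<in>Basis. smooth_on U (\<lambda>x. f x \<bullet> b)) \<longleftrightarrow> (\<forall>j. \<forall>u\<in>Basis. smooth_on U (\<lambda>x. f x $ j \<bullet> u))"
    by (auto simp: Basis_vec_def inner_axis)
  moreover have "smooth_on U (\<lambda>x. f x $ j) \<longleftrightarrow> (\<forall>u\<in>Basis. smooth_on U (\<lambda>x. f x $ j \<bullet> u))" for j
    by (rule smooth_on_componentwise[OF assms])
  ultimately show ?thesis
    using smooth_on_componentwise[OF assms, of f] by simp
qed

lemma Ck_on_subset: "V \<subseteq> U \<Longrightarrow> Ck_on k U f \<Longrightarrow> Ck_on k V f"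
proof (induction k arbitrary: f)
  case (Suc k)
  have "Ck_on k V (\<lambda>x. frechet_derivative f (at x) v)" for v
    by (rule Suc.IH) (use Suc.prems in auto)
  thus ?case using Suc.prems by auto
qed (simp add: continuous_on_subset)

lemma smooth_on_subset: "V \<subseteq> U \<Longrightarrow> smooth_on U f \<Longrightarrow> smooth_on V f"
  unfolding smooth_on_def using Ck_on_subset by blast

lemma smooth_on_differentiable: "smooth_on U f \<Longrightarrow> x \<in> U \<Longrightarrow> f differentiable (at x)"
  by (metis Ck_on.simps(2) smooth_on_def)

lemma smooth_on_frechet: "smooth_on U f \<Longrightarrow> smooth_on U (\<lambda>x. frechet_derivative f (at x) v)"
  by (metis Ck_on.simps(2) smooth_on_def)

lemma smooth_on_has_derivative:
  "smooth_on U f \<Longrightarrow> x \<in> U \<Longrightarrow> (f has_derivative frechet_derivative f (at x)) (at x)"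
  using smooth_on_differentiable frechet_derivative_works by blast

lemma smooth_on_continuous: "smooth_on U f \<Longrightarrow> continuous_on U f"
  using smooth_on_def Ck_on.simps(1) by blast

lemma smooth_on_differentiable_on: "smooth_on U f \<Longrightarrow> f differentiable_on U"
  using smooth_on_differentiable differentiable_at_imp_differentiable_on by blast

lemma smooth_on_const [simp]: "smooth_on U (\<lambda>x. c)"
proof -
  have "Ck_on k U (\<lambda>x. c)" for k by (induction k arbitrary: c) auto
  thus ?thesis by (simp add: smooth_on_def)
qed

lemma smooth_on_linear:
  assumes "bounded_linear f" shows "smooth_on U f"
proof -
  have eq: "frechet_derivative f (at x) = f" for x
    using bounded_linear_imp_has_derivative[OF assms] frechet_derivative_at by metis
  have "Ck_on k U f" for k
  proof (cases k)
    case 0 thus ?thesis using assms by (simp add: linear_continuous_on)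
  next
    case (Suc n)
    have "Ck_on n U (\<lambda>x. f v)" for v using smooth_on_const smooth_on_def by blast
    thus ?thesis using Suc assms
      by (simp add: eq bounded_linear_imp_differentiable)
  qed
  thus ?thesis by (simp add: smooth_on_def)
qed

context
  fixes U :: "'a::euclidean_space set"
  assumes U: "open U"
begin

lemma smooth_on_add: "smooth_on U f \<Longrightarrow> smooth_on U g \<Longrightarrow> smooth_on U (\<lambda>x. f x + g x :: real)"
  using plain.fam_smooth_add[OF U, of "\<lambda>_. f" "\<lambda>_. g"] by (simp add: plain_smooth_iff[OF U])

lemma smooth_on_mult: "smooth_on U f \<Longrightarrow> smooth_on U g \<Longrightarrow> smooth_on U (\<lambda>x. f x * g x :: real)"
  using plain.fam_smooth_mult[OF U, of "\<lambda>_. f" "\<lambda>_. g"] by (simp add: plain_smooth_iff[OF U])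

lemma smooth_on_diff: "smooth_on U f \<Longrightarrow> smooth_on U g \<Longrightarrow> smooth_on U (\<lambda>x. f x - g x :: real)"
  using plain.fam_smooth_diff[OF U, of "\<lambda>_. f" "\<lambda>_. g"] by (simp add: plain_smooth_iff[OF U])

lemma smooth_on_minus: "smooth_on U f \<Longrightarrow> smooth_on U (\<lambda>x. - f x :: real)"
  using plain.fam_smooth_minus[OF U, of "\<lambda>_. f"] by (simp add: plain_smooth_iff[OF U])

lemma smooth_on_divide: "smooth_on U f \<Longrightarrow> smooth_on U g \<Longrightarrow> (\<And>x. x \<in> U \<Longrightarrow> g x \<noteq> 0) \<Longrightarrow>
    smooth_on U (\<lambda>x. f x / g x :: real)"
  using plain.fam_smooth_divide[OF U, of "\<lambda>_. f" "\<lambda>_. g"] by (simp add: plain_smooth_iff[OF U])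

lemma smooth_on_sum: "(\<And>a. a \<in> A \<Longrightarrow> smooth_on U (h a)) \<Longrightarrow> smooth_on U (\<lambda>x. \<Sum>a\<in>A. h a x :: real)"
  using plain.fam_smooth_sum[OF U, of A "\<lambda>a _. h a"] by (simp add: plain_smooth_iff[OF U])

lemma smooth_on_power: "smooth_on U f \<Longrightarrow> smooth_on U (\<lambda>x. f x ^ n :: real)"
  by (induction n) (auto intro: smooth_on_mult)

lemma smooth_on_matrix_inv:
  fixes M :: "'a \<Rightarrow> real^'n^'n"
  shows "(\<And>j k. smooth_on U (\<lambda>x. M x $ j $ k)) \<Longrightarrow> (\<And>x. x \<in> U \<Longrightarrow> det (M x) \<noteq> 0) \<Longrightarrow>
    smooth_on U (\<lambda>x. matrix_inv (M x) $ j $ k)"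
  using plain.fam_smooth_matrix_inv[OF U, of "\<lambda>_. M" j k] by (simp add: plain_smooth_iff[OF U])

lemma smooth_on_compose:
  fixes f :: "'b::euclidean_space \<Rightarrow> 'c::euclidean_space"
  assumes V: "open V" and f: "smooth_on V f" and g: "smooth_on U g" and im: "g ` U \<subseteq> V"
  shows "smooth_on U (\<lambda>x. f (g x))"
proof -
  have "smooth_on U (\<lambda>x. f (g x) \<bullet> b)" if b: "b \<in> Basis" for b
  proof -
    have fb: "smooth_on V (\<lambda>x. f x \<bullet> b)" using f b smooth_on_componentwise[OF V] by blast
    have gb: "smooth_on U (\<lambda>x. g x \<bullet> b)" if "b \<in> Basis" for b
      using g that smooth_on_componentwise[OF U] by blast
    have "plain.fam_Ck k U (\<lambda>t x. f (g x) \<bullet> b)" for k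
      by (rule plain.fam_Ck_compose[OF V U im])
         (use fb gb smooth_on_continuous[OF g] in \<open>simp_all add: plain_Ck_iff[OF V] plain_Ck_iff[OF U] smooth_on_def\<close>)
    thus ?thesis by (simp add: plain_Ck_iff[OF U] smooth_on_def)
  qed
  thus ?thesis using smooth_on_componentwise[OF U, of "\<lambda>x. f (g x)"] by blast
qed

end

context deformation
begin

text \<open>Through this lemma the metric and its Christoffel symbols enter the families.\<close>

lemma fam_smooth_fixed:
  assumes "open U" "smooth_on U f"
  shows "fam_smooth U (\<lambda>_. f)"
proof -
  have C0: "fam_C0 U (\<lambda>_. f)" if "continuous_on U f" for f
    unfolding fam_C0_def
  proof
    fix x assume "x \<in> U"
    hence "isCont f x" using that assms(1) continuous_on_eq_continuous_at by blast
    hence "(f \<longlongrightarrow> f x) (nhds x)" by (simp add: isCont_def tendsto_at_iff_tendsto_nhds)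
    from filterlim_compose[OF this filterlim_snd]
    show "((\<lambda>z. f (snd z)) \<longlongrightarrow> f x) (F \<times>\<^sub>F nhds x)" .
  qed
  have "fam_Ck k U (\<lambda>_. f)" if "smooth_on U f" for k f
    using that
  proof (induction k arbitrary: f)
    case 0
    thus ?case using C0 smooth_on_continuous by auto
  next
    case (Suc k)
    show ?case
      using C0[OF smooth_on_continuous[OF Suc.prems]] smooth_on_differentiable[OF Suc.prems]
        Suc.IH[OF smooth_on_frechet[OF Suc.prems]] by simp
  qed
  thus ?thesis using assms(2) by (simp add: fam_smooth_def)
qed

end

subsection \<open>Partial derivatives\<close>

lemma has_derivative_line:
  fixes f :: "real^'d \<Rightarrow> real"
  assumes "(f has_derivative f') (at (x + t *\<^sub>R axis j 1))"
  shows "((\<lambda>s. f (x + s *\<^sub>R axis j 1)) has_real_derivative f' (axis j 1)) (at t)"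
proof -
  have "((\<lambda>s. x + s *\<^sub>R axis j 1) has_derivative (\<lambda>s. s *\<^sub>R axis j 1)) (at t)"
    by (auto intro!: derivative_eq_intros)
  from diff_chain_at[OF this assms]
  have "((\<lambda>s. f (x + s *\<^sub>R axis j 1)) has_derivative (\<lambda>s. f' (s *\<^sub>R axis j 1))) (at t)"
    by (simp add: o_def)
  moreover have "f' (s *\<^sub>R axis j 1) = f' (axis j 1) * s" for s
    using linear_scale[OF has_derivative_linear[OF assms], of s "axis j 1"] by simp
  ultimately show ?thesis by (simp add: has_field_derivative_def)
qed

lemma partial_deriv_eq_frechet:
  fixes f :: "real^'d \<Rightarrow> real"
  assumes "f differentiable (at x)"
  shows "partial_deriv j f x = frechet_derivative f (at x) (axis j 1)"
  unfolding partial_deriv_def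
  using has_derivative_line[of f "frechet_derivative f (at x)" x 0 j] assms
  by (intro DERIV_imp_deriv) (simp add: frechet_derivative_works[symmetric])

lemma frechet_eq_partial_sum:
  fixes f :: "real^'d \<Rightarrow> real"
  assumes "f differentiable (at x)"
  shows "frechet_derivative f (at x) v = (\<Sum>j\<in>UNIV. v $ j * partial_deriv j f x)"
proof -
  interpret linear "frechet_derivative f (at x)"
    using assms by (simp add: linear_frechet_derivative)
  have "frechet_derivative f (at x) v = frechet_derivative f (at x) (\<Sum>j\<in>UNIV. v $ j *\<^sub>R axis j 1)"
    by (subst basis_expansion[symmetric]) (simp add: scalar_mult_eq_scaleR)
  thus ?thesis by (simp add: sum scaleR partial_deriv_eq_frechet[OF assms])
qed

lemma partial_deriv_cong:
  assumes "open U" "x \<in> U" "\<And>y. y \<in> U \<Longrightarrow> f y = g y"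
  shows "partial_deriv j f x = partial_deriv j g x"
  unfolding partial_deriv_def
proof (rule deriv_cong_ev[OF _ refl])
  have "((\<lambda>t::real. x + t *\<^sub>R axis j 1) \<longlongrightarrow> x + 0 *\<^sub>R axis j 1) (nhds 0)"
    by (intro tendsto_intros filterlim_ident)
  hence "eventually (\<lambda>t::real. x + t *\<^sub>R axis j 1 \<in> U) (nhds 0)"
    using assms(1,2) by (intro topological_tendstoD[of _ x]) simp_all
  thus "eventually (\<lambda>t. f (x + t *\<^sub>R axis j 1) = g (x + t *\<^sub>R axis j 1)) (nhds 0)"
    by (rule eventually_mono) (use assms(3) in auto)
qed

lemma partial_derivs_simps [simp]:
  "partial_derivs [] f = f" "partial_derivs (j # js) f = partial_deriv j (partial_derivs js f)"
  by (simp_all add: partial_derivs_def)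

lemma smooth_on_partial_deriv:
  fixes f :: "real^'d \<Rightarrow> real"
  assumes "open U" "smooth_on U f" shows "smooth_on U (partial_deriv j f)"
proof (rule smooth_on_cong[OF assms(1) _ smooth_on_frechet[OF assms(2), of "axis j 1"]])
  fix x assume "x \<in> U"
  thus "frechet_derivative f (at x) (axis j 1) = partial_deriv j f x"
    using partial_deriv_eq_frechet[OF smooth_on_differentiable[OF assms(2)]] by metis
qed

lemma smooth_on_partial_derivs:
  fixes f :: "real^'d \<Rightarrow> real"
  assumes "open U" "smooth_on U f" shows "smooth_on U (partial_derivs js f)"
  by (induction js) (simp_all add: assms(2) smooth_on_partial_deriv[OF assms(1)])

lemma (in deformation) fam_smooth_partial_deriv:
  fixes \<Theta> :: "'p \<Rightarrow> real^'d \<Rightarrow> real"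
  assumes "open U" "fam_smooth U \<Theta>" shows "fam_smooth U (\<lambda>t. partial_deriv j (\<Theta> t))"
proof (rule fam_smooth_cong[OF assms(1) _ fam_smooth_frechet[OF assms(2), of "axis j 1"]])
  fix t x assume "t \<in> N" "x \<in> U"
  thus "frechet_derivative (\<Theta> t) (at x) (axis j 1) = partial_deriv j (\<Theta> t) x"
    using partial_deriv_eq_frechet[OF fam_smooth_differentiable[OF assms(2)]] by metis
qed

lemma partial_deriv_has_derivative:
  fixes f :: "real^'d \<Rightarrow> real"
  shows "(f has_derivative f') (at x) \<Longrightarrow> partial_deriv j f x = f' (axis j 1)"
  using partial_deriv_eq_frechet[of f x j] fun_cong[OF frechet_derivative_at[of f f' x], of "axis j 1"]
  by (auto simp: differentiable_def)

text \<open>The mean value theorem is applied first in the direction \<open>j\<close> to the difference in the direction \<open>k\<close>, and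
then in the direction \<open>k\<close>.\<close>

lemma second_difference_mean_value:
  fixes f :: "real^'d \<Rightarrow> real"
  assumes U: "open U" and f: "smooth_on U f" and h: "h > 0"
    and sub: "\<And>s t. 0 \<le> s \<Longrightarrow> s \<le> h \<Longrightarrow> 0 \<le> t \<Longrightarrow> t \<le> h \<Longrightarrow> x + s *\<^sub>R axis j 1 + t *\<^sub>R axis k 1 \<in> U"
  obtains s t where "0 < s" "s < h" "0 < t" "t < h"
    "f (x + h *\<^sub>R axis j 1 + h *\<^sub>R axis k 1) - f (x + h *\<^sub>R axis j 1) - f (x + h *\<^sub>R axis k 1) + f x
       = h\<^sup>2 * partial_deriv k (partial_deriv j f) (x + s *\<^sub>R axis j 1 + t *\<^sub>R axis k 1)"
proof -
  have dj: "((\<lambda>s. f (z + s *\<^sub>R axis j 1)) has_real_derivative partial_deriv j f (z + s *\<^sub>R axis j 1)) (at s)"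
    if "z + s *\<^sub>R axis j 1 \<in> U" for z s
    using has_derivative_line[OF smooth_on_has_derivative[OF f that]]
      partial_deriv_eq_frechet[OF smooth_on_differentiable[OF f that]] by simp
  define g where "g s = f ((x + h *\<^sub>R axis k 1) + s *\<^sub>R axis j 1) - f (x + s *\<^sub>R axis j 1)" for s
  have "\<exists>z>0. z < h \<and> g h - g 0 = (h - 0) *
      (partial_deriv j f ((x + h *\<^sub>R axis k 1) + z *\<^sub>R axis j 1) - partial_deriv j f (x + z *\<^sub>R axis j 1))"
    unfolding g_def
  proof (rule MVT2[OF h])
    fix s assume s: "0 \<le> s" "s \<le> h"
    have "(x + h *\<^sub>R axis k 1) + s *\<^sub>R axis j 1 \<in> U" "x + s *\<^sub>R axis j 1 \<in> U"
      using sub[OF s, of h] sub[OF s, of 0] h by (simp_all add: add_ac)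
    thus "DERIV (\<lambda>s. f ((x + h *\<^sub>R axis k 1) + s *\<^sub>R axis j 1) - f (x + s *\<^sub>R axis j 1)) s :>
      partial_deriv j f ((x + h *\<^sub>R axis k 1) + s *\<^sub>R axis j 1) - partial_deriv j f (x + s *\<^sub>R axis j 1)"
      by (intro DERIV_diff dj)
  qed
  then obtain s where s: "0 < s" "s < h" and gs: "g h - g 0 = h *
      (partial_deriv j f ((x + h *\<^sub>R axis k 1) + s *\<^sub>R axis j 1) - partial_deriv j f (x + s *\<^sub>R axis j 1))"
    by auto
  have "\<exists>t>0. t < h \<and> partial_deriv j f (x + s *\<^sub>R axis j 1 + h *\<^sub>R axis k 1) - partial_deriv j f (x + s *\<^sub>R axis j 1 + 0 *\<^sub>R axis k 1)
      = (h - 0) * partial_deriv k (partial_deriv j f) (x + s *\<^sub>R axis j 1 + t *\<^sub>R axis k 1)"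
  proof (rule MVT2[OF h])
    fix t assume "0 \<le> t" "t \<le> h"
    hence "x + s *\<^sub>R axis j 1 + t *\<^sub>R axis k 1 \<in> U" using sub[of s t] s by simp
    moreover have "smooth_on U (partial_deriv j f)" by (rule smooth_on_partial_deriv[OF U f])
    ultimately show "DERIV (\<lambda>t. partial_deriv j f (x + s *\<^sub>R axis j 1 + t *\<^sub>R axis k 1)) t :>
        partial_deriv k (partial_deriv j f) (x + s *\<^sub>R axis j 1 + t *\<^sub>R axis k 1)"
      using has_derivative_line[OF smooth_on_has_derivative]
        partial_deriv_eq_frechet[OF smooth_on_differentiable] by metis
  qed
  then obtain t where t: "0 < t" "t < h"
      "partial_deriv j f (x + s *\<^sub>R axis j 1 + h *\<^sub>R axis k 1) - partial_deriv j f (x + s *\<^sub>R axis j 1)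
      = h * partial_deriv k (partial_deriv j f) (x + s *\<^sub>R axis j 1 + t *\<^sub>R axis k 1)"
    by auto
  have "g h - g 0 = h\<^sup>2 * partial_deriv k (partial_deriv j f) (x + s *\<^sub>R axis j 1 + t *\<^sub>R axis k 1)"
    using gs t(3) by (simp add: add_ac power2_eq_square)
  thus thesis
    using that[OF s t(1,2)] by (simp add: g_def add_ac)
qed

text \<open>Both iterated derivatives are limits of the second difference quotient.\<close>

lemma partial_deriv_commute:
  fixes f :: "real^'d \<Rightarrow> real"
  assumes U: "open U" and f: "smooth_on U f" and x: "x \<in> U"
  shows "partial_deriv j (partial_deriv k f) x = partial_deriv k (partial_deriv j f) x"
proof (rule ccontr)
  define D where "D = partial_deriv j (partial_deriv k f)"
  define D' where "D' = partial_deriv k (partial_deriv j f)"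
  assume "partial_deriv j (partial_deriv k f) x \<noteq> partial_deriv k (partial_deriv j f) x"
  hence e: "\<bar>D x - D' x\<bar> / 2 > 0" by (simp add: D_def D'_def)
  have "isCont D x" "isCont D' x"
    using smooth_on_continuous[OF smooth_on_partial_deriv[OF U smooth_on_partial_deriv[OF U f]]]
      U x continuous_on_eq_continuous_at unfolding D_def D'_def by blast+
  then obtain d1 d2 where d1: "d1 > 0" "\<And>y. dist y x < d1 \<Longrightarrow> dist (D y) (D x) < \<bar>D x - D' x\<bar> / 2"
    and d2: "d2 > 0" "\<And>y. dist y x < d2 \<Longrightarrow> dist (D' y) (D' x) < \<bar>D x - D' x\<bar> / 2"
    using e unfolding continuous_at_eps_delta by (metis dist_commute)
  obtain d3 where d3: "d3 > 0" "\<And>y. dist y x < d3 \<Longrightarrow> y \<in> U"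
    using U x unfolding open_dist by blast
  define h where "h = min d1 (min d2 d3) / 3"
  have h: "h > 0" "2 * h < d1" "2 * h < d2" "2 * h < d3"
    using d1 d2 d3 by (auto simp: h_def min_def)
  have near: "dist (x + s *\<^sub>R axis a 1 + t *\<^sub>R axis b 1) x \<le> 2 * h"
    if "0 \<le> s" "s \<le> h" "0 \<le> t" "t \<le> h" for s t and a b :: 'd
  proof -
    have "dist (x + s *\<^sub>R axis a 1 + t *\<^sub>R axis b 1) x = norm (s *\<^sub>R axis a (1::real) + t *\<^sub>R axis b 1)"
      by (simp add: dist_norm algebra_simps)
    also have "\<dots> \<le> norm (s *\<^sub>R axis a (1::real)) + norm (t *\<^sub>R axis b (1::real))" by (rule norm_triangle_ineq)
    also have "\<dots> \<le> 2 * h" using that by simp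
    finally show ?thesis .
  qed
  have inU: "x + s *\<^sub>R axis a 1 + t *\<^sub>R axis b 1 \<in> U"
    if "0 \<le> s" "s \<le> h" "0 \<le> t" "t \<le> h" for s t and a b :: 'd
    using near[OF that, of a b] h d3(2) by fastforce
  obtain s t where st: "0 < s" "s < h" "0 < t" "t < h"
    "f (x + h *\<^sub>R axis j 1 + h *\<^sub>R axis k 1) - f (x + h *\<^sub>R axis j 1) - f (x + h *\<^sub>R axis k 1) + f x
       = h\<^sup>2 * D' (x + s *\<^sub>R axis j 1 + t *\<^sub>R axis k 1)"
    unfolding D'_def using second_difference_mean_value[OF U f h(1) inU] by blast
  obtain s' t' where st': "0 < s'" "s' < h" "0 < t'" "t' < h"
    "f (x + h *\<^sub>R axis k 1 + h *\<^sub>R axis j 1) - f (x + h *\<^sub>R axis k 1) - f (x + h *\<^sub>R axis j 1) + f x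
       = h\<^sup>2 * D (x + s' *\<^sub>R axis k 1 + t' *\<^sub>R axis j 1)"
    unfolding D_def using second_difference_mean_value[OF U f h(1) inU] by blast
  have "h\<^sup>2 * D' (x + s *\<^sub>R axis j 1 + t *\<^sub>R axis k 1) = h\<^sup>2 * D (x + s' *\<^sub>R axis k 1 + t' *\<^sub>R axis j 1)"
    using st(5) st'(5) by (simp add: algebra_simps)
  hence eq: "D' (x + s *\<^sub>R axis j 1 + t *\<^sub>R axis k 1) = D (x + s' *\<^sub>R axis k 1 + t' *\<^sub>R axis j 1)"
    using h(1) by simp
  have "dist (D' (x + s *\<^sub>R axis j 1 + t *\<^sub>R axis k 1)) (D' x) < \<bar>D x - D' x\<bar> / 2"
    using near[of s t j k] st h d2(2) by fastforce
  moreover have "dist (D (x + s' *\<^sub>R axis k 1 + t' *\<^sub>R axis j 1)) (D x) < \<bar>D x - D' x\<bar> / 2"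
    using near[of s' t' k j] st' h d1(2) by fastforce
  ultimately show False using eq by (auto simp: dist_real_def abs_if split: if_splits)
qed

lemma Ck_on_compose:
  fixes f :: "'b::euclidean_space \<Rightarrow> real" and g :: "'a::euclidean_space \<Rightarrow> 'b"
  assumes U: "open U" and V: "open V" and f: "Ck_on k V f" and g: "Ck_on k U g" and im: "g ` U \<subseteq> V"
  shows "Ck_on k U (\<lambda>x. f (g x))"
proof -
  have "Ck_on 0 U g" using g
    by (cases k) (auto simp: intro!: continuous_at_imp_continuous_on differentiable_imp_continuous_within)
  moreover have "Ck_on k U (\<lambda>x. g x \<bullet> b)" if "b \<in> Basis" for b
    using g that Ck_on_componentwise[OF U] by blast
  ultimately show ?thesis
    using plain.fam_Ck_compose[OF V U im, of k "\<lambda>_. f"] f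
    by (simp add: plain_Ck_iff[OF V] plain_Ck_iff[OF U])
qed

subsection \<open>Bump functions\<close>

text \<open>The polynomial factor in \<open>1 / x\<close> makes this class of functions closed under differentiation, so that
smoothness at \<open>0\<close> needs a single limit.\<close>

definition flat_exp :: "real poly \<Rightarrow> real \<Rightarrow> real" where
  "flat_exp q x = (if x > 0 then poly q (1 / x) * exp (- (1 / x)) else 0)"

lemma poly_times_exp_minus_tendsto_0: "((\<lambda>y::real. poly q y * exp (- y)) \<longlongrightarrow> 0) at_top"
proof -
  have "((\<lambda>y. \<Sum>n\<le>degree q. coeff q n * (y ^ n / exp y)) \<longlongrightarrow> (\<Sum>n\<le>degree q. coeff q n * 0)) at_top"
    by (intro tendsto_sum tendsto_mult tendsto_const tendsto_power_div_exp_0)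
  moreover have "(\<Sum>n\<le>degree q. coeff q n * (y ^ n / exp y)) = poly q y * exp (- y)" for y
    by (simp add: poly_altdef sum_distrib_right exp_minus divide_inverse mult.assoc)
  ultimately show ?thesis by simp
qed

lemma flat_exp_has_derivative:
  "(flat_exp q has_real_derivative flat_exp ([:0,0,1:] * (q - pderiv q)) x) (at x)"
proof -
  consider "x > 0" | "x = 0" | "x < 0" by linarith
  thus ?thesis
  proof cases
    case 1
    have "((\<lambda>x. poly q (1 / x) * exp (- (1 / x))) has_real_derivative flat_exp ([:0,0,1:] * (q - pderiv q)) x) (at x)"
      using 1 by (auto intro!: derivative_eq_intros DERIV_chain2[OF poly_DERIV]
        simp: flat_exp_def field_simps power2_eq_square)
    thus ?thesis
      using 1 by (elim has_field_derivative_transform_within_open[where S = "{0<..}"]) (auto simp: flat_exp_def)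
  next
    case 3
    have "((\<lambda>x. 0) has_real_derivative flat_exp ([:0,0,1:] * (q - pderiv q)) x) (at x)"
      using 3 by (auto simp: flat_exp_def)
    thus ?thesis
      using 3 by (elim has_field_derivative_transform_within_open[where S = "{..<0}"]) (auto simp: flat_exp_def)
  next
    case 2
    have right: "((\<lambda>h. flat_exp q h / h) \<longlongrightarrow> 0) (at_right 0)"
    proof -
      have "((\<lambda>h. poly ([:0,1:] * q) (inverse h) * exp (- inverse h)) \<longlongrightarrow> 0) (at_right (0::real))"
        by (rule filterlim_compose[OF poly_times_exp_minus_tendsto_0 filterlim_inverse_at_top_right])
      thus ?thesis
      proof (rule Lim_transform_eventually)
        show "eventually (\<lambda>h. poly ([:0,1:] * q) (inverse h) * exp (- inverse h) = flat_exp q h / h) (at_right (0::real))"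
          using eventually_at_right_less[of "0::real"]
          by eventually_elim (auto simp: flat_exp_def field_simps)
      qed
    qed
    have left: "((\<lambda>h. flat_exp q h / h) \<longlongrightarrow> 0) (at_left 0)"
    proof (rule Lim_transform_eventually[OF tendsto_const])
      show "eventually (\<lambda>h. 0 = flat_exp q h / h) (at_left (0::real))"
        by (auto simp: eventually_at_filter flat_exp_def intro!: always_eventually)
    qed
    have "((\<lambda>h. (flat_exp q (0 + h) - flat_exp q 0) / h) \<longlongrightarrow> 0) (at 0)"
      using filterlim_split_at[OF left right] by (simp add: flat_exp_def)
    thus ?thesis using 2 by (simp add: DERIV_def flat_exp_def)
  qed
qed

lemma smooth_on_flat_exp: "smooth_on U (flat_exp q)"
proof -
  have scale: "flat_exp (smult v p) x = v * flat_exp p x" for v p x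
    by (simp add: flat_exp_def)
  have eq: "frechet_derivative (flat_exp q) (at x) v = flat_exp (smult v ([:0,0,1:] * (q - pderiv q))) x" for q x v
    using fun_cong[OF frechet_derivative_at[OF flat_exp_has_derivative[unfolded has_field_derivative_def], of q x], of v]
    by (simp only: scale mult.commute)
  have d: "flat_exp q differentiable (at x)" for q x
    using flat_exp_has_derivative[of q x] by (auto simp: has_field_derivative_def differentiable_def)
  have "Ck_on k U (flat_exp q)" for k
  proof (induction k arbitrary: q)
    case 0
    show ?case using d by (auto intro!: continuous_at_imp_continuous_on differentiable_imp_continuous_within)
  next
    case (Suc k)
    have "Ck_on k U (\<lambda>x. frechet_derivative (flat_exp q) (at x) v)" for v
      unfolding eq by (rule Suc.IH)
    thus ?case using d by simp
  qed
  thus ?thesis by (simp add: smooth_on_def)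
qed

lemma smooth_on_nth: "smooth_on U (\<lambda>x::real^'d. x $ j)"
  by (rule smooth_on_linear) (rule bounded_linear_vec_nth)

lemma smooth_bump_exists:
  fixes x\<^sub>0 :: "real^'d"
  assumes "0 < r" "r < R"
  obtains \<beta> :: "real^'d \<Rightarrow> real" where "smooth_on UNIV \<beta>"
    "\<And>x. x \<in> cball x\<^sub>0 r \<Longrightarrow> \<beta> x = 1" "\<And>x. x \<notin> ball x\<^sub>0 R \<Longrightarrow> \<beta> x = 0"
proof -
  define n :: "real^'d \<Rightarrow> real" where "n x = (\<Sum>j\<in>UNIV. (x $ j - x\<^sub>0 $ j) ^ 2)" for x
  have n: "n x = (dist x x\<^sub>0)\<^sup>2" for x
    by (simp add: n_def dist_norm norm_eq_sqrt_inner inner_vec_def power2_eq_square sum_nonneg)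
  have sn: "smooth_on UNIV n"
    unfolding n_def by (intro smooth_on_sum smooth_on_power smooth_on_diff smooth_on_nth smooth_on_const open_UNIV)
  define \<sigma> where "\<sigma> = flat_exp 1"
  have \<sigma>: "\<sigma> u > 0 \<longleftrightarrow> u > 0" "\<sigma> u \<ge> 0" "u \<le> 0 \<Longrightarrow> \<sigma> u = 0" for u
    by (auto simp: \<sigma>_def flat_exp_def)
  have s\<sigma>: "smooth_on UNIV (\<lambda>x. \<sigma> (g x))" if "smooth_on UNIV g" for g :: "real^'d \<Rightarrow> real"
    unfolding \<sigma>_def by (rule smooth_on_compose[OF open_UNIV open_UNIV smooth_on_flat_exp that]) simp
  \<comment> \<open>The two terms have no common zero because \<open>r < R\<close>.\<close>
  have pos: "\<sigma> (R\<^sup>2 - n x) + \<sigma> (n x - r\<^sup>2) > 0" for x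
  proof -
    have "r\<^sup>2 < R\<^sup>2" using assms by (simp add: power_strict_mono)
    hence "R\<^sup>2 - n x > 0 \<or> n x - r\<^sup>2 > 0" by linarith
    thus ?thesis using \<sigma>(1,2) by (metis add_nonneg_pos add_pos_nonneg)
  qed
  define \<beta> where "\<beta> x = \<sigma> (R\<^sup>2 - n x) / (\<sigma> (R\<^sup>2 - n x) + \<sigma> (n x - r\<^sup>2))" for x
  show thesis
  proof
    show "smooth_on UNIV \<beta>"
      unfolding \<beta>_def using pos
      by (intro smooth_on_divide smooth_on_add s\<sigma> smooth_on_diff smooth_on_const sn open_UNIV) (metis less_irrefl)
    fix x
    show "\<beta> x = 1" if "x \<in> cball x\<^sub>0 r"
    proof -
      have "n x \<le> r\<^sup>2" using that assms by (simp add: n dist_commute power_mono)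
      thus ?thesis using \<sigma>(3)[of "n x - r\<^sup>2"] pos[of x] by (simp add: \<beta>_def)
    qed
    show "\<beta> x = 0" if "x \<notin> ball x\<^sub>0 R"
    proof -
      have "R\<^sup>2 \<le> n x" using that assms by (simp add: n dist_commute power_mono)
      thus ?thesis using \<sigma>(3)[of "R\<^sup>2 - n x"] by (simp add: \<beta>_def)
    qed
  qed
qed

section \<open>Charts adapted to a level set\<close>

subsection \<open>Straightening a function in Euclidean space\<close>

definition straighten :: "'d::finite \<Rightarrow> (real^'d \<Rightarrow> real) \<Rightarrow> real^'d \<Rightarrow> real^'d" where
  "straighten i f x = x + (f x - x $ i) *\<^sub>R axis i 1"

text \<open>The coordinate fields of the coordinates \<open>straighten i f\<close>, expressed in the original ones.  For \<open>j \<noteq> i\<close> they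
are tangent to the level sets of \<open>f\<close>.\<close>

definition level_frame :: "'d::finite \<Rightarrow> (real^'d \<Rightarrow> real) \<Rightarrow> 'd \<Rightarrow> real^'d \<Rightarrow> real^'d" where
  "level_frame i f j x =
     axis j 1 + (((if j = i then 1 else 0) - partial_deriv j f x) / partial_deriv i f x) *\<^sub>R axis i 1"

locale straightening =
  fixes i :: "'d::finite" and f :: "real^'d \<Rightarrow> real" and B :: "(real^'d) set"
  assumes open_B: "open B" and convex_B: "convex B" and smooth_f: "smooth_on B f"
    and transversal: "\<And>x. x \<in> B \<Longrightarrow> partial_deriv i f x \<noteq> 0"
begin

abbreviation "\<phi> \<equiv> straighten i f"
abbreviation "\<psi> \<equiv> inv_into B \<phi>"

lemma straighten_nth: "\<phi> x $ j = (if j = i then f x else x $ j)"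
  by (simp add: straighten_def axis_def)

text \<open>Points with the same image differ only in the coordinate \<open>i\<close>, and \<open>f\<close> has no critical point on the
segment between them.\<close>

lemma straighten_inj: "inj_on \<phi> B"
proof (rule inj_onI, rule ccontr)
  fix x y assume xy: "x \<in> B" "y \<in> B" "\<phi> x = \<phi> y" and "x \<noteq> y"
  have fxy: "f x = f y" and off: "j \<noteq> i \<Longrightarrow> x $ j = y $ j" for j
    using straighten_nth[of x] straighten_nth[of y] xy(3) by metis+
  have "x $ i \<noteq> y $ i" using off \<open>x \<noteq> y\<close> by (metis vec_eq_iff)
  define t where "t = y $ i - x $ i"
  have t: "t \<noteq> 0" and y: "y = x + t *\<^sub>R axis i 1"
    using \<open>x $ i \<noteq> y $ i\<close> off by (auto simp: t_def vec_eq_iff axis_def)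
  have seg: "x + (s * t) *\<^sub>R axis i 1 \<in> B" if "0 \<le> s" "s \<le> 1" for s
  proof -
    have "(1 - s) *\<^sub>R x + s *\<^sub>R y \<in> B" using convex_B xy that by (simp add: convex_alt)
    thus ?thesis by (simp add: y algebra_simps)
  qed
  have "\<exists>z>0. z < 1 \<and> f (x + (1 * t) *\<^sub>R axis i 1) - f (x + (0 * t) *\<^sub>R axis i 1) = (1 - 0) * (partial_deriv i f (x + (z * t) *\<^sub>R axis i 1) * t)"
  proof (rule MVT2)
    fix s :: real assume "0 \<le> s" "s \<le> 1"
    hence inB: "x + (s * t) *\<^sub>R axis i 1 \<in> B" by (rule seg)
    have "((\<lambda>u. f (x + u *\<^sub>R axis i 1)) has_real_derivative partial_deriv i f (x + (s * t) *\<^sub>R axis i 1)) (at (s * t))"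
      using has_derivative_line[OF smooth_on_has_derivative[OF smooth_f inB]]
        partial_deriv_eq_frechet[OF smooth_on_differentiable[OF smooth_f inB]] by simp
    moreover have "((\<lambda>s. s * t) has_real_derivative t) (at s)" by (auto intro!: derivative_eq_intros)
    ultimately show "DERIV (\<lambda>s. f (x + (s * t) *\<^sub>R axis i 1)) s :> partial_deriv i f (x + (s * t) *\<^sub>R axis i 1) * t"
      by (rule DERIV_chain2[where f = "\<lambda>u. f (x + u *\<^sub>R axis i 1)" and g = "\<lambda>s. s * t"])
  qed simp
  then obtain z where "0 < z" "z < 1" "f y - f x = partial_deriv i f (x + (z * t) *\<^sub>R axis i 1) * t"
    by (auto simp: y)
  thus False using fxy t transversal[OF seg[of z]] by simp
qed

lemma inverse_straighten [simp]: "x \<in> B \<Longrightarrow> \<psi> (\<phi> x) = x"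
  by (simp add: straighten_inj)

lemma straighten_inverse [simp]: "y \<in> \<phi> ` B \<Longrightarrow> \<phi> (\<psi> y) = y"
  and inverse_in [simp]: "y \<in> \<phi> ` B \<Longrightarrow> \<psi> y \<in> B"
  by (auto simp: f_inv_into_f inv_into_into)

lemma smooth_straighten: "smooth_on B \<phi>"
proof -
  have "smooth_on B (\<lambda>x. \<phi> x $ j)" for j
    using smooth_f by (cases "j = i") (simp_all add: straighten_nth smooth_on_nth)
  thus ?thesis using smooth_on_vec_iff[OF open_B, of \<phi>] by blast
qed

lemma open_image: "open (\<phi> ` B)"
  by (rule invariance_of_domain[OF smooth_on_continuous[OF smooth_straighten] open_B straighten_inj])

text \<open>This is the derivative of the inverse of \<open>\<phi>\<close> at \<open>\<phi> x\<close>.\<close>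

definition frame_map :: "real^'d \<Rightarrow> real^'d \<Rightarrow> real^'d" where
  "frame_map x v = (\<Sum>j\<in>UNIV. v $ j *\<^sub>R level_frame i f j x)"

lemma frame_map_axis: "frame_map x (axis j 1) = level_frame i f j x"
  unfolding frame_map_def by (simp add: axis_def if_distrib[of "\<lambda>a. a *\<^sub>R _"] cong: if_cong)

lemma frame_map_eq:
  assumes "x \<in> B"
  shows "frame_map x v = v + ((v $ i - frechet_derivative f (at x) v) / partial_deriv i f x) *\<^sub>R axis i 1"
proof -
  let ?p = "\<lambda>j. partial_deriv j f x"
  have "frame_map x v = (\<Sum>j\<in>UNIV. v $ j *\<^sub>R axis j 1) +
      (\<Sum>j\<in>UNIV. v $ j * (((if j = i then 1 else 0) - ?p j) / ?p i)) *\<^sub>R axis i 1"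
    by (simp add: frame_map_def level_frame_def scaleR_add_right sum.distrib scaleR_sum_left)
  also have "(\<Sum>j\<in>UNIV. v $ j *\<^sub>R axis j 1) = v"
    using basis_expansion[of v] by (simp add: scalar_mult_eq_scaleR)
  also have "(\<Sum>j\<in>UNIV. v $ j * (((if j = i then 1 else 0) - ?p j) / ?p i)) =
      ((\<Sum>j\<in>UNIV. if j = i then v $ j else 0) - (\<Sum>j\<in>UNIV. v $ j * ?p j)) / ?p i"
    unfolding sum_subtractf[symmetric] sum_divide_distrib by (intro sum.cong) (auto simp: algebra_simps)
  also have "(\<Sum>j\<in>UNIV. v $ j * ?p j) = frechet_derivative f (at x) v"
    using frechet_eq_partial_sum[OF smooth_on_differentiable[OF smooth_f assms]] by simp
  finally show ?thesis by simp
qed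

lemma has_derivative_inverse_straighten:
  assumes "x \<in> B"
  shows "(\<psi> has_derivative frame_map x) (at (\<phi> x))"
proof (rule has_derivative_inverse_strong[OF open_B assms])
  let ?D = "frechet_derivative f (at x)"
  have lin: "linear ?D" using smooth_on_differentiable[OF smooth_f assms] by (simp add: linear_frechet_derivative)
  show "continuous_on B \<phi>" by (rule smooth_on_continuous[OF smooth_straighten])
  show "(\<phi> has_derivative (\<lambda>v. v + (?D v - v $ i) *\<^sub>R axis i 1)) (at x)"
    unfolding straighten_def[abs_def]
    by (intro has_derivative_add has_derivative_ident has_derivative_scaleR_left has_derivative_diff
        smooth_on_has_derivative[OF smooth_f assms] bounded_linear_imp_has_derivative bounded_linear_vec_nth)
  have Di: "?D (axis i 1) = partial_deriv i f x"
    using partial_deriv_eq_frechet[OF smooth_on_differentiable[OF smooth_f assms]] by simp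
  show "(\<lambda>v. v + (?D v - v $ i) *\<^sub>R axis i 1) \<circ> frame_map x = id"
  proof
    fix v
    have "?D (frame_map x v) = v $ i"
      using transversal[OF assms] by (simp add: frame_map_eq[OF assms] linear_add[OF lin] linear_scale[OF lin] Di)
    thus "((\<lambda>v. v + (?D v - v $ i) *\<^sub>R axis i 1) \<circ> frame_map x) v = id v"
      using transversal[OF assms] by (simp add: frame_map_eq[OF assms] vec_eq_iff axis_def)
  qed
qed auto

text \<open>The derivative of the inverse is a smooth function of the inverse, so each order of
  differentiability of the inverse yields the next one.\<close>

lemma smooth_inverse_straighten: "smooth_on (\<phi> ` B) \<psi>"
proof -
  have d: "(\<psi> has_derivative frame_map (\<psi> y)) (at y)" if "y \<in> \<phi> ` B" for y
    using has_derivative_inverse_straighten[of "\<psi> y"] that by simp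
  have diff: "\<forall>y\<in>\<phi> ` B. \<psi> differentiable (at y)" using d by (auto simp: differentiable_def)
  have fr: "smooth_on B (\<lambda>x. (v $ i - frechet_derivative f (at x) v) / partial_deriv i f x)" for v
    using transversal
    by (intro smooth_on_divide smooth_on_diff smooth_on_const smooth_on_frechet smooth_on_partial_deriv smooth_f open_B)
  have "Ck_on k (\<phi> ` B) \<psi>" for k
  proof (induction k)
    case 0
    show ?case using diff by (auto intro!: continuous_at_imp_continuous_on differentiable_imp_continuous_within)
  next
    case (Suc k)
    have "Ck_on k (\<phi> ` B) (\<lambda>y. frechet_derivative \<psi> (at y) v)" for v
    proof (subst Ck_on_componentwise[OF open_image], rule ballI)
      fix b :: "real^'d" assume "b \<in> Basis"
      then obtain j where b: "b = axis j 1" by (auto simp: Basis_vec_def)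
      show "Ck_on k (\<phi> ` B) (\<lambda>y. frechet_derivative \<psi> (at y) v \<bullet> b)"
      proof (rule Ck_on_cong[OF open_image])
        have "smooth_on B (\<lambda>x. v $ j + (v $ i - frechet_derivative f (at x) v) / partial_deriv i f x * axis i 1 $ j)"
          by (intro smooth_on_add smooth_on_mult smooth_on_const fr open_B)
        hence "Ck_on k B (\<lambda>x. v $ j + (v $ i - frechet_derivative f (at x) v) / partial_deriv i f x * axis i 1 $ j)"
          by (simp only: smooth_on_def)
        moreover have "\<psi> ` \<phi> ` B \<subseteq> B" using inverse_in by blast
        ultimately show "Ck_on k (\<phi> ` B) (\<lambda>y. v $ j + (v $ i - frechet_derivative f (at (\<psi> y)) v) / partial_deriv i f (\<psi> y) * axis i 1 $ j)"
          by (rule Ck_on_compose[OF open_image open_B _ Suc.IH])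
        fix y assume y: "y \<in> \<phi> ` B"
        have "frechet_derivative \<psi> (at y) v = frame_map (\<psi> y) v"
          using fun_cong[OF frechet_derivative_at[OF d[OF y]], of v] by simp
        thus "v $ j + (v $ i - frechet_derivative f (at (\<psi> y)) v) / partial_deriv i f (\<psi> y) * axis i 1 $ j
            = frechet_derivative \<psi> (at y) v \<bullet> b"
          using y by (simp add: frame_map_eq b inner_axis)
      qed
    qed
    thus ?case using diff by simp
  qed
  thus ?thesis by (simp add: smooth_on_def)
qed

text \<open>The inverse maps the coordinate direction \<open>j\<close> to the \<open>j\<close>-th frame vector, so this is the chain rule.  It
allows all computations in an adapted chart to be carried out in the original coordinates.\<close>

lemma partial_deriv_pullback:
  assumes "x \<in> B" "K differentiable (at x)" and eq: "\<And>x. x \<in> B \<Longrightarrow> G (\<phi> x) = K x"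
  shows "partial_deriv j G (\<phi> x) = frechet_derivative K (at x) (level_frame i f j x)"
proof -
  have "(\<psi> has_derivative frame_map x) (at (\<phi> x))" by (rule has_derivative_inverse_straighten[OF assms(1)])
  moreover have "(K has_derivative frechet_derivative K (at x)) (at (\<psi> (\<phi> x)))"
    using assms by (simp add: frechet_derivative_works[symmetric])
  ultimately have "((K \<circ> \<psi>) has_derivative frechet_derivative K (at x) \<circ> frame_map x) (at (\<phi> x))"
    by (rule diff_chain_at)
  hence "(G has_derivative frechet_derivative K (at x) \<circ> frame_map x) (at (\<phi> x))"
    by (rule has_derivative_transform_within_open[OF _ open_image]) (use assms(1) eq in auto)
  from partial_deriv_has_derivative[OF this]
  have "partial_deriv j G (\<phi> x) = frechet_derivative K (at x) (frame_map x (axis j 1))" by simp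
  thus ?thesis by (simp only: frame_map_axis)
qed

end

subsection \<open>Charts\<close>

lemma is_chart_inj: "is_chart c \<Longrightarrow> inj_on (snd c) (fst c)"
  by (rule inj_on_inverseI[where g = "chart_inv c"]) (simp add: homeomorphism_def is_chart_def)

lemma chart_inv_chart [simp]: "is_chart c \<Longrightarrow> p \<in> fst c \<Longrightarrow> chart_inv c (snd c p) = p"
  by (simp add: homeomorphism_def is_chart_def)

lemma chart_chart_inv [simp]: "x \<in> chart_image c \<Longrightarrow> snd c (chart_inv c x) = x"
  and chart_inv_in [simp]: "x \<in> chart_image c \<Longrightarrow> chart_inv c x \<in> fst c"
  by (auto simp: chart_inv_def chart_image_def f_inv_into_f inv_into_into)

lemma chart_in_image [simp]: "p \<in> fst c \<Longrightarrow> snd c p \<in> chart_image c"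
  by (simp add: chart_image_def)

lemma is_chart_open: "is_chart c \<Longrightarrow> open (fst c)" "is_chart c \<Longrightarrow> open (chart_image c)"
  and is_chart_continuous: "is_chart c \<Longrightarrow> continuous_on (fst c) (snd c)"
    "is_chart c \<Longrightarrow> continuous_on (chart_image c) (chart_inv c)"
  by (auto simp: is_chart_def homeomorphism_def)

lemma open_chart_preimage:
  assumes "is_chart c" "open B" shows "open {p \<in> fst c. snd c p \<in> B}"
proof -
  have "{p \<in> fst c. snd c p \<in> B} = snd c -` B \<inter> fst c" by auto
  thus ?thesis
    using continuous_on_open_vimage[OF is_chart_open(1)[OF assms(1)]] is_chart_continuous(1) assms by metis
qed

lemma overlap_iff:
  assumes "is_chart c" shows "x \<in> overlap c c' \<longleftrightarrow> x \<in> chart_image c \<and> chart_inv c x \<in> fst c'"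
  using assms by (auto simp: overlap_def chart_image_def intro: rev_image_eqI[where x = "chart_inv c x"])

lemma open_overlap:
  assumes "is_chart c" "is_chart c'" shows "open (overlap c c')"
proof -
  have "overlap c c' = chart_inv c -` fst c' \<inter> chart_image c"
    using overlap_iff[OF assms(1), of _ c'] by auto
  thus ?thesis
    using continuous_on_open_vimage[OF is_chart_open(2)[OF assms(1)]] is_chart_continuous(2)[OF assms(1)]
      is_chart_open(1)[OF assms(2)] by metis
qed

lemma overlap_sub: "overlap c d \<subseteq> chart_image c"
  by (auto simp: overlap_def chart_image_def)

lemma transition_in: "is_chart c \<Longrightarrow> x \<in> overlap c c' \<Longrightarrow> transition c c' x \<in> overlap c' c"
  by (auto simp: overlap_def transition_def)

definition reparametrize ::
  "('m, 'd::finite) chart \<Rightarrow> (real^'d) set \<Rightarrow> (real^'d \<Rightarrow> real^'d) \<Rightarrow> ('m, 'd) chart" where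
  "reparametrize c B \<phi> = ({p \<in> fst c. snd c p \<in> B}, \<phi> \<circ> snd c)"

locale smooth_reparametrization =
  fixes c :: "('m::topological_space, 'd::finite) chart" and B and \<phi> :: "real^'d \<Rightarrow> real^'d"
  assumes chart: "is_chart c" and open_B: "open B" and B_sub: "B \<subseteq> chart_image c"
    and smooth: "smooth_on B \<phi>" and inj: "inj_on \<phi> B"
    and smooth_inv: "smooth_on (\<phi> ` B) (inv_into B \<phi>)" and open_image: "open (\<phi> ` B)"
begin

abbreviation "c' \<equiv> reparametrize c B \<phi>"
abbreviation "\<psi> \<equiv> inv_into B \<phi>"

lemma repar_simps: "p \<in> fst c' \<longleftrightarrow> p \<in> fst c \<and> snd c p \<in> B" "snd c' p = \<phi> (snd c p)"
  by (auto simp: reparametrize_def)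

lemma repar_image: "chart_image c' = \<phi> ` B"
proof -
  have "\<phi> x \<in> snd c' ` fst c'" if "x \<in> B" for x
    using that B_sub chart by (intro rev_image_eqI[where x = "chart_inv c x"]) (auto simp: repar_simps)
  thus ?thesis by (auto simp: chart_image_def repar_simps)
qed

lemma repar_inj: "inj_on (snd c') (fst c')"
  using is_chart_inj[OF chart] inj by (auto simp: inj_on_def repar_simps)

lemma repar_inv: "y \<in> \<phi> ` B \<Longrightarrow> chart_inv c' y = chart_inv c (\<psi> y)"
proof -
  assume y: "y \<in> \<phi> ` B"
  hence "\<psi> y \<in> B" "\<phi> (\<psi> y) = y" by (auto simp: inv_into_into f_inv_into_f)
  hence "chart_inv c (\<psi> y) \<in> fst c'" "snd c' (chart_inv c (\<psi> y)) = y"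
    using B_sub by (auto simp: repar_simps)
  thus ?thesis using repar_inj unfolding chart_inv_def by (metis inv_into_f_f)
qed

lemma repar_is_chart: "is_chart c'"
proof -
  have "homeomorphism (fst c') (chart_image c') (snd c') (chart_inv c')"
    unfolding homeomorphism_def
  proof (intro conjI ballI)
    show "snd c' ` fst c' = chart_image c'" by (simp add: chart_image_def)
    show "chart_inv c' (snd c' p) = p" if "p \<in> fst c'" for p
      using repar_inj that by (simp add: chart_inv_def)
    show "snd c' (chart_inv c' y) = y" if "y \<in> chart_image c'" for y using that by simp
    show "chart_inv c' ` chart_image c' = fst c'"
      using repar_inj by (simp add: chart_inv_def chart_image_def)
    show "continuous_on (fst c') (snd c')"
      unfolding reparametrize_def snd_conv fst_conv
    proof (rule continuous_on_compose)
      show "continuous_on {p \<in> fst c. snd c p \<in> B} (snd c)"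
        using is_chart_continuous(1)[OF chart] by (rule continuous_on_subset) auto
      show "continuous_on (snd c ` {p \<in> fst c. snd c p \<in> B}) \<phi>"
        using smooth_on_continuous[OF smooth] by (rule continuous_on_subset) auto
    qed
    have "continuous_on (\<phi> ` B) (chart_inv c \<circ> \<psi>)"
    proof (rule continuous_on_compose[OF smooth_on_continuous[OF smooth_inv]])
      show "continuous_on (\<psi> ` \<phi> ` B) (chart_inv c)"
        using is_chart_continuous(2)[OF chart] B_sub inj by (rule_tac continuous_on_subset) auto
    qed
    thus "continuous_on (chart_image c') (chart_inv c')"
      unfolding repar_image by (rule continuous_on_eq) (simp add: repar_inv)
  qed
  moreover have "fst c' = {p \<in> fst c. snd c p \<in> B}" by (auto simp: repar_simps)
  ultimately show ?thesis
    using open_chart_preimage[OF chart open_B] open_image repar_image by (simp add: is_chart_def)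
qed

lemma repar_overlap: "overlap c' d = \<phi> ` (B \<inter> overlap c d)"
  using B_sub chart inj
  by (auto simp: overlap_iff[OF repar_is_chart] overlap_iff[OF chart] repar_image repar_inv intro!: imageI subsetD[OF B_sub])

lemma repar_transition: "y \<in> \<phi> ` B \<Longrightarrow> transition c' d y = transition c d (\<psi> y)"
  by (simp add: transition_def repar_inv)

lemma repar_overlap_self: "overlap c' c = \<phi> ` B"
  using B_sub inj by (auto simp: overlap_iff[OF repar_is_chart] repar_image repar_inv intro!: imageI subsetD[OF B_sub])

lemma repar_transition_self: "y \<in> \<phi> ` B \<Longrightarrow> transition c' c y = \<psi> y"
  using B_sub by (simp add: transition_def repar_inv inv_into_into subset_iff)

lemma repar_compatible:
  assumes "compatible c d" "is_chart d"
  shows "compatible c' d"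
proof -
  note od = open_overlap[OF chart assms(2)] open_overlap[OF assms(2) chart]
  have "smooth_on (\<phi> ` (B \<inter> overlap c d)) (\<lambda>y. transition c d (\<psi> y))"
  proof (rule smooth_on_compose[where f = "transition c d" and g = \<psi>, OF _ od(1)])
    show "open (\<phi> ` (B \<inter> overlap c d))"
      using open_overlap[OF repar_is_chart assms(2)] by (simp add: repar_overlap)
    show "smooth_on (overlap c d) (transition c d)" using assms(1) by (simp add: compatible_def)
    show "smooth_on (\<phi> ` (B \<inter> overlap c d)) \<psi>"
      by (rule smooth_on_subset[OF _ smooth_inv]) auto
    show "\<psi> ` \<phi> ` (B \<inter> overlap c d) \<subseteq> overlap c d" using inj by auto
  qed
  hence "smooth_on (overlap c' d) (\<lambda>y. transition c d (\<psi> y))" by (simp add: repar_overlap)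
  hence 1: "smooth_on (overlap c' d) (transition c' d)"
    by (rule smooth_on_cong[OF open_overlap[OF repar_is_chart assms(2)], rotated])
       (auto simp: repar_transition repar_overlap)
  have sub: "overlap d c' \<subseteq> overlap d c" by (auto simp: overlap_def repar_simps)
  have "smooth_on (overlap d c') (\<lambda>x. \<phi> (transition d c x))"
  proof (rule smooth_on_compose[OF open_overlap[OF assms(2) repar_is_chart] open_B smooth])
    show "smooth_on (overlap d c') (transition d c)"
      using assms(1) by (intro smooth_on_subset[OF sub]) (simp add: compatible_def)
    show "transition d c ` overlap d c' \<subseteq> B"
      using assms(2) by (auto simp: overlap_def transition_def repar_simps)
  qed
  moreover have "transition d c' = (\<lambda>x. \<phi> (transition d c x))"
    by (auto simp: transition_def repar_simps)
  ultimately show ?thesis using 1 by (simp add: compatible_def)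
qed

end

lemma atlas_covers: "smooth_atlas \<A> \<Longrightarrow> \<exists>d\<in>\<A>. p \<in> fst d"
  unfolding smooth_atlas_def by blast

lemma smooth_charts_chart: "c \<in> smooth_charts \<A> \<Longrightarrow> is_chart c"
  by (simp add: smooth_charts_def)

lemma atlas_in_smooth_charts: "smooth_atlas \<A> \<Longrightarrow> c \<in> \<A> \<Longrightarrow> c \<in> smooth_charts \<A>"
  by (auto simp: smooth_atlas_def smooth_charts_def)

lemma (in smooth_reparametrization) repar_smooth_chart:
  assumes "smooth_atlas \<A>" "c \<in> smooth_charts \<A>" shows "c' \<in> smooth_charts \<A>"
  using assms repar_is_chart repar_compatible by (auto simp: smooth_charts_def smooth_atlas_def)

lemma (in straightening) straighten_reparametrization:
  assumes "is_chart c" "B \<subseteq> chart_image c"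
  shows "smooth_reparametrization c B \<phi>"
  using assms open_B smooth_straighten straighten_inj smooth_inverse_straighten open_image
  by unfold_locales

text \<open>Near each point the chart differs from a chart of the atlas by a smooth transition.\<close>

lemma smooth_functions_chart:
  assumes A: "smooth_atlas \<A>" and f: "f \<in> smooth_functions \<A>" and c: "c \<in> smooth_charts \<A>"
  shows "smooth_on (chart_image c) (f \<circ> chart_inv c)"
proof (rule smooth_on_local)
  fix x assume x: "x \<in> chart_image c"
  have ch: "is_chart c" by (rule smooth_charts_chart[OF c])
  obtain d where d: "d \<in> \<A>" "chart_inv c x \<in> fst d"
    using atlas_covers[OF A] by blast
  have chd: "is_chart d" and comp: "compatible c d"
    using A c d by (auto simp: smooth_atlas_def smooth_charts_def)
  have "smooth_on (overlap c d) (\<lambda>y. (f \<circ> chart_inv d) (transition c d y))"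
  proof (rule smooth_on_compose[where f = "f \<circ> chart_inv d" and g = "transition c d",
        OF open_overlap[OF ch chd] is_chart_open(2)[OF chd]])
    show "smooth_on (chart_image d) (f \<circ> chart_inv d)" using f d by (simp add: smooth_functions_def)
    show "smooth_on (overlap c d) (transition c d)" using comp by (simp add: compatible_def)
    show "transition c d ` overlap c d \<subseteq> chart_image d"
      using transition_in[OF ch, of _ d] overlap_sub[of d c] by blast
  qed
  hence "smooth_on (overlap c d) (f \<circ> chart_inv c)"
    by (rule smooth_on_cong[OF open_overlap[OF ch chd], rotated])
       (auto simp: transition_def overlap_iff[OF ch] chd)
  thus "\<exists>V. open V \<and> x \<in> V \<and> smooth_on V (f \<circ> chart_inv c)"
    using open_overlap[OF ch chd] overlap_iff[OF ch] x d by blast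
qed

section \<open>Mean curvature of level sets\<close>

subsection \<open>Positive definite matrices\<close>

definition pos_def :: "real^'n^'n \<Rightarrow> bool" where
  "pos_def A \<longleftrightarrow> transpose A = A \<and> (\<forall>v. v \<noteq> 0 \<longrightarrow> v \<bullet> (A *v v) > 0)"

lemma pos_def_sym: "pos_def A \<Longrightarrow> v \<bullet> (A *v w) = w \<bullet> (A *v v)"
  unfolding pos_def_def by (metis dot_lmul_matrix inner_commute transpose_matrix_vector)

lemma pos_def_entry_sym:
  assumes "pos_def A" shows "A $ j $ k = A $ k $ j"
proof -
  have "transpose A $ k $ j = A $ k $ j" using assms by (simp add: pos_def_def)
  thus ?thesis by (simp add: transpose_def)
qed

lemma pos_def_det: "pos_def A \<Longrightarrow> det A \<noteq> 0"
proof -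
  assume A: "pos_def A"
  have "inj ((*v) A)"
  proof (rule injI)
    fix v w assume "A *v v = A *v w"
    hence "(v - w) \<bullet> (A *v (v - w)) = 0" by (simp add: matrix_vector_mult_diff_distrib)
    thus "v = w" using A unfolding pos_def_def by (metis eq_iff_diff_eq_0 less_irrefl)
  qed
  thus ?thesis using det_nz_iff_inj[of "(*v) A"] by (simp add: matrix_of_matrix_vector_mul)
qed

lemma matrix_inv_mult_vec:
  fixes A :: "real^'n^'n"
  assumes "det A \<noteq> 0" shows "A *v (matrix_inv A *v v) = v" "matrix_inv A *v (A *v v) = v"
  using matrix_inv_mult[OF assms] by (simp_all add: matrix_vector_mul_assoc)

lemma matrix_inv_entry: "(matrix_inv A *v axis k 1) $ j = matrix_inv A $ j $ k" for A :: "real^'n^'n"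
  by (simp add: matrix_vector_mult_basis column_def)

lemma pos_def_inv_diag:
  assumes "pos_def A" shows "matrix_inv A $ i $ i > 0"
proof -
  let ?w = "matrix_inv A *v axis i 1"
  have w: "A *v ?w = axis i 1" by (rule matrix_inv_mult_vec(1)[OF pos_def_det[OF assms]])
  hence "?w \<noteq> 0" by (metis axis_eq_0_iff matrix_vector_mult_0_right zero_neq_one)
  hence "?w \<bullet> (A *v ?w) > 0" using assms by (simp add: pos_def_def)
  thus ?thesis by (simp only: w inner_axis matrix_inv_entry) simp
qed

text \<open>The padding by a unit entry used for the induced metric, as an operation on matrices.\<close>

definition padded :: "'n::finite \<Rightarrow> real^'n^'n \<Rightarrow> real^'n^'n" where
  "padded i A = (\<chi> j k. if j \<noteq> i \<and> k \<noteq> i then A $ j $ k else if j = k then 1 else 0)"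

lemma inner_matrix_sum: "v \<bullet> (A *v w) = (\<Sum>j\<in>UNIV. \<Sum>k\<in>UNIV. v $ j * A $ j $ k * w $ k)"
  for A :: "real^'n^'n"
  unfolding inner_vec_def matrix_vector_mult_def inner_real_def vec_lambda_beta sum_distrib_left mult.assoc ..

lemma pos_def_padded:
  assumes "pos_def A" shows "pos_def (padded i A)"
  unfolding pos_def_def
proof (intro conjI allI impI)
  have "A $ j $ k = A $ k $ j" for j k
    by (rule pos_def_entry_sym[OF assms])
  thus "transpose (padded i A) = padded i A"
    by (auto simp: padded_def transpose_def vec_eq_iff)
  fix v :: "real^'a" assume v: "v \<noteq> 0"
  define u where "u = (\<chi> j. if j = i then 0 else v $ j)"
  have "v $ j * padded i A $ j $ k * v $ k = u $ j * A $ j $ k * u $ k + (if k = i then if j = i then v $ i * v $ i else 0 else 0)" for j k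
    by (auto simp: padded_def u_def)
  hence "v \<bullet> (padded i A *v v) = u \<bullet> (A *v u) + v $ i * v $ i"
    by (simp add: inner_matrix_sum sum.distrib)
  moreover have "u \<bullet> (A *v u) > 0" if "u \<noteq> 0" using that assms by (simp add: pos_def_def)
  moreover have "v $ i \<noteq> 0" if "u = 0"
  proof -
    obtain j where "v $ j \<noteq> 0" using v by (auto simp: vec_eq_iff)
    moreover have "u $ j = 0" using that by simp
    ultimately show ?thesis by (auto simp: u_def split: if_splits)
  qed
  ultimately show "v \<bullet> (padded i A *v v) > 0"
    by (cases "u = 0") (auto simp: add_pos_nonneg zero_less_mult_iff)
qed

lemma sum_mult_axis: "(\<Sum>b\<in>UNIV. h b * axis k (1::real) $ b) = h k"
  by (simp add: axis_def if_distrib[of "(*) _"] cong: if_cong)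

lemma congruence_entry:
  fixes J A :: "real^'n^'n"
  shows "(transpose J ** A ** J) $ j $ k = column j J \<bullet> (A *v column k J)"
proof -
  have "(transpose J ** A ** J) $ j $ k = axis j 1 \<bullet> ((transpose J ** A ** J) *v axis k 1)"
    by (simp add: matrix_vector_mult_basis column_def inner_axis')
  also have "\<dots> = axis j 1 \<bullet> (transpose J *v (A *v (J *v axis k 1)))"
    by (simp add: matrix_vector_mul_assoc matrix_mul_assoc)
  also have "\<dots> = (J *v axis j 1) \<bullet> (A *v (J *v axis k 1))"
    by (metis dot_lmul_matrix inner_commute transpose_matrix_vector)
  finally show ?thesis by (simp add: matrix_vector_mult_basis)
qed

subsection \<open>Mean curvature in a chart\<close>

lemma riemannian_pos_def:
  "riemannian_metric \<A> g \<Longrightarrow> c \<in> smooth_charts \<A> \<Longrightarrow> x \<in> chart_image c \<Longrightarrow> pos_def (g c x)"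
  by (simp add: riemannian_metric_def pos_def_def)

text \<open>The conormal of the slice is a multiple of the differential of the coordinate \<open>i\<close>, whose length is the
square root of the entry \<open>(i, i)\<close> of the inverse metric.\<close>

lemma unit_normal_lowered:
  assumes A: "pos_def (g c x)"
  shows "g c x *v unit_normal g c i x = (1 / sqrt (matrix_inv (g c x) $ i $ i)) *\<^sub>R axis i 1"
proof -
  let ?A = "g c x"
  define l where "l = 1 / sqrt (matrix_inv ?A $ i $ i)"
  define \<nu> where "\<nu> = l *\<^sub>R (matrix_inv ?A *v axis i 1)"
  have l: "l > 0" and l2: "l * l * matrix_inv ?A $ i $ i = 1"
    using pos_def_inv_diag[OF A, of i] by (auto simp: l_def)
  have A\<nu>: "?A *v \<nu> = l *\<^sub>R axis i 1"
    by (simp add: \<nu>_def matrix_vector_mult_scaleR matrix_inv_mult_vec(1)[OF pos_def_det[OF A]])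
  have \<nu>i: "\<nu> $ i = l * matrix_inv ?A $ i $ i" by (simp add: \<nu>_def matrix_inv_entry)
  have "unit_normal g c i x = \<nu>"
    unfolding unit_normal_def
  proof (rule the_equality)
    show "(\<forall>v. v $ i = 0 \<longrightarrow> v \<bullet> (?A *v \<nu>) = 0) \<and> \<nu> \<bullet> (?A *v \<nu>) = 1 \<and> 0 < \<nu> $ i"
      using l l2 pos_def_inv_diag[OF A, of i] by (simp add: A\<nu> inner_axis \<nu>i mult.assoc)
    fix \<mu> assume \<mu>: "(\<forall>v. v $ i = 0 \<longrightarrow> v \<bullet> (?A *v \<mu>) = 0) \<and> \<mu> \<bullet> (?A *v \<mu>) = 1 \<and> 0 < \<mu> $ i"
    have "(?A *v \<mu>) $ j = 0" if "j \<noteq> i" for j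
    proof -
      have "axis j 1 \<bullet> (?A *v \<mu>) = 0" using \<mu> that by (simp add: axis_def)
      thus ?thesis by (simp add: inner_axis')
    qed
    hence eq: "?A *v \<mu> = ((?A *v \<mu>) $ i) *\<^sub>R axis i 1" by (auto simp: vec_eq_iff axis_def)
    define m where "m = (?A *v \<mu>) $ i"
    have Am: "?A *v \<mu> = m *\<^sub>R axis i 1" using eq by (simp add: m_def)
    hence \<mu>': "\<mu> = m *\<^sub>R (matrix_inv ?A *v axis i 1)"
      by (metis A matrix_inv_mult_vec(2) matrix_vector_mult_scaleR pos_def_det)
    have \<mu>i: "\<mu> $ i = m * matrix_inv ?A $ i $ i" by (subst \<mu>') (simp add: matrix_inv_entry)
    have "m * \<mu> $ i = 1" using \<mu> by (simp add: Am inner_axis)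
    hence m2: "m * m * matrix_inv ?A $ i $ i = 1" by (simp add: \<mu>i mult.assoc)
    have "m > 0" using \<mu> pos_def_inv_diag[OF A, of i] by (simp add: \<mu>i zero_less_mult_iff)
    moreover have "m * m = l * l" using m2 l2 pos_def_inv_diag[OF A, of i]
      by (metis less_irrefl mult_right_cancel)
    ultimately have "m = l" using l by (simp add: square_eq_iff)
    thus "\<mu> = \<nu>" by (simp add: \<mu>' \<nu>_def)
  qed
  thus ?thesis by (simp add: A\<nu> l_def)
qed

text \<open>Only the Christoffel symbols with upper index \<open>i\<close> contribute to the second fundamental form.\<close>

lemma mean_curvature_eq:
  assumes "pos_def (g c x)"
  shows "mean_curvature g c i x = (\<Sum>j\<in>-{i}. \<Sum>k\<in>-{i}.
    matrix_inv (padded i (g c x)) $ j $ k * christoffel g c i j k x) / sqrt (matrix_inv (g c x) $ i $ i)"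
  unfolding mean_curvature_def second_fundamental_form_def unit_normal_lowered[where g = g, OF assms]
  by (simp add: inner_axis induced_metric_def padded_def sum_divide_distrib mult.commute)

subsection \<open>Mean curvature in an adapted chart\<close>

definition gradient :: "(real^'d \<Rightarrow> real) \<Rightarrow> real^'d \<Rightarrow> real^'d::finite" where
  "gradient f x = (\<chi> j. partial_deriv j f x)"

text \<open>Minus the covariant Hessian of \<open>f\<close>, evaluated on the level frame.\<close>

definition level_hessian ::
  "('m, 'd::finite) metric \<Rightarrow> ('m, 'd) chart \<Rightarrow> 'd \<Rightarrow> (real^'d \<Rightarrow> real) \<Rightarrow> 'd \<Rightarrow> 'd \<Rightarrow> real^'d \<Rightarrow> real" where
  "level_hessian g c i f j k x = (\<Sum>a\<in>UNIV. \<Sum>b\<in>UNIV.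
     ((\<Sum>l\<in>UNIV. partial_deriv l f x * christoffel g c l a b x) - partial_deriv a (partial_deriv b f) x)
       * (level_frame i f j x $ a * level_frame i f k x $ b))"

definition level_metric ::
  "('m, 'd::finite) metric \<Rightarrow> ('m, 'd) chart \<Rightarrow> 'd \<Rightarrow> (real^'d \<Rightarrow> real) \<Rightarrow> real^'d \<Rightarrow> real^'d^'d" where
  "level_metric g c i f x =
     (\<chi> j k. \<Sum>a\<in>UNIV. \<Sum>b\<in>UNIV. level_frame i f j x $ a * g c x $ a $ b * level_frame i f k x $ b)"

definition level_trace ::
  "('m, 'd::finite) metric \<Rightarrow> ('m, 'd) chart \<Rightarrow> 'd \<Rightarrow> (real^'d \<Rightarrow> real) \<Rightarrow> real^'d \<Rightarrow> real" where
  "level_trace g c i f x = (\<Sum>j\<in>-{i}. \<Sum>k\<in>-{i}.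
     matrix_inv (padded i (level_metric g c i f x)) $ j $ k * level_hessian g c i f j k x)"

definition gradient_sq ::
  "('m, 'd::finite) metric \<Rightarrow> ('m, 'd) chart \<Rightarrow> (real^'d \<Rightarrow> real) \<Rightarrow> real^'d \<Rightarrow> real" where
  "gradient_sq g c f x = (\<Sum>a\<in>UNIV. \<Sum>b\<in>UNIV. partial_deriv a f x * matrix_inv (g c x) $ a $ b * partial_deriv b f x)"

definition level_mean_curvature ::
  "('m, 'd::finite) metric \<Rightarrow> ('m, 'd) chart \<Rightarrow> 'd \<Rightarrow> (real^'d \<Rightarrow> real) \<Rightarrow> real^'d \<Rightarrow> real" where
  "level_mean_curvature g c i f x = level_trace g c i f x / sqrt (gradient_sq g c f x)"

lemma gradient_sq_eq: "gradient_sq g c f x = gradient f x \<bullet> (matrix_inv (g c x) *v gradient f x)"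
  by (simp add: gradient_sq_def inner_matrix_sum gradient_def)

locale metric_straightening = straightening i f B
  for i :: "'d::finite" and f B +
  fixes \<A> :: "('m::topological_space, 'd) chart set" and g :: "('m, 'd) metric" and c :: "('m, 'd) chart"
  assumes atlas: "smooth_atlas \<A>" and metric: "riemannian_metric \<A> g"
    and c: "c \<in> smooth_charts \<A>" and B_image: "B \<subseteq> chart_image c"
begin

sublocale repar: smooth_reparametrization c B "straighten i f"
  by (rule straighten_reparametrization[OF smooth_charts_chart[OF c] B_image])

abbreviation "c' \<equiv> reparametrize c B (straighten i f)"
abbreviation "X \<equiv> level_frame i f"
abbreviation "Df x \<equiv> frechet_derivative f (at x)"

lemma c': "c' \<in> smooth_charts \<A>"
  by (rule repar.repar_smooth_chart[OF atlas c])

lemma c'_image: "chart_image c' = \<phi> ` B"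
  by (rule repar.repar_image)

lemma pos_def_c: "x \<in> B \<Longrightarrow> pos_def (g c x)"
  using riemannian_pos_def[OF metric c] B_image by blast

lemma pos_def_c': "x \<in> B \<Longrightarrow> pos_def (g c' (\<phi> x))"
  using riemannian_pos_def[OF metric c'] c'_image by blast

text \<open>The columns of the Jacobian of the inverse are the frame vectors.\<close>

lemma metric_in_new_chart:
  assumes x: "x \<in> B" shows "g c' (\<phi> x) $ j $ k = X j x \<bullet> (g c x *v X k x)"
proof -
  let ?J = "jacobian (transition c' c) (at (\<phi> x))"
  have "(\<psi> has_derivative frame_map x) (at (\<phi> x))" by (rule has_derivative_inverse_straighten[OF x])
  hence "(transition c' c has_derivative frame_map x) (at (\<phi> x))"
    by (rule has_derivative_transform_within_open[OF _ open_image]) (use x repar.repar_transition_self in auto)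
  hence "?J = matrix (frame_map x)"
    unfolding jacobian_def using frechet_derivative_at by metis
  hence col: "column j ?J = X j x" for j
    by (simp add: matrix_def column_def frame_map_axis)
  have "\<phi> x \<in> overlap c' c" using x by (simp add: repar.repar_overlap_self)
  moreover have "transition c' c (\<phi> x) = x" using x by (simp add: repar.repar_transition_self)
  ultimately have "g c' (\<phi> x) = transpose ?J ** g c x ** ?J"
    using metric c c' unfolding riemannian_metric_def by metis
  thus ?thesis by (simp add: congruence_entry col)
qed

lemma level_metric_eq: "x \<in> B \<Longrightarrow> level_metric g c i f x = g c' (\<phi> x)"
  by (simp add: vec_eq_iff level_metric_def metric_in_new_chart inner_matrix_sum)

lemma Df_eq: "x \<in> B \<Longrightarrow> Df x v = gradient f x \<bullet> v"
  using frechet_eq_partial_sum[OF smooth_on_differentiable[OF smooth_f]]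
  by (simp add: inner_vec_def gradient_def mult.commute)

lemma Df_frame: "x \<in> B \<Longrightarrow> Df x (X j x) = (if j = i then 1 else 0)"
proof -
  assume x: "x \<in> B"
  have lin: "linear (Df x)" using smooth_on_differentiable[OF smooth_f x] by (simp add: linear_frechet_derivative)
  have "Df x (axis j 1) = partial_deriv j f x" for j
    using partial_deriv_eq_frechet[OF smooth_on_differentiable[OF smooth_f x]] by simp
  thus ?thesis
    using transversal[OF x] by (simp add: level_frame_def linear_add[OF lin] linear_scale[OF lin])
qed

text \<open>Raising the lowered frame components of \<open>W\<close> gives its components in the frame; the
  \<open>i\<close>-th one is \<open>Df W\<close>.\<close>

lemma raise_frame_components:
  assumes x: "x \<in> B"
  shows "(\<Sum>m\<in>UNIV. matrix_inv (g c' (\<phi> x)) $ i $ m * (X m x \<bullet> (g c x *v W))) = Df x W"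
proof -
  let ?g' = "g c' (\<phi> x)"
  define u where "u = W + (Df x W - W $ i) *\<^sub>R axis i 1"
  have lin: "linear (Df x)" using smooth_on_differentiable[OF smooth_f x] by (simp add: linear_frechet_derivative)
  have Di: "Df x (axis i 1) = partial_deriv i f x"
    using partial_deriv_eq_frechet[OF smooth_on_differentiable[OF smooth_f x]] by simp
  have "u $ i = Df x W" by (simp add: u_def)
  moreover have "Df x u = Df x W + (Df x W - W $ i) * partial_deriv i f x"
    by (simp add: u_def linear_add[OF lin] linear_scale[OF lin] Di)
  ultimately have "(u $ i - Df x u) / partial_deriv i f x = - (Df x W - W $ i)"
    using transversal[OF x] by (simp add: field_simps)
  hence Wu: "frame_map x u = W"
    by (simp only: frame_map_eq[OF x]) (simp add: u_def algebra_simps)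
  have "(?g' *v u) $ m = X m x \<bullet> (g c x *v W)" for m
  proof -
    have "(?g' *v u) $ m = (\<Sum>k\<in>UNIV. (X m x \<bullet> (g c x *v X k x)) * u $ k)"
      by (simp add: matrix_vector_mult_def metric_in_new_chart[OF x])
    also have "\<dots> = X m x \<bullet> (g c x *v frame_map x u)"
      by (simp add: frame_map_def linear_sum[OF matrix_vector_mul_linear] matrix_vector_mult_scaleR
          inner_sum_right mult.commute)
    finally show ?thesis by (simp add: Wu)
  qed
  hence "(\<Sum>m\<in>UNIV. matrix_inv ?g' $ i $ m * (X m x \<bullet> (g c x *v W))) = (matrix_inv ?g' *v (?g' *v u)) $ i"
    by (simp add: matrix_vector_mult_def)
  also have "\<dots> = u $ i" using matrix_inv_mult_vec(2)[OF pos_def_det[OF pos_def_c'[OF x]]] by simp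
  finally show ?thesis by (simp add: u_def)
qed

text \<open>The Riemannian gradient \<open>W\<close> of \<open>f\<close> is orthogonal to the frame vectors other than the \<open>i\<close>-th, on which it
pairs to \<open>1\<close>.\<close>

lemma gradient_sq_new_chart:
  assumes x: "x \<in> B" shows "matrix_inv (g c' (\<phi> x)) $ i $ i = gradient_sq g c f x"
proof -
  define W where "W = matrix_inv (g c x) *v gradient f x"
  have "g c x *v W = gradient f x"
    unfolding W_def by (rule matrix_inv_mult_vec(1)[OF pos_def_det[OF pos_def_c[OF x]]])
  hence "X m x \<bullet> (g c x *v W) = (if m = i then 1 else 0)" for m
    using Df_frame[OF x, of m] by (simp add: Df_eq[OF x] inner_commute)
  hence "(\<Sum>m\<in>UNIV. matrix_inv (g c' (\<phi> x)) $ i $ m * (X m x \<bullet> (g c x *v W)))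
      = (\<Sum>m\<in>UNIV. if m = i then matrix_inv (g c' (\<phi> x)) $ i $ m else 0)"
    by (intro sum.cong refl) simp
  hence "matrix_inv (g c' (\<phi> x)) $ i $ i = Df x W"
    using raise_frame_components[OF x, of W] by simp
  thus ?thesis by (simp add: Df_eq[OF x] gradient_sq_eq W_def)
qed

lemma gradient_sq_pos: "x \<in> B \<Longrightarrow> gradient_sq g c f x > 0"
  using gradient_sq_new_chart pos_def_inv_diag[OF pos_def_c'] by metis

text \<open>The component in the direction \<open>i\<close> is the only nonconstant one of a frame vector.\<close>

definition slope :: "'d \<Rightarrow> real^'d \<Rightarrow> real" where
  "slope j x = ((if j = i then 1 else 0) - partial_deriv j f x) / partial_deriv i f x"

lemma X_slope: "X j x = axis j 1 + slope j x *\<^sub>R axis i 1"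
  by (simp add: level_frame_def slope_def)

lemma smooth_slope: "smooth_on B (slope j)"
  unfolding slope_def[abs_def]
  by (intro smooth_on_divide smooth_on_diff smooth_on_const smooth_on_partial_deriv smooth_f open_B transversal)

definition D2f :: "real^'d \<Rightarrow> real^'d \<Rightarrow> real^'d \<Rightarrow> real" where
  "D2f x u v = (\<Sum>a\<in>UNIV. \<Sum>b\<in>UNIV. partial_deriv a (partial_deriv b f) x * (u $ a * v $ b))"

text \<open>The derivative of the frame vector \<open>k\<close> along the frame vector \<open>j\<close>.  As coordinate fields commute, it must be
symmetric in \<open>j\<close> and \<open>k\<close>; this appears here as the symmetry of the Hessian.\<close>

lemma slope_derivative:
  assumes x: "x \<in> B"
  shows "frechet_derivative (slope k) (at x) (X j x) = - D2f x (X j x) (X k x) / partial_deriv i f x"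
proof -
  let ?p = "\<lambda>j. partial_deriv j f"
  have sp: "smooth_on B (?p j)" for j by (rule smooth_on_partial_deriv[OF open_B smooth_f])
  have pi: "?p i x \<noteq> 0" by (rule transversal[OF x])
  have Dp: "frechet_derivative (?p k) (at x) v = (\<Sum>a\<in>UNIV. v $ a * partial_deriv a (?p k) x)" for k v
    by (rule frechet_eq_partial_sum[OF smooth_on_differentiable[OF sp x]])
  let ?d = "\<lambda>k. frechet_derivative (?p k) (at x)"
  have hd: "(?p k has_derivative ?d k) (at x)" for k by (rule smooth_on_has_derivative[OF sp x])
  have "(slope k has_derivative (\<lambda>v. - ((if k = i then 1 else 0) - ?p k x) * (inverse (?p i x) * ?d i v * inverse (?p i x))
      + (0 - ?d k v) / ?p i x)) (at x)"
    unfolding slope_def[abs_def]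
    by (rule has_derivative_divide[OF has_derivative_diff[OF has_derivative_const hd] hd pi])
  from fun_cong[OF frechet_derivative_at[OF this], of "X j x"]
  have "frechet_derivative (slope k) (at x) (X j x) =
     - ((if k = i then 1 else 0) - ?p k x) * (inverse (?p i x) * ?d i (X j x) * inverse (?p i x)) + (0 - ?d k (X j x)) / ?p i x"
    by (rule sym)
  also have "\<dots> = - (?d k (X j x) + slope k x * ?d i (X j x)) / ?p i x"
  proof -
    have "- u * (inverse p * d * inverse p) + (0 - e) / p = - (e + u / p * d) / p" if "p \<noteq> 0" for u p d e :: real
      using that by (simp add: field_simps)
    thus ?thesis unfolding slope_def using pi by blast
  qed
  also have "?d k (X j x) + slope k x * ?d i (X j x) = D2f x (X j x) (X k x)"
  proof -
    have inner: "(\<Sum>b\<in>UNIV. partial_deriv a (?p b) x * X k x $ b) = partial_deriv a (?p k) x + partial_deriv a (?p i) x * slope k x" for a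
      by (simp add: X_slope distrib_left sum.distrib sum_mult_axis mult.assoc[symmetric])
    have "D2f x (X j x) (X k x) = (\<Sum>a\<in>UNIV. X j x $ a * (\<Sum>b\<in>UNIV. partial_deriv a (?p b) x * X k x $ b))"
      by (simp add: D2f_def sum_distrib_left mult_ac)
    thus ?thesis by (simp add: inner Dp algebra_simps sum.distrib sum_distrib_left)
  qed
  finally show ?thesis .
qed

lemma D2f_sym: "x \<in> B \<Longrightarrow> D2f x u v = D2f x v u"
proof -
  assume x: "x \<in> B"
  have "D2f x u v = (\<Sum>a\<in>UNIV. \<Sum>b\<in>UNIV. partial_deriv b (partial_deriv a f) x * (v $ b * u $ a))"
    unfolding D2f_def by (simp add: partial_deriv_commute[OF open_B smooth_f x] mult.commute)
  thus ?thesis unfolding D2f_def by (subst sum.swap) simp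
qed

text \<open>The derivative of the frame vector \<open>k\<close> along the frame vector \<open>j\<close> is \<open>bend j k\<close> times the coordinate
direction \<open>i\<close>.\<close>

definition bend :: "'d \<Rightarrow> 'd \<Rightarrow> real^'d \<Rightarrow> real" where
  "bend j k x = - D2f x (X j x) (X k x) / partial_deriv i f x"

lemma bend_sym: "x \<in> B \<Longrightarrow> bend j k x = bend k j x"
  by (simp add: bend_def D2f_sym)

text \<open>The derivative of the metric in the direction \<open>u\<close>, evaluated at \<open>v\<close> and \<open>w\<close>.\<close>

definition metric_grad :: "real^'d \<Rightarrow> real^'d \<Rightarrow> real^'d \<Rightarrow> real^'d \<Rightarrow> real" where
  "metric_grad x u v w = (\<Sum>a\<in>UNIV. \<Sum>b\<in>UNIV. \<Sum>e\<in>UNIV. partial_deriv a (\<lambda>y. g c y $ b $ e) x * (u $ a * v $ b * w $ e))"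

lemma smooth_g: "smooth_on B (\<lambda>y. g c y $ a $ b)"
proof -
  have o: "open (chart_image c)" using smooth_charts_chart[OF c] is_chart_open by blast
  have "smooth_on (chart_image c) (g c)" using metric c by (simp add: riemannian_metric_def)
  hence "smooth_on (chart_image c) (\<lambda>y. g c y $ a $ b)"
    using smooth_on_vec_iff[OF o, of "g c"] smooth_on_vec_iff[OF o, of "\<lambda>y. g c y $ a"] by blast
  thus ?thesis using smooth_on_subset[OF B_image] by blast
qed

lemma metric_derivative:
  assumes x: "x \<in> B"
  shows "partial_deriv l (\<lambda>y. g c' y $ j $ k) (\<phi> x) =
    metric_grad x (X l x) (X j x) (X k x) + bend l j x * (axis i 1 \<bullet> (g c x *v X k x)) + bend l k x * (X j x \<bullet> (g c x *v axis i 1))"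
proof -
  let ?G = "\<lambda>a b y. g c y $ a $ b"
  have hq: "(slope j has_derivative frechet_derivative (slope j) (at x)) (at x)" for j
    by (rule smooth_on_has_derivative[OF smooth_slope x])
  have hX: "((\<lambda>y. X j y $ a) has_derivative (\<lambda>v. frechet_derivative (slope j) (at x) v * axis i 1 $ a)) (at x)" for j a
  proof -
    have "((\<lambda>y. axis j 1 $ a + slope j y * axis i 1 $ a) has_derivative (\<lambda>v. 0 + frechet_derivative (slope j) (at x) v * axis i 1 $ a)) (at x)"
      by (intro has_derivative_add has_derivative_const has_derivative_mult_left hq)
    thus ?thesis by (simp add: X_slope)
  qed
  have hG: "(?G a b has_derivative frechet_derivative (?G a b) (at x)) (at x)" for a b
    by (rule smooth_on_has_derivative[OF smooth_g x])
  define K where "K y = (\<Sum>a\<in>UNIV. \<Sum>b\<in>UNIV. X j y $ a * ?G a b y * X k y $ b)" for y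
  have hK: "(K has_derivative (\<lambda>v. \<Sum>a\<in>UNIV. \<Sum>b\<in>UNIV.
      X j x $ a * ?G a b x * (frechet_derivative (slope k) (at x) v * axis i 1 $ b) +
      (X j x $ a * frechet_derivative (?G a b) (at x) v + frechet_derivative (slope j) (at x) v * axis i 1 $ a * ?G a b x) * X k x $ b)) (at x)"
    unfolding K_def by (intro has_derivative_sum has_derivative_mult hX hG)
  have "partial_deriv l (\<lambda>y. g c' y $ j $ k) (\<phi> x) = frechet_derivative K (at x) (X l x)"
  proof (rule partial_deriv_pullback[OF x])
    show "K differentiable (at x)" using hK by (auto simp: differentiable_def)
    show "g c' (\<phi> y) $ j $ k = K y" if "y \<in> B" for y
      by (simp add: metric_in_new_chart[OF that] K_def inner_matrix_sum)
  qed
  also have "\<dots> = (\<Sum>a\<in>UNIV. \<Sum>b\<in>UNIV.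
      X j x $ a * ?G a b x * (frechet_derivative (slope k) (at x) (X l x) * axis i 1 $ b) +
      (X j x $ a * frechet_derivative (?G a b) (at x) (X l x) + frechet_derivative (slope j) (at x) (X l x) * axis i 1 $ a * ?G a b x) * X k x $ b)"
    using fun_cong[OF frechet_derivative_at[OF hK], of "X l x"] by simp
  also have "\<dots> = (\<Sum>a\<in>UNIV. \<Sum>b\<in>UNIV. X j x $ a * frechet_derivative (?G a b) (at x) (X l x) * X k x $ b)
      + bend l j x * (axis i 1 \<bullet> (g c x *v X k x)) + bend l k x * (X j x \<bullet> (g c x *v axis i 1))"
    unfolding slope_derivative[OF x] bend_def[symmetric]
    by (simp add: inner_matrix_sum sum.distrib sum_distrib_left algebra_simps)
  also have "(\<Sum>a\<in>UNIV. \<Sum>b\<in>UNIV. X j x $ a * frechet_derivative (?G a b) (at x) (X l x) * X k x $ b)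
     = (\<Sum>a\<in>UNIV. \<Sum>b\<in>UNIV. \<Sum>e\<in>UNIV. partial_deriv e (?G a b) x * (X l x $ e * X j x $ a * X k x $ b))"
    by (simp add: frechet_eq_partial_sum[OF smooth_on_differentiable[OF smooth_g x]] sum_distrib_left sum_distrib_right algebra_simps)
  also have "\<dots> = (\<Sum>a\<in>UNIV. \<Sum>e\<in>UNIV. \<Sum>b\<in>UNIV. partial_deriv e (?G a b) x * (X l x $ e * X j x $ a * X k x $ b))"
    by (intro sum.cong refl sum.swap)
  also have "\<dots> = metric_grad x (X l x) (X j x) (X k x)"
    unfolding metric_grad_def by (rule sum.swap)
  finally show ?thesis .
qed

text \<open>The Koszul formula for constant vector fields.\<close>

lemma christoffel_lowered:
  assumes x: "x \<in> B"
  shows "metric_grad x u v w + metric_grad x w v u - metric_grad x v u w =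
    2 * (v \<bullet> (g c x *v (\<chi> l. \<Sum>a\<in>UNIV. \<Sum>b\<in>UNIV. christoffel g c l a b x * (u $ a * w $ b))))"
proof -
  let ?G = "\<lambda>a b y. g c y $ a $ b"
  define S where "S a b = (\<chi> m. partial_deriv a (?G m b) x + partial_deriv b (?G m a) x - partial_deriv m (?G a b) x)" for a b
  have ch: "(\<chi> l. christoffel g c l a b x) = (1/2) *\<^sub>R (matrix_inv (g c x) *v S a b)" for a b
    by (simp add: vec_eq_iff christoffel_def S_def matrix_vector_mult_def)
  have lower: "2 * (v \<bullet> (g c x *v (\<chi> l. christoffel g c l a b x))) = v \<bullet> S a b" for a b
    unfolding ch matrix_vector_mult_scaleR matrix_inv_mult_vec(1)[OF pos_def_det[OF pos_def_c[OF x]]] by simp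
  have vec: "(\<chi> l. \<Sum>a\<in>UNIV. \<Sum>b\<in>UNIV. christoffel g c l a b x * (u $ a * w $ b))
     = (\<Sum>a\<in>UNIV. \<Sum>b\<in>UNIV. (u $ a * w $ b) *\<^sub>R (\<chi> l. christoffel g c l a b x))"
    by (simp add: vec_eq_iff mult.commute)
  have "2 * (v \<bullet> (g c x *v (\<chi> l. \<Sum>a\<in>UNIV. \<Sum>b\<in>UNIV. christoffel g c l a b x * (u $ a * w $ b))))
     = (\<Sum>a\<in>UNIV. \<Sum>b\<in>UNIV. (u $ a * w $ b) * (2 * (v \<bullet> (g c x *v (\<chi> l. christoffel g c l a b x)))))"
    unfolding vec by (simp add: linear_sum[OF matrix_vector_mul_linear] matrix_vector_mult_scaleR inner_sum_right sum_distrib_left mult_ac)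
  also have "\<dots> = (\<Sum>a\<in>UNIV. \<Sum>b\<in>UNIV. \<Sum>m\<in>UNIV. partial_deriv a (?G m b) x * (u $ a * v $ m * w $ b)
      + partial_deriv b (?G m a) x * (w $ b * v $ m * u $ a) - partial_deriv m (?G a b) x * (v $ m * u $ a * w $ b))"
    unfolding lower by (simp add: inner_vec_def S_def sum_distrib_left algebra_simps)
  also have "\<dots> = (\<Sum>a\<in>UNIV. \<Sum>b\<in>UNIV. \<Sum>m\<in>UNIV. partial_deriv a (?G m b) x * (u $ a * v $ m * w $ b))
      + (\<Sum>a\<in>UNIV. \<Sum>b\<in>UNIV. \<Sum>m\<in>UNIV. partial_deriv b (?G m a) x * (w $ b * v $ m * u $ a))
      - (\<Sum>a\<in>UNIV. \<Sum>b\<in>UNIV. \<Sum>m\<in>UNIV. partial_deriv m (?G a b) x * (v $ m * u $ a * w $ b))"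
    by (simp add: sum.distrib sum_subtractf)
  also have "(\<Sum>a\<in>UNIV. \<Sum>b\<in>UNIV. \<Sum>m\<in>UNIV. partial_deriv a (?G m b) x * (u $ a * v $ m * w $ b)) = metric_grad x u v w"
    unfolding metric_grad_def by (intro sum.cong refl sum.swap)
  also have "(\<Sum>a\<in>UNIV. \<Sum>b\<in>UNIV. \<Sum>m\<in>UNIV. partial_deriv b (?G m a) x * (w $ b * v $ m * u $ a)) = metric_grad x w v u"
  proof -
    have "(\<Sum>a\<in>UNIV. \<Sum>b\<in>UNIV. \<Sum>m\<in>UNIV. partial_deriv b (?G m a) x * (w $ b * v $ m * u $ a))
       = (\<Sum>b\<in>UNIV. \<Sum>a\<in>UNIV. \<Sum>m\<in>UNIV. partial_deriv b (?G m a) x * (w $ b * v $ m * u $ a))"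
      by (rule sum.swap)
    also have "\<dots> = metric_grad x w v u"
      unfolding metric_grad_def by (intro sum.cong refl sum.swap)
    finally show ?thesis .
  qed
  also have "(\<Sum>a\<in>UNIV. \<Sum>b\<in>UNIV. \<Sum>m\<in>UNIV. partial_deriv m (?G a b) x * (v $ m * u $ a * w $ b)) = metric_grad x v u w"
  proof -
    have "(\<Sum>a\<in>UNIV. \<Sum>b\<in>UNIV. \<Sum>m\<in>UNIV. partial_deriv m (?G a b) x * (v $ m * u $ a * w $ b))
        = (\<Sum>a\<in>UNIV. \<Sum>m\<in>UNIV. \<Sum>b\<in>UNIV. partial_deriv m (?G a b) x * (v $ m * u $ a * w $ b))"
      by (intro sum.cong refl sum.swap)
    also have "\<dots> = metric_grad x v u w" unfolding metric_grad_def by (rule sum.swap)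
    finally show ?thesis .
  qed
  finally show ?thesis by simp
qed

text \<open>This is the transformation law of Christoffel symbols.  Its inhomogeneous term comes from the derivatives of
the frame vectors, which point in the direction \<open>i\<close>; pairing them with the differential of \<open>f\<close> gives
minus the coordinate Hessian of \<open>f\<close>.\<close>

lemma christoffel_new_chart:
  assumes x: "x \<in> B"
  shows "christoffel g c' i j k (\<phi> x) = level_hessian g c i f j k x"
proof -
  let ?V = "\<chi> l. \<Sum>a\<in>UNIV. \<Sum>b\<in>UNIV. christoffel g c l a b x * (X j x $ a * X k x $ b)"
  define W where "W = ?V + bend j k x *\<^sub>R axis i 1"
  have br: "partial_deriv j (\<lambda>y. g c' y $ m $ k) (\<phi> x) + partial_deriv k (\<lambda>y. g c' y $ m $ j) (\<phi> x)
      - partial_deriv m (\<lambda>y. g c' y $ j $ k) (\<phi> x) = 2 * (X m x \<bullet> (g c x *v W))" for m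
  proof -
    have n: "axis i 1 \<bullet> (g c x *v v) = v \<bullet> (g c x *v axis i 1)" for v
      by (rule pos_def_sym[OF pos_def_c[OF x]])
    have "X m x \<bullet> (g c x *v W) = X m x \<bullet> (g c x *v ?V) + bend j k x * (X m x \<bullet> (g c x *v axis i 1))"
      by (simp add: W_def matrix_vector_right_distrib matrix_vector_mult_scaleR inner_add_right)
    thus ?thesis
      using christoffel_lowered[OF x, of "X j x" "X m x" "X k x"]
      by (simp add: metric_derivative[OF x] n bend_sym[OF x, of m] bend_sym[OF x, of k j])
  qed
  have "christoffel g c' i j k (\<phi> x) = (\<Sum>m\<in>UNIV. matrix_inv (g c' (\<phi> x)) $ i $ m * (2 * (X m x \<bullet> (g c x *v W)))) / 2"
    unfolding christoffel_def[of g c'] br ..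
  also have "\<dots> = (\<Sum>m\<in>UNIV. matrix_inv (g c' (\<phi> x)) $ i $ m * (X m x \<bullet> (g c x *v W)))"
    by (simp add: sum_divide_distrib)
  also have "\<dots> = Df x W" by (rule raise_frame_components[OF x])
  also have "\<dots> = gradient f x \<bullet> ?V - D2f x (X j x) (X k x)"
    using transversal[OF x] by (simp add: Df_eq[OF x] W_def inner_add_right inner_diff_right inner_axis gradient_def bend_def)
  also have "\<dots> = level_hessian g c i f j k x"
  proof -
    have "gradient f x \<bullet> ?V = (\<Sum>l\<in>UNIV. \<Sum>a\<in>UNIV. \<Sum>b\<in>UNIV. partial_deriv l f x * christoffel g c l a b x * (X j x $ a * X k x $ b))"
      by (simp add: inner_vec_def gradient_def sum_distrib_left mult.assoc)
    also have "\<dots> = (\<Sum>a\<in>UNIV. \<Sum>l\<in>UNIV. \<Sum>b\<in>UNIV. partial_deriv l f x * christoffel g c l a b x * (X j x $ a * X k x $ b))"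
      by (rule sum.swap)
    also have "\<dots> = (\<Sum>a\<in>UNIV. \<Sum>b\<in>UNIV. \<Sum>l\<in>UNIV. partial_deriv l f x * christoffel g c l a b x * (X j x $ a * X k x $ b))"
      by (intro sum.cong refl sum.swap)
    finally show ?thesis
      by (simp add: level_hessian_def D2f_def sum_subtractf[symmetric] sum_distrib_right left_diff_distrib)
  qed
  finally show ?thesis .
qed

lemma mean_curvature_new_chart:
  assumes x: "x \<in> B"
  shows "mean_curvature g c' i (\<phi> x) = level_mean_curvature g c i f x"
  by (simp add: mean_curvature_eq[where g = g, OF pos_def_c'[OF x]] level_mean_curvature_def level_trace_def
      level_metric_eq[OF x] christoffel_new_chart[OF x] gradient_sq_new_chart[OF x])

end

subsection \<open>Dependence of the mean curvature on the function\<close>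

lemma smooth_metric_entry:
  assumes "riemannian_metric \<A> g" "c \<in> smooth_charts \<A>"
  shows "smooth_on (chart_image c) (\<lambda>y. g c y $ a $ b)"
proof -
  have o: "open (chart_image c)" using smooth_charts_chart[OF assms(2)] is_chart_open by blast
  have "smooth_on (chart_image c) (g c)" using assms by (simp add: riemannian_metric_def)
  thus ?thesis
    using smooth_on_vec_iff[OF o, of "g c"] smooth_on_vec_iff[OF o, of "\<lambda>y. g c y $ a"] by blast
qed

lemma smooth_metric_inverse:
  assumes "riemannian_metric \<A> g" "c \<in> smooth_charts \<A>"
  shows "smooth_on (chart_image c) (\<lambda>y. matrix_inv (g c y) $ a $ b)"
  using smooth_charts_chart[OF assms(2)] is_chart_open(2)[of c] pos_def_det[OF riemannian_pos_def[OF assms]]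
  by (intro smooth_on_matrix_inv smooth_metric_entry[OF assms]) auto

lemma smooth_christoffel:
  assumes "riemannian_metric \<A> g" "c \<in> smooth_charts \<A>"
  shows "smooth_on (chart_image c) (christoffel g c l a b)"
proof -
  have o: "open (chart_image c)" using smooth_charts_chart[OF assms(2)] is_chart_open by blast
  have "smooth_on (chart_image c) (\<lambda>x. (\<Sum>m\<in>UNIV. matrix_inv (g c x) $ l $ m *
     (partial_deriv a (\<lambda>y. g c y $ m $ b) x + partial_deriv b (\<lambda>y. g c y $ m $ a) x
        - partial_deriv m (\<lambda>y. g c y $ a $ b) x)) / 2)"
    by (intro smooth_on_divide[OF o] smooth_on_sum[OF o] smooth_on_mult[OF o] smooth_on_diff[OF o]
        smooth_on_add[OF o] smooth_on_partial_deriv[OF o] smooth_metric_inverse[OF assms]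
        smooth_metric_entry[OF assms] smooth_on_const) simp
  thus ?thesis by (simp add: christoffel_def[abs_def])
qed

text \<open>These iterated derivatives along the level frame are the iterated partial derivatives in the adapted
coordinates.\<close>

fun frame_derivs ::
  "'d::finite \<Rightarrow> (real^'d \<Rightarrow> real) \<Rightarrow> 'd list \<Rightarrow> (real^'d \<Rightarrow> real) \<Rightarrow> real^'d \<Rightarrow> real" where
  "frame_derivs i f [] K = K"
| "frame_derivs i f (j # js) K =
     (\<lambda>x. frechet_derivative (frame_derivs i f js K) (at x) (level_frame i f j x))"

lemma (in straightening) partial_derivs_pullback:
  assumes smooth: "\<And>js. smooth_on B (frame_derivs i f js K)"
    and eq: "\<And>x. x \<in> B \<Longrightarrow> G (\<phi> x) = K x" and x: "x \<in> B"
  shows "partial_derivs js G (\<phi> x) = frame_derivs i f js K x"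
  using x
proof (induction js arbitrary: x)
  case Nil
  thus ?case by (simp add: eq)
next
  case (Cons j js)
  have "partial_deriv j (partial_derivs js G) (\<phi> x) = frechet_derivative (frame_derivs i f js K) (at x) (level_frame i f j x)"
    by (rule partial_deriv_pullback[OF Cons.prems smooth_on_differentiable[OF smooth Cons.prems] Cons.IH])
  thus ?case by simp
qed

text \<open>The adapted charts of different parameters are compared on the common set \<open>B\<close> of original coordinates.\<close>

locale metric_deformation = deformation F N t\<^sub>0
  for F :: "'p filter" and N and t\<^sub>0 +
  fixes \<A> :: "('m::topological_space, 'd::finite) chart set" and g :: "('m, 'd) metric" and c :: "('m, 'd) chart"
    and i :: 'd and f :: "'p \<Rightarrow> real^'d \<Rightarrow> real" and B :: "(real^'d) set"
  assumes fam: "fam_smooth B f"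
    and straight: "\<And>t. t \<in> N \<Longrightarrow> metric_straightening i (f t) B \<A> g c"
begin

lemma open_B: "open B"
  using straight[OF base_in] by (simp add: metric_straightening_def straightening_def)

lemma fixed_on_image: "smooth_on (chart_image c) K \<Longrightarrow> fam_smooth B (\<lambda>_. K)"
  using fam_smooth_fixed[OF open_B] smooth_on_subset metric_straightening.B_image[OF straight[OF base_in]] by blast

lemma metric: "riemannian_metric \<A> g" and c: "c \<in> smooth_charts \<A>"
  using metric_straightening.metric[OF straight[OF base_in]] metric_straightening.c[OF straight[OF base_in]] by auto

lemma fam_pd: "fam_smooth B (\<lambda>t. partial_deriv j (f t))"
  by (rule fam_smooth_partial_deriv[OF open_B fam])

lemma fam_pd2: "fam_smooth B (\<lambda>t. partial_deriv j (partial_deriv k (f t)))"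
  by (rule fam_smooth_partial_deriv[OF open_B fam_pd])

lemma fam_frame: "fam_smooth B (\<lambda>t x. level_frame i (f t) j x $ a)"
proof -
  have "partial_deriv i (f t) x \<noteq> 0" if "t \<in> N" "x \<in> B" for t x
    using straight[OF that(1)] that(2) by (simp add: metric_straightening_def straightening_def)
  hence "fam_smooth B (\<lambda>t x. axis j 1 $ a + ((if j = i then 1 else 0) - partial_deriv j (f t) x) / partial_deriv i (f t) x * axis i 1 $ a)"
    by (intro fam_smooth_add fam_smooth_mult fam_smooth_divide fam_smooth_diff fam_smooth_const fam_pd open_B)
  thus ?thesis by (simp add: level_frame_def)
qed

lemma fam_frame_derivative:
  assumes "fam_smooth B K"
  shows "fam_smooth B (\<lambda>t x. frechet_derivative (K t) (at x) (level_frame i (f t) j x))"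
proof (rule fam_smooth_cong[OF open_B])
  show "fam_smooth B (\<lambda>t x. \<Sum>a\<in>UNIV. level_frame i (f t) j x $ a * partial_deriv a (K t) x)"
    by (intro fam_smooth_sum fam_smooth_mult fam_frame fam_smooth_partial_deriv assms open_B)
  fix t x assume "t \<in> N" "x \<in> B"
  thus "(\<Sum>a\<in>UNIV. level_frame i (f t) j x $ a * partial_deriv a (K t) x) =
      frechet_derivative (K t) (at x) (level_frame i (f t) j x)"
    using frechet_eq_partial_sum[OF fam_smooth_differentiable[OF assms]] by simp
qed

lemma fam_frame_derivs: "fam_smooth B K \<Longrightarrow> fam_smooth B (\<lambda>t. frame_derivs i (f t) js (K t))"
proof (induction js)
  case (Cons j js)
  from fam_frame_derivative[OF Cons.IH[OF Cons.prems]] show ?case by simp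
qed simp

lemma fam_level_trace: "fam_smooth B (\<lambda>t. level_trace g c i (f t))"
proof -
  have lm: "fam_smooth B (\<lambda>t x. level_metric g c i (f t) x $ j $ k)" for j k
    unfolding level_metric_def vec_lambda_beta
    by (intro fam_smooth_sum fam_smooth_mult fam_frame fixed_on_image smooth_metric_entry[OF metric c] open_B)
  have pm: "fam_smooth B (\<lambda>t x. padded i (level_metric g c i (f t) x) $ j $ k)" for j k
    using lm[of j k] by (cases "j = i"; cases "k = i"; cases "j = k") (auto simp: padded_def)
  have inv: "fam_smooth B (\<lambda>t x. matrix_inv (padded i (level_metric g c i (f t) x)) $ j $ k)" for j k
  proof (rule fam_smooth_matrix_inv[OF open_B pm])
    fix t x assume "t \<in> N" "x \<in> B"
    then interpret metric_straightening i "f t" B \<A> g c using straight by blast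
    show "det (padded i (level_metric g c i (f t) x)) \<noteq> 0"
      unfolding level_metric_eq[OF \<open>x \<in> B\<close>] by (rule pos_def_det[OF pos_def_padded[OF pos_def_c'[OF \<open>x \<in> B\<close>]]])
  qed
  have "fam_smooth B (\<lambda>t x. \<Sum>j\<in>-{i}. \<Sum>k\<in>-{i}. matrix_inv (padded i (level_metric g c i (f t) x)) $ j $ k *
      (\<Sum>a\<in>UNIV. \<Sum>b\<in>UNIV. ((\<Sum>l\<in>UNIV. partial_deriv l (f t) x * christoffel g c l a b x) - partial_deriv a (partial_deriv b (f t)) x)
       * (level_frame i (f t) j x $ a * level_frame i (f t) k x $ b)))"
    by (intro fam_smooth_sum fam_smooth_mult inv fam_smooth_diff fam_pd fam_pd2 fam_frame fixed_on_image
        smooth_christoffel[OF metric c] open_B)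
  thus ?thesis by (simp add: level_trace_def[abs_def] level_hessian_def)
qed

lemma fam_gradient_sq: "fam_smooth B (\<lambda>t. gradient_sq g c (f t))"
  unfolding gradient_sq_def[abs_def]
  by (intro fam_smooth_sum fam_smooth_mult fam_pd fixed_on_image smooth_metric_inverse[OF metric c] open_B)

lemma fam_level_mean_curvature: "fam_smooth B (\<lambda>t. level_mean_curvature g c i (f t))"
proof -
  have pos: "gradient_sq g c (f t) x > 0" if "t \<in> N" "x \<in> B" for t x
    using metric_straightening.gradient_sq_pos[OF straight[OF that(1)] that(2)] .
  hence "sqrt (gradient_sq g c (f t) x) \<noteq> 0" if "t \<in> N" "x \<in> B" for t x
    using that by (metis less_irrefl real_sqrt_gt_zero)
  with pos have "fam_smooth B (\<lambda>t x. level_trace g c i (f t) x / sqrt (gradient_sq g c (f t) x))"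
    by (intro fam_smooth_divide fam_smooth_sqrt fam_level_trace fam_gradient_sq open_B)
  thus ?thesis by (simp add: level_mean_curvature_def[abs_def])
qed

lemmas fam_mean_curvature_derivs = fam_frame_derivs[OF fam_level_mean_curvature]

end

context metric_straightening
begin

sublocale single: metric_deformation "top :: unit filter" UNIV "()" \<A> g c i "\<lambda>_. f" B
proof
  show "plain.fam_smooth B (\<lambda>_. f)" using smooth_f by (simp add: plain_smooth_iff[OF open_B])
qed

lemma smooth_gradient_sq: "smooth_on B (gradient_sq g c f)"
  using single.fam_gradient_sq by (simp add: plain_smooth_iff[OF open_B])

lemma smooth_mean_curvature_derivs: "smooth_on B (frame_derivs i f js (level_mean_curvature g c i f))"
  using single.fam_mean_curvature_derivs[of js] by (simp add: plain_smooth_iff[OF open_B])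

lemma mean_curvature_derivs_new_chart:
  "x \<in> B \<Longrightarrow> partial_derivs js (mean_curvature g c' i) (\<phi> x) = frame_derivs i f js (level_mean_curvature g c i f) x"
  by (rule partial_derivs_pullback[OF smooth_mean_curvature_derivs mean_curvature_new_chart])

text \<open>In the adapted chart the function is the coordinate \<open>i\<close>.\<close>

lemma slice_chart_level_set:
  assumes h: "\<And>x. x \<in> B \<Longrightarrow> h (chart_inv c x) = f x"
  shows "slice_chart \<A> {p. h p = 0} c' i"
proof -
  have "snd c' ` (fst c' \<inter> {p. h p = 0}) = {y \<in> chart_image c'. y $ i = 0}"
  proof (intro equalityI subsetI)
    fix y assume "y \<in> snd c' ` (fst c' \<inter> {p. h p = 0})"
    then obtain p where p: "p \<in> fst c" "snd c p \<in> B" "h p = 0" "y = \<phi> (snd c p)"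
      by (auto simp: repar.repar_simps)
    have "f (snd c p) = 0"
      using h[OF p(2)] p smooth_charts_chart[OF c] by simp
    thus "y \<in> {y \<in> chart_image c'. y $ i = 0}"
      using p by (simp add: c'_image straighten_nth)
  next
    fix y assume "y \<in> {y \<in> chart_image c'. y $ i = 0}"
    then obtain x where x: "x \<in> B" "y = \<phi> x" "f x = 0" by (auto simp: c'_image straighten_nth)
    have "chart_inv c x \<in> fst c' \<inter> {p. h p = 0}"
      using x h[OF x(1)] B_image by (auto simp: repar.repar_simps subset_iff)
    moreover have "y = snd c' (chart_inv c x)"
      using x B_image by (auto simp: repar.repar_simps subset_iff)
    ultimately show "y \<in> snd c' ` (fst c' \<inter> {p. h p = 0})" by blast
  qed
  thus ?thesis using c' by (simp add: slice_chart_def)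
qed

lemma flat_mean_curvature_derivs:
  assumes h: "\<And>x. x \<in> B \<Longrightarrow> h (chart_inv c x) = f x"
    and q: "q \<in> fst c" "snd c q \<in> B"
    and flat: "mean_curvature_vanishes_to_infinite_order \<A> g {p. h p = 0} q" and js: "set js \<subseteq> -{i}"
  shows "frame_derivs i f js (level_mean_curvature g c i f) (snd c q) = 0"
proof -
  have "q \<in> fst c'" "snd c' q = \<phi> (snd c q)" using q by (auto simp: repar.repar_simps)
  hence "partial_derivs js (mean_curvature g c' i) (\<phi> (snd c q)) = 0"
    using flat js slice_chart_level_set[OF h] unfolding mean_curvature_vanishes_to_infinite_order_def by metis
  thus ?thesis using mean_curvature_derivs_new_chart[OF q(2)] by simp
qed

text \<open>The factor by which the mean curvature differs from the trace is invertible, so the vanishing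
  of the former to first order passes to the latter.\<close>

lemma flat_level_trace:
  assumes h: "\<And>x. x \<in> B \<Longrightarrow> h (chart_inv c x) = f x"
    and q: "q \<in> fst c" "snd c q \<in> B"
    and flat: "mean_curvature_vanishes_to_infinite_order \<A> g {p. h p = 0} q"
  shows "level_trace g c i f (snd c q) = 0"
    and "l \<noteq> i \<Longrightarrow> frechet_derivative (level_trace g c i f) (at (snd c q)) (X l (snd c q)) = 0"
proof -
  let ?x = "snd c q" and ?L = "level_trace g c i f" and ?M = "level_mean_curvature g c i f"
  let ?s = "\<lambda>x. sqrt (gradient_sq g c f x)"
  have s: "?s x > 0" if "x \<in> B" for x using gradient_sq_pos[OF that] by simp
  have "?M ?x = 0" using flat_mean_curvature_derivs[OF h q flat, of "[]"] by simp
  thus L0: "?L ?x = 0" using s[OF q(2)] by (simp add: level_mean_curvature_def)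
  assume l: "l \<noteq> i"
  have M: "frechet_derivative ?M (at ?x) (X l ?x) = 0"
    using flat_mean_curvature_derivs[OF h q flat, of "[l]"] l by simp
  have ds: "?s differentiable (at ?x)"
  proof -
    have "(gradient_sq g c f has_derivative frechet_derivative (gradient_sq g c f) (at ?x)) (at ?x)"
      by (rule smooth_on_has_derivative[OF smooth_gradient_sq q(2)])
    from DERIV_compose_FDERIV[OF DERIV_real_sqrt[OF gradient_sq_pos[OF q(2)]] this]
    show ?thesis unfolding differentiable_def by blast
  qed
  have dM: "?M differentiable (at ?x)"
    using smooth_on_differentiable[OF smooth_mean_curvature_derivs[of "[]"] q(2)] by simp
  have "((\<lambda>x. ?M x * ?s x) has_derivative (\<lambda>v. ?M ?x * frechet_derivative ?s (at ?x) v + frechet_derivative ?M (at ?x) v * ?s ?x)) (at ?x)"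
    by (intro has_derivative_mult) (use ds dM in \<open>simp_all add: frechet_derivative_works[symmetric]\<close>)
  hence "(?L has_derivative (\<lambda>v. ?M ?x * frechet_derivative ?s (at ?x) v + frechet_derivative ?M (at ?x) v * ?s ?x)) (at ?x)"
    by (rule has_derivative_transform_within_open[OF _ open_B q(2)])
       (use s in \<open>simp add: level_mean_curvature_def less_imp_neq[THEN not_sym]\<close>)
  from fun_cong[OF frechet_derivative_at[OF this], of "X l ?x"]
  show "frechet_derivative ?L (at ?x) (X l ?x) = 0"
    using M \<open>?M ?x = 0\<close> by simp
qed

end

subsection \<open>Comparison with the mean curvature in a given slice chart\<close>

lemma partial_deriv_slice_cong:
  assumes "open V" "x \<in> V" "x $ i = 0" "j \<noteq> i" "\<And>y. y \<in> V \<Longrightarrow> y $ i = 0 \<Longrightarrow> K y = L y"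
  shows "partial_deriv j K x = partial_deriv j L x"
  unfolding partial_deriv_def
proof (rule deriv_cong_ev[OF _ refl])
  have "((\<lambda>t::real. x + t *\<^sub>R axis j 1) \<longlongrightarrow> x + 0 *\<^sub>R axis j 1) (nhds 0)"
    by (intro tendsto_intros filterlim_ident)
  hence "eventually (\<lambda>t::real. x + t *\<^sub>R axis j 1 \<in> V) (nhds 0)"
    using assms(1,2) by (intro topological_tendstoD[of _ x]) simp_all
  thus "eventually (\<lambda>t. K (x + t *\<^sub>R axis j 1) = L (x + t *\<^sub>R axis j 1)) (nhds 0)"
    by (rule eventually_mono) (use assms(3-5) in \<open>auto simp: axis_def\<close>)
qed

lemma partial_derivs_slice_cong:
  assumes "open V" "\<And>y. y \<in> V \<Longrightarrow> y $ i = 0 \<Longrightarrow> K y = L y" "set js \<subseteq> -{i}" "x \<in> V" "x $ i = 0"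
  shows "partial_derivs js K x = partial_derivs js L x"
  using assms(3-5)
proof (induction js arbitrary: x)
  case (Cons j js)
  show ?case
    unfolding partial_derivs_simps
    by (rule partial_deriv_slice_cong[OF assms(1), of x i]) (use Cons in auto)
qed (use assms(2) in auto)

lemma partial_derivs_cmult:
  fixes G :: "real^'d \<Rightarrow> real"
  assumes U: "open U" and G: "smooth_on U G" and "x \<in> U"
  shows "partial_derivs js (\<lambda>y. s * G y) x = s * partial_derivs js G x"
  using assms(3)
proof (induction js arbitrary: x)
  case (Cons j js)
  have "partial_deriv j (partial_derivs js (\<lambda>y. s * G y)) x = partial_deriv j (\<lambda>y. s * partial_derivs js G y) x"
    by (rule partial_deriv_cong[OF U Cons.prems]) (rule Cons.IH)
  also have "\<dots> = s * partial_deriv j (partial_derivs js G) x"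
  proof -
    note sm = smooth_on_partial_derivs[OF U G, of js]
    show ?thesis
      using partial_deriv_has_derivative[OF has_derivative_mult_right[OF smooth_on_has_derivative[OF sm Cons.prems]]]
        partial_deriv_eq_frechet[OF smooth_on_differentiable[OF sm Cons.prems]] by simp
  qed
  finally show ?case by simp
qed simp

text \<open>If \<open>f\<close> defines the hyperplane \<open>x $ i = 0\<close>, its tangential level frame there is the coordinate frame and only
  the derivative in the direction \<open>i\<close> of \<open>f\<close> survives; it cancels up to its sign.\<close>

lemma (in metric_straightening) level_mean_curvature_on_slice:
  assumes zero: "\<And>x. x \<in> B \<Longrightarrow> x $ i = 0 \<Longrightarrow> f x = 0" and x: "x \<in> B" "x $ i = 0"
  shows "level_mean_curvature g c i f x = sgn (partial_deriv i f x) * mean_curvature g c i x"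
proof -
  have pdc: "partial_deriv j (\<lambda>_. 0) y = 0" for j and y :: "real^'d"
    by (simp add: partial_deriv_def)
  have p1: "partial_deriv j f y = 0" if "j \<noteq> i" "y \<in> B" "y $ i = 0" for j y
    using partial_deriv_slice_cong[OF open_B that(2,3,1), of f "\<lambda>_. 0"] zero pdc by simp
  have p2: "partial_deriv a (partial_deriv b f) x = 0" if "a \<noteq> i" "b \<noteq> i" for a b
    using partial_deriv_slice_cong[OF open_B x that(1), of "partial_deriv b f" "\<lambda>_. 0"] p1[OF that(2)] pdc by simp
  let ?p = "partial_deriv i f x"
  have p: "?p \<noteq> 0" by (rule transversal[OF x(1)])
  have X: "X j x = axis j 1" if "j \<noteq> i" for j
    using p1[OF that x] that by (simp add: level_frame_def)
  have lm: "padded i (level_metric g c i f x) = padded i (g c x)"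
  proof -
    have "level_metric g c i f x $ j $ k = g c x $ j $ k" if "j \<noteq> i" "k \<noteq> i" for j k
      unfolding level_metric_eq[OF x(1)] metric_in_new_chart[OF x(1)] X[OF that(1)] X[OF that(2)]
      by (simp add: inner_axis' matrix_vector_mult_basis column_def)
    thus ?thesis by (simp add: padded_def vec_eq_iff)
  qed
  have gr: "(\<Sum>l\<in>UNIV. partial_deriv l f x * r l) = ?p * r i" for r
  proof -
    have "(\<Sum>l\<in>UNIV. partial_deriv l f x * r l) = (\<Sum>l\<in>UNIV. if l = i then ?p * r i else 0)"
      using p1[OF _ x] by (intro sum.cong refl) auto
    thus ?thesis by simp
  qed
  have lh: "level_hessian g c i f j k x = ?p * christoffel g c i j k x" if "j \<noteq> i" "k \<noteq> i" for j k
  proof -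
    have "level_hessian g c i f j k x = (\<Sum>a\<in>UNIV. \<Sum>b\<in>UNIV.
       (?p * christoffel g c i a b x - partial_deriv a (partial_deriv b f) x) * axis j 1 $ a * axis k 1 $ b)"
      by (simp add: level_hessian_def gr X[OF that(1)] X[OF that(2)] mult.assoc)
    also have "\<dots> = (\<Sum>a\<in>UNIV. ((?p * christoffel g c i a k x - partial_deriv a (partial_deriv k f) x) * axis j 1 $ a))"
      by (simp only: sum_mult_axis)
    also have "\<dots> = ?p * christoffel g c i j k x - partial_deriv j (partial_deriv k f) x"
      by (simp only: sum_mult_axis)
    finally show ?thesis using p2[OF that] by simp
  qed
  have gs: "gradient_sq g c f x = ?p\<^sup>2 * matrix_inv (g c x) $ i $ i"
  proof -
    have "gradient_sq g c f x = (\<Sum>a\<in>UNIV. partial_deriv a f x * (\<Sum>b\<in>UNIV. partial_deriv b f x * matrix_inv (g c x) $ a $ b))"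
      by (simp add: gradient_sq_def sum_distrib_left mult_ac)
    thus ?thesis by (simp add: gr power2_eq_square)
  qed
  have "level_trace g c i f x = ?p * (\<Sum>j\<in>-{i}. \<Sum>k\<in>-{i}. matrix_inv (padded i (g c x)) $ j $ k * christoffel g c i j k x)"
    by (simp add: level_trace_def lm lh sum_distrib_left mult.left_commute)
  thus ?thesis
    using p by (simp add: level_mean_curvature_def gs real_sqrt_mult real_sqrt_abs
        mean_curvature_eq[where g = g, OF pos_def_c[OF x(1)]] sgn_real_def)
qed

text \<open>On the slice the two charts have the same tangential coordinates, and the sign relating the two mean
curvatures is constant because \<open>B\<close> is connected.\<close>

lemma (in metric_straightening) mean_curvature_derivs_on_slice:
  assumes slice: "\<And>x. x \<in> B \<Longrightarrow> x $ i = 0 \<Longrightarrow> f x = 0" and x: "x \<in> B" "x $ i = 0" and js: "set js \<subseteq> -{i}"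
    and flat: "frame_derivs i f js (level_mean_curvature g c i f) x = 0"
  shows "partial_derivs js (mean_curvature g c i) x = 0"
proof -
  have fix\<phi>: "\<phi> y = y" if "y \<in> B" "y $ i = 0" for y
    using slice[OF that] that by (simp add: vec_eq_iff straighten_nth)
  have same_sign: "sgn (partial_deriv i f y) = sgn (partial_deriv i f x)" if "y \<in> B" for y
  proof (rule ccontr)
    assume "sgn (partial_deriv i f y) \<noteq> sgn (partial_deriv i f x)"
    hence opp: "partial_deriv i f y < 0 \<and> 0 < partial_deriv i f x \<or> partial_deriv i f x < 0 \<and> 0 < partial_deriv i f y"
      using transversal[OF that] transversal[OF x(1)] by (auto simp: sgn_real_def split: if_splits)
    have conn: "connected (partial_deriv i f ` B)"
      by (rule connected_continuous_image[OF
            smooth_on_continuous[OF smooth_on_partial_deriv[OF open_B smooth_f]] convex_connected[OF convex_B]])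
    have im: "partial_deriv i f y \<in> partial_deriv i f ` B" "partial_deriv i f x \<in> partial_deriv i f ` B"
      using that x(1) by auto
    have "0 \<in> partial_deriv i f ` B"
      using opp connectedD_interval[OF conn im, of 0] connectedD_interval[OF conn im(2) im(1), of 0] by auto
    thus False using transversal by fastforce
  qed
  let ?G = "mean_curvature g c' i" and ?s = "sgn (partial_deriv i f x)"
  have "smooth_on (\<phi> ` B) (\<lambda>y. level_mean_curvature g c i f (\<psi> y))"
  proof (rule smooth_on_compose[OF open_image open_B _ smooth_inverse_straighten])
    show "smooth_on B (level_mean_curvature g c i f)"
      using single.fam_level_mean_curvature by (simp add: plain_smooth_iff[OF open_B])
    show "\<psi> ` \<phi> ` B \<subseteq> B" using inverse_in by blast
  qed
  hence sG: "smooth_on (\<phi> ` B) ?G"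
    by (rule smooth_on_cong[OF open_image, rotated]) (auto simp: mean_curvature_new_chart)
  have "partial_derivs js (mean_curvature g c i) x = partial_derivs js (\<lambda>y. ?s * ?G y) x"
  proof (rule partial_derivs_slice_cong[OF open_B _ js x])
    fix y assume y: "y \<in> B" "y $ i = 0"
    have "?G y = sgn (partial_deriv i f y) * mean_curvature g c i y"
      using mean_curvature_new_chart[OF y(1)] level_mean_curvature_on_slice[OF slice y] fix\<phi>[OF y] by simp
    thus "mean_curvature g c i y = ?s * ?G y"
      using same_sign[OF y(1)] transversal[OF x(1)] by (simp add: sgn_real_def)
  qed
  also have "\<dots> = ?s * partial_derivs js ?G x"
    using fix\<phi>[OF x] x(1) by (intro partial_derivs_cmult[OF open_image sG]) (metis imageI)
  also have "partial_derivs js ?G x = 0"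
    using mean_curvature_derivs_new_chart[OF x(1), of js] fix\<phi>[OF x] flat by simp
  finally show ?thesis by simp
qed

section \<open>Openness\<close>

subsection \<open>The smooth topology\<close>

lemma openin_Cinf_nbhd:
  assumes "f \<in> smooth_functions \<A>" "c \<in> smooth_charts \<A>" "compact K" "K \<subseteq> chart_image c" "\<epsilon> > 0"
  shows "openin (Cinf_topology \<A>) (Cinf_nbhd \<A> f c K k \<epsilon>)"
  unfolding Cinf_topology_def by (rule topology_generated_by_Basis) (use assms in blast)

lemma Cinf_nbhd_self: "f \<in> smooth_functions \<A> \<Longrightarrow> \<epsilon> > 0 \<Longrightarrow> f \<in> Cinf_nbhd \<A> f c K k \<epsilon>"
  by (simp add: Cinf_nbhd_def)

lemma partial_derivs_jointly_continuous:
  assumes A: "smooth_atlas \<A>" and h: "h\<^sub>0 \<in> smooth_functions \<A>" and c: "c \<in> smooth_charts \<A>" and x: "x \<in> chart_image c"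
  shows "((\<lambda>z. partial_derivs js (fst z \<circ> chart_inv c) (snd z)) \<longlongrightarrow> partial_derivs js (h\<^sub>0 \<circ> chart_inv c) x)
    (nhdsin (Cinf_topology \<A>) h\<^sub>0 \<times>\<^sub>F nhds x)"
proof (rule tendstoI)
  fix e :: real assume e: "e > 0"
  have o: "open (chart_image c)" using smooth_charts_chart[OF c] is_chart_open by blast
  let ?D = "\<lambda>h. partial_derivs js (h \<circ> chart_inv c)"
  obtain r where r: "r > 0" "cball x r \<subseteq> chart_image c" using o x open_contains_cball by blast
  have "continuous_on (chart_image c) (?D h\<^sub>0)"
    by (intro smooth_on_continuous smooth_on_partial_derivs o smooth_functions_chart[OF A h c])
  hence "isCont (?D h\<^sub>0) x" using o x continuous_on_eq_continuous_at by blast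
  hence "(?D h\<^sub>0 \<longlongrightarrow> ?D h\<^sub>0 x) (nhds x)" by (simp add: isCont_def tendsto_at_iff_tendsto_nhds)
  hence "eventually (\<lambda>y. dist (?D h\<^sub>0 y) (?D h\<^sub>0 x) < e / 2) (nhds x)"
    using e by (intro tendstoD) auto
  moreover have "eventually (\<lambda>y. y \<in> ball x r) (nhds x)"
    using r by (intro eventually_nhds_in_open) auto
  ultimately have Q: "eventually (\<lambda>y. dist (?D h\<^sub>0 y) (?D h\<^sub>0 x) < e / 2 \<and> y \<in> ball x r) (nhds x)"
    by (rule eventually_conj)
  let ?O = "Cinf_nbhd \<A> h\<^sub>0 c (cball x r) (length js) (e / 2)"
  have "eventually (\<lambda>h. h \<in> ?O) (nhdsin (Cinf_topology \<A>) h\<^sub>0)"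
    unfolding eventually_nhdsin
    using openin_Cinf_nbhd[OF h c compact_cball r(2), of "e / 2" "length js"] Cinf_nbhd_self[OF h, of "e / 2" c "cball x r" "length js"] e
    by (intro disjI2 exI[of _ ?O]) simp
  from eventually_prodI[OF this Q]
  show "eventually (\<lambda>z. dist (?D (fst z) (snd z)) (?D h\<^sub>0 x) < e) (nhdsin (Cinf_topology \<A>) h\<^sub>0 \<times>\<^sub>F nhds x)"
  proof (rule eventually_mono)
    fix z
    assume z: "fst z \<in> ?O \<and> dist (?D h\<^sub>0 (snd z)) (?D h\<^sub>0 x) < e / 2 \<and> snd z \<in> ball x r"
    hence "dist (?D (fst z) (snd z)) (?D h\<^sub>0 (snd z)) < e / 2"
      by (auto simp: Cinf_nbhd_def dist_real_def)
    thus "dist (?D (fst z) (snd z)) (?D h\<^sub>0 x) < e"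
      using conjunct1[OF conjunct2[OF z]] dist_triangle[of "?D (fst z) (snd z)" "?D h\<^sub>0 x" "?D h\<^sub>0 (snd z)"]
      by linarith
  qed
qed

text \<open>The evaluation of functions in a chart is a smooth family with respect to the smooth topology.  This is the
family to which the calculus of families is applied.\<close>

lemma Cinf_fam_smooth:
  assumes A: "smooth_atlas \<A>" and h: "h\<^sub>0 \<in> smooth_functions \<A>" and c: "c \<in> smooth_charts \<A>"
    and def: "deformation (nhdsin (Cinf_topology \<A>) h\<^sub>0) N h\<^sub>0" and N: "N \<subseteq> smooth_functions \<A>"
  shows "deformation.fam_smooth (nhdsin (Cinf_topology \<A>) h\<^sub>0) N h\<^sub>0 (chart_image c) (\<lambda>h. h \<circ> chart_inv c)"
proof -
  interpret deformation "nhdsin (Cinf_topology \<A>) h\<^sub>0" N h\<^sub>0 by (rule def)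
  have o: "open (chart_image c)" using smooth_charts_chart[OF c] is_chart_open by blast
  have C0: "fam_C0 (chart_image c) (\<lambda>h. partial_derivs js (h \<circ> chart_inv c))" for js
    unfolding fam_C0_def using partial_derivs_jointly_continuous[OF A h c] by blast
  have d: "partial_derivs js (h \<circ> chart_inv c) differentiable (at x)" if "h \<in> N" "x \<in> chart_image c" for js h x
    using smooth_on_differentiable[OF smooth_on_partial_derivs[OF o smooth_functions_chart[OF A _ c]]] N that by blast
  have "fam_Ck k (chart_image c) (\<lambda>h. partial_derivs js (h \<circ> chart_inv c))" for k js
  proof (induction k arbitrary: js)
    case 0
    show ?case unfolding fam_Ck.simps by (rule C0)
  next
    case (Suc k)
    have "fam_Ck k (chart_image c) (\<lambda>h x. frechet_derivative (partial_derivs js (h \<circ> chart_inv c)) (at x) v)" for v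
    proof (rule fam_Ck_cong[OF o])
      have "fam_Ck k (chart_image c) (\<lambda>h x. \<Sum>j\<in>J. v $ j * partial_derivs (j # js) (h \<circ> chart_inv c) x)" for J
      proof (induction J rule: infinite_finite_induct)
        case (insert j J)
        have "fam_Ck k (chart_image c) (\<lambda>h x. v $ j * partial_derivs (j # js) (h \<circ> chart_inv c) x +
            (\<Sum>j\<in>J. v $ j * partial_derivs (j # js) (h \<circ> chart_inv c) x))"
          by (rule fam_Ck_add[OF o fam_Ck_mult[OF o fam_Ck_const Suc.IH] insert.IH])
        thus ?case by (simp only: sum.insert[OF insert.hyps])
      qed (auto intro: fam_Ck_const)
      thus "fam_Ck k (chart_image c) (\<lambda>h x. \<Sum>j\<in>UNIV. v $ j * partial_derivs (j # js) (h \<circ> chart_inv c) x)" .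
      fix h x assume "h \<in> N" "x \<in> chart_image c"
      from frechet_eq_partial_sum[OF d[OF this]]
      show "(\<Sum>j\<in>UNIV. v $ j * partial_derivs (j # js) (h \<circ> chart_inv c) x) =
         frechet_derivative (partial_derivs js (h \<circ> chart_inv c)) (at x) v" by simp
    qed
    thus ?case unfolding fam_Ck.simps using C0 d by blast
  qed
  from this[of _ "[]"] show ?thesis by (simp add: fam_smooth_def)
qed

lemma eventually_in_chart:
  fixes P :: "('m::topological_space \<Rightarrow> real) \<Rightarrow> real^'d::finite \<Rightarrow> bool"
  assumes A: "smooth_atlas \<A>" and h: "h\<^sub>0 \<in> smooth_functions \<A>" and c: "is_chart c" "p \<in> fst c"
    and ev: "eventually (\<lambda>z. P (fst z) (snd z)) (nhdsin (Cinf_topology \<A>) h\<^sub>0 \<times>\<^sub>F nhds (snd c p))"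
  obtains O' V where "openin (Cinf_topology \<A>) O'" "h\<^sub>0 \<in> O'" "open V" "p \<in> V" "V \<subseteq> fst c"
    "\<And>h q. h \<in> O' \<Longrightarrow> q \<in> V \<Longrightarrow> P h (snd c q)"
proof -
  obtain Pf Pg where P: "eventually Pf (nhdsin (Cinf_topology \<A>) h\<^sub>0)" "eventually Pg (nhds (snd c p))"
     "\<And>h x. Pf h \<Longrightarrow> Pg x \<Longrightarrow> P h x"
    using ev unfolding eventually_prod_filter by auto
  obtain O' where O': "openin (Cinf_topology \<A>) O'" "h\<^sub>0 \<in> O'" "\<forall>h\<in>O'. Pf h"
    using P(1) h topspace_Cinf_topology[OF A] unfolding eventually_nhdsin by auto
  obtain W where W: "open W" "snd c p \<in> W" "\<forall>x\<in>W. Pg x"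
    using P(2) unfolding eventually_nhds by auto
  show thesis
    by (rule that[OF O'(1,2) open_chart_preimage[OF c(1) W(1)]]) (use c W O' P in auto)
qed

text \<open>Finitely many of the sets \<open>V\<close> cover \<open>C\<close>, and the corresponding sets \<open>O'\<close> are intersected.\<close>

lemma tube:
  fixes P :: "('m::topological_space \<Rightarrow> real) \<Rightarrow> 'm \<Rightarrow> bool"
  assumes "compact C" and ne: "h\<^sub>0 \<in> topspace T"
    and loc: "\<And>p. p \<in> C \<Longrightarrow> \<exists>O' V. openin T O' \<and> h\<^sub>0 \<in> O' \<and> open V \<and> p \<in> V \<and> (\<forall>h\<in>O'. \<forall>q\<in>V. P h q)"
  shows "\<exists>O'. openin T O' \<and> h\<^sub>0 \<in> O' \<and> (\<forall>h\<in>O'. \<forall>q\<in>C. P h q)"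
proof -
  obtain Of V where OV: "\<And>p. p \<in> C \<Longrightarrow> openin T (Of p) \<and> h\<^sub>0 \<in> Of p \<and> open (V p) \<and> p \<in> V p \<and> (\<forall>h\<in>Of p. \<forall>q\<in>V p. P h q)"
    using loc by metis
  obtain D where D: "D \<subseteq> C" "finite D" "C \<subseteq> (\<Union>p\<in>D. V p)"
    using compactE_image[OF assms(1), of C V] OV by blast
  have "openin T (topspace T \<inter> (\<Inter>p\<in>D. Of p))"
    using D OV by (intro openin_Int_Inter) auto
  thus ?thesis using D OV ne by (intro exI[of _ "topspace T \<inter> (\<Inter>p\<in>D. Of p)"]) (auto; blast)
qed

subsection \<open>Critical points\<close>

lemma compatible_sym: "compatible c d \<Longrightarrow> compatible d c"
  by (simp add: compatible_def)

locale chart_change =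
  fixes \<A> :: "('m::topological_space, 'd::finite) chart set" and c d and h :: "'m \<Rightarrow> real" and p
  assumes atlas: "smooth_atlas \<A>" and c: "c \<in> smooth_charts \<A>" and d: "d \<in> smooth_charts \<A>"
    and compatible: "compatible c d" and h: "h \<in> smooth_functions \<A>" and p: "p \<in> fst c" "p \<in> fst d"
begin

abbreviation "u \<equiv> h \<circ> chart_inv c"
abbreviation "w \<equiv> h \<circ> chart_inv d"
abbreviation "\<tau> \<equiv> transition d c"
abbreviation "V \<equiv> overlap d c"

lemma charts: "is_chart c" "is_chart d" using smooth_charts_chart[OF c] smooth_charts_chart[OF d] by auto

lemma open_V: "open V" by (rule open_overlap[OF charts(2,1)])

lemma smooth_u: "smooth_on (chart_image c) u" by (rule smooth_functions_chart[OF atlas h c])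

lemma open_c: "open (chart_image c)" using is_chart_open(2)[OF charts(1)] .

lemma \<tau>_in: "y \<in> V \<Longrightarrow> \<tau> y \<in> chart_image c"
  using transition_in[OF charts(2)] overlap_sub by blast

lemma smooth_\<tau>: "smooth_on V (\<lambda>y. \<tau> y $ a)"
  using compatible smooth_on_vec_iff[OF open_V, of \<tau>] by (simp add: compatible_def)

lemma w_eq: "y \<in> V \<Longrightarrow> w y = u (\<tau> y)"
  using charts by (auto simp: overlap_iff[OF charts(2)] transition_def)

lemma chain_rule:
  assumes v: "smooth_on (chart_image c) v" and y: "y \<in> V"
  shows "partial_deriv k (\<lambda>y. v (\<tau> y)) y = (\<Sum>a\<in>UNIV. partial_deriv k (\<lambda>y. \<tau> y $ a) y * partial_deriv a v (\<tau> y))"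
proof -
  have s\<tau>: "smooth_on V \<tau>" using compatible by (simp add: compatible_def)
  have dv: "v differentiable (at (\<tau> y))" by (rule smooth_on_differentiable[OF v \<tau>_in[OF y]])
  have h\<tau>: "(\<tau> has_derivative frechet_derivative \<tau> (at y)) (at y)" by (rule smooth_on_has_derivative[OF s\<tau> y])
  have "((\<lambda>y. \<tau> y $ a) has_derivative (\<lambda>x. frechet_derivative \<tau> (at y) x $ a)) (at y)" for a
    by (rule bounded_linear.has_derivative[OF bounded_linear_vec_nth h\<tau>])
  hence comp: "partial_deriv k (\<lambda>y. \<tau> y $ a) y = frechet_derivative \<tau> (at y) (axis k 1) $ a" for a
    by (rule partial_deriv_has_derivative)
  have "((\<lambda>y. v (\<tau> y)) has_derivative (\<lambda>x. frechet_derivative v (at (\<tau> y)) (frechet_derivative \<tau> (at y) x))) (at y)"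
    using diff_chain_at[OF h\<tau>, of v "frechet_derivative v (at (\<tau> y))"] dv
    by (simp add: o_def frechet_derivative_works[symmetric])
  from partial_deriv_has_derivative[OF this, of k] show ?thesis
    by (simp add: frechet_eq_partial_sum[OF dv] comp)
qed

lemma p_in: "snd d p \<in> V" "\<tau> (snd d p) = snd c p"
  using p charts by (auto simp: overlap_def transition_def)

lemma gradient_change:
  "y \<in> V \<Longrightarrow> partial_deriv k w y = (\<Sum>a\<in>UNIV. partial_deriv k (\<lambda>y. \<tau> y $ a) y * partial_deriv a u (\<tau> y))"
  using partial_deriv_cong[of V y w "\<lambda>y. u (\<tau> y)" k] open_V w_eq chain_rule[OF smooth_u] by simp

lemma critical_change: "critical_in_chart c h p \<Longrightarrow> critical_in_chart d h p"
  by (simp add: critical_in_chart_def gradient_change[OF p_in(1)] p_in(2))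

lemma hessian_change:
  assumes crit: "critical_in_chart c h p"
  shows "det (hessian_in_chart d h p) = (det (\<chi> a b. partial_deriv b (\<lambda>y. \<tau> y $ a) (snd d p)))\<^sup>2 * det (hessian_in_chart c h p)"
proof -
  let ?y = "snd d p"
  define J where "J = (\<chi> a b. partial_deriv b (\<lambda>y. \<tau> y $ a) ?y)"
  have su: "smooth_on (chart_image c) (partial_deriv a u)" for a
    by (rule smooth_on_partial_deriv[OF open_c smooth_u])
  have crit': "partial_deriv a u (\<tau> ?y) = 0" for a
    using crit by (simp add: critical_in_chart_def p_in)
  have "partial_deriv j (partial_deriv k w) ?y = (\<Sum>a\<in>UNIV. \<Sum>b\<in>UNIV. J $ b $ j * partial_deriv b (partial_deriv a u) (\<tau> ?y) * J $ a $ k)" for j k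
  proof -
    let ?t = "\<lambda>a. partial_deriv k (\<lambda>y. \<tau> y $ a)" and ?v = "\<lambda>a y. partial_deriv a u (\<tau> y)"
    have ht: "(?t a has_derivative frechet_derivative (?t a) (at ?y)) (at ?y)" for a
      by (rule smooth_on_has_derivative[OF smooth_on_partial_deriv[OF open_V smooth_\<tau>] p_in(1)])
    have sv: "smooth_on V (?v a)" for a
    proof (rule smooth_on_compose[OF open_V open_c su])
      show "smooth_on V \<tau>" using compatible by (simp add: compatible_def)
      show "\<tau> ` V \<subseteq> chart_image c" using \<tau>_in by blast
    qed
    have hv: "(?v a has_derivative frechet_derivative (?v a) (at ?y)) (at ?y)" for a
      by (rule smooth_on_has_derivative[OF sv p_in(1)])
    have "((\<lambda>y. \<Sum>a\<in>UNIV. ?t a y * ?v a y) has_derivative (\<lambda>x. \<Sum>a\<in>UNIV. ?t a ?y * frechet_derivative (?v a) (at ?y) x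
         + frechet_derivative (?t a) (at ?y) x * ?v a ?y)) (at ?y)"
      by (intro has_derivative_sum has_derivative_mult ht hv)
    from partial_deriv_has_derivative[OF this, of j]
    have "partial_deriv j (\<lambda>y. \<Sum>a\<in>UNIV. ?t a y * ?v a y) ?y = (\<Sum>a\<in>UNIV. ?t a ?y * partial_deriv j (?v a) ?y)"
      by (simp add: crit' partial_deriv_eq_frechet[OF smooth_on_differentiable[OF sv p_in(1)]])
    moreover have "partial_deriv j (partial_deriv k w) ?y = partial_deriv j (\<lambda>y. \<Sum>a\<in>UNIV. ?t a y * ?v a y) ?y"
      by (rule partial_deriv_cong[OF open_V p_in(1)]) (rule gradient_change)
    ultimately show ?thesis
      by (simp add: chain_rule[OF su p_in(1)] J_def sum_distrib_left mult_ac)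
  qed
  moreover have "(transpose J ** hessian_in_chart c h p ** J) $ j $ k =
     (\<Sum>a\<in>UNIV. \<Sum>b\<in>UNIV. J $ b $ j * partial_deriv b (partial_deriv a u) (\<tau> ?y) * J $ a $ k)" for j k
    by (simp add: congruence_entry inner_matrix_sum column_def hessian_in_chart_def p_in(2)) (rule sum.swap)
  ultimately have "hessian_in_chart d h p = transpose J ** hessian_in_chart c h p ** J"
    by (simp add: vec_eq_iff hessian_in_chart_def)
  thus ?thesis by (simp add: det_mul det_transpose J_def power2_eq_square)
qed

end

lemma critical_in_chart_iff:
  assumes "smooth_atlas \<A>" "c \<in> smooth_charts \<A>" "d \<in> \<A>" "h \<in> smooth_functions \<A>" "p \<in> fst c" "p \<in> fst d"
  shows "critical_in_chart c h p \<longleftrightarrow> critical_in_chart d h p"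
proof -
  have d: "d \<in> smooth_charts \<A>" and cd: "compatible c d"
    using atlas_in_smooth_charts[OF assms(1,3)] assms(2,3) by (auto simp: smooth_charts_def)
  have "chart_change \<A> c d h p" "chart_change \<A> d c h p"
    using assms d cd compatible_sym[OF cd] by (simp_all add: chart_change_def)
  thus ?thesis using chart_change.critical_change by blast
qed

text \<open>At a critical point the term with the second derivatives of the transition map drops out, so the Hessian
transforms as a bilinear form.\<close>

lemma nondegenerate_in_chart_iff:
  assumes "smooth_atlas \<A>" "c \<in> smooth_charts \<A>" "d \<in> \<A>" "h \<in> smooth_functions \<A>" "p \<in> fst c" "p \<in> fst d"
    and "critical_in_chart c h p"
  shows "det (hessian_in_chart c h p) \<noteq> 0 \<longleftrightarrow> det (hessian_in_chart d h p) \<noteq> 0"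
proof -
  have d: "d \<in> smooth_charts \<A>" and cd: "compatible c d"
    using atlas_in_smooth_charts[OF assms(1,3)] assms(2,3) by (auto simp: smooth_charts_def)
  have cc: "chart_change \<A> c d h p" "chart_change \<A> d c h p"
    using assms(1-6) d cd compatible_sym[OF cd] by (simp_all add: chart_change_def)
  have crit: "critical_in_chart d h p" using critical_in_chart_iff[OF assms(1-6)] assms(7) by simp
  have "det (hessian_in_chart c h p) = 0 \<Longrightarrow> det (hessian_in_chart d h p) = 0"
    using chart_change.hessian_change[OF cc(1) assms(7)] by simp
  moreover have "det (hessian_in_chart d h p) = 0 \<Longrightarrow> det (hessian_in_chart c h p) = 0"
    using chart_change.hessian_change[OF cc(2) crit] by simp
  ultimately show ?thesis by blast
qed

text \<open>The three conditions at single points.  All of them are open in the function and the point jointly, the last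
one at functions with regular zeros.\<close>

definition morse_at :: "('m::topological_space, 'd::finite) chart set \<Rightarrow> ('m \<Rightarrow> real) \<Rightarrow> 'm \<Rightarrow> bool" where
  "morse_at \<A> h p \<longleftrightarrow> (\<forall>c\<in>\<A>. p \<in> fst c \<longrightarrow> critical_in_chart c h p \<longrightarrow> det (hessian_in_chart c h p) \<noteq> 0)"

definition regular_zero_at :: "('m::topological_space, 'd::finite) chart set \<Rightarrow> ('m \<Rightarrow> real) \<Rightarrow> 'm \<Rightarrow> bool" where
  "regular_zero_at \<A> h p \<longleftrightarrow> (h p = 0 \<longrightarrow> (\<forall>c\<in>\<A>. p \<in> fst c \<longrightarrow> \<not> critical_in_chart c h p))"

definition finite_order_at ::
  "('m::topological_space, 'd::finite) chart set \<Rightarrow> ('m, 'd) metric \<Rightarrow> ('m \<Rightarrow> real) \<Rightarrow> 'm \<Rightarrow> bool" where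
  "finite_order_at \<A> g h p \<longleftrightarrow> (h p = 0 \<longrightarrow> \<not> mean_curvature_vanishes_to_infinite_order \<A> g {p. h p = 0} p)"

lemma morse_atI:
  assumes "smooth_atlas \<A>" "h \<in> smooth_functions \<A>" "c \<in> \<A>" "p \<in> fst c"
    "critical_in_chart c h p \<Longrightarrow> det (hessian_in_chart c h p) \<noteq> 0"
  shows "morse_at \<A> h p"
  unfolding morse_at_def
  using critical_in_chart_iff[OF assms(1) atlas_in_smooth_charts[OF assms(1,3)] _ assms(2,4)]
    nondegenerate_in_chart_iff[OF assms(1) atlas_in_smooth_charts[OF assms(1,3)] _ assms(2,4)] assms(5) by blast

lemma regular_zero_atI:
  assumes "smooth_atlas \<A>" "h \<in> smooth_functions \<A>" "c \<in> \<A>" "p \<in> fst c"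
    "h p = 0 \<Longrightarrow> \<not> critical_in_chart c h p"
  shows "regular_zero_at \<A> h p"
  unfolding regular_zero_at_def
  using critical_in_chart_iff[OF assms(1) atlas_in_smooth_charts[OF assms(1,3)] _ assms(2,4)] assms(5) by blast

lemma regular_zero_atD:
  assumes "smooth_atlas \<A>" "h \<in> smooth_functions \<A>" "c \<in> smooth_charts \<A>" "p \<in> fst c" "regular_zero_at \<A> h p" "h p = 0"
  shows "\<exists>i. partial_deriv i (h \<circ> chart_inv c) (snd c p) \<noteq> 0"
proof -
  obtain d where d: "d \<in> \<A>" "p \<in> fst d" using atlas_covers[OF assms(1)] by blast
  hence "\<not> critical_in_chart d h p" using assms by (simp add: regular_zero_at_def)
  hence "\<not> critical_in_chart c h p" using critical_in_chart_iff[OF assms(1,3) d(1) assms(2,4) d(2)] by simp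
  thus ?thesis by (simp add: critical_in_chart_def)
qed

lemma open_morse_at:
  assumes A: "smooth_atlas \<A>" and h: "h\<^sub>0 \<in> smooth_functions \<A>" and P: "morse_at \<A> h\<^sub>0 p"
  shows "\<exists>O' V. openin (Cinf_topology \<A>) O' \<and> h\<^sub>0 \<in> O' \<and> open V \<and> p \<in> V \<and> (\<forall>h\<in>O'. \<forall>q\<in>V. morse_at \<A> h q)"
proof -
  obtain c where c: "c \<in> \<A>" "p \<in> fst c" using atlas_covers[OF A] by blast
  have cs: "c \<in> smooth_charts \<A>" by (rule atlas_in_smooth_charts[OF A c(1)])
  have ch: "is_chart c" by (rule smooth_charts_chart[OF cs])
  let ?F = "nhdsin (Cinf_topology \<A>) h\<^sub>0" and ?x = "snd c p"
  let ?Q = "\<lambda>h x. (\<exists>j. partial_deriv j (h \<circ> chart_inv c) x \<noteq> 0) \<or>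
     det (\<chi> j k. partial_deriv j (partial_deriv k (h \<circ> chart_inv c)) x) \<noteq> 0"
  note jc = partial_derivs_jointly_continuous[OF A h cs chart_in_image[OF c(2)]]
  have "eventually (\<lambda>z. ?Q (fst z) (snd z)) (?F \<times>\<^sub>F nhds ?x)"
  proof (cases "critical_in_chart c h\<^sub>0 p")
    case False
    then obtain j where "partial_deriv j (h\<^sub>0 \<circ> chart_inv c) ?x \<noteq> 0" by (auto simp: critical_in_chart_def)
    with jc[of "[j]"] have "eventually (\<lambda>z. partial_deriv j (fst z \<circ> chart_inv c) (snd z) \<noteq> 0) (?F \<times>\<^sub>F nhds ?x)"
      using tendsto_imp_eventually_ne by fastforce
    thus ?thesis by (rule eventually_mono) blast
  next
    case True
    hence ne: "det (\<chi> j k. partial_deriv j (partial_deriv k (h\<^sub>0 \<circ> chart_inv c)) ?x) \<noteq> 0"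
      using P c by (simp add: morse_at_def hessian_in_chart_def)
    have "((\<lambda>z. det (\<chi> j k. partial_deriv j (partial_deriv k (fst z \<circ> chart_inv c)) (snd z))) \<longlongrightarrow>
        det (\<chi> j k. partial_deriv j (partial_deriv k (h\<^sub>0 \<circ> chart_inv c)) ?x)) (?F \<times>\<^sub>F nhds ?x)"
      unfolding det_def vec_lambda_beta
      using jc[of "[_, _]"] by (intro tendsto_sum tendsto_mult tendsto_prod tendsto_const) simp
    from tendsto_imp_eventually_ne[OF this ne] show ?thesis by (rule eventually_mono) blast
  qed
  then obtain O' V where OV: "openin (Cinf_topology \<A>) O'" "h\<^sub>0 \<in> O'" "open V" "p \<in> V" "V \<subseteq> fst c"
    "\<And>h q. h \<in> O' \<Longrightarrow> q \<in> V \<Longrightarrow> ?Q h (snd c q)"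
    using eventually_in_chart[OF A h ch c(2), of ?Q] by blast
  have "morse_at \<A> h q" if "h \<in> O'" "q \<in> V" for h q
  proof (rule morse_atI[OF A _ c(1)])
    show "h \<in> smooth_functions \<A>" using openin_subset[OF OV(1)] topspace_Cinf_topology[OF A] that by auto
    show "q \<in> fst c" using OV(5) that by auto
    show "det (hessian_in_chart c h q) \<noteq> 0" if "critical_in_chart c h q"
      using OV(6)[OF \<open>h \<in> O'\<close> \<open>q \<in> V\<close>] that by (simp add: critical_in_chart_def hessian_in_chart_def)
  qed
  thus ?thesis using OV by blast
qed

lemma open_regular_zero_at:
  assumes A: "smooth_atlas \<A>" and h: "h\<^sub>0 \<in> smooth_functions \<A>" and P: "regular_zero_at \<A> h\<^sub>0 p"
  shows "\<exists>O' V. openin (Cinf_topology \<A>) O' \<and> h\<^sub>0 \<in> O' \<and> open V \<and> p \<in> V \<and> (\<forall>h\<in>O'. \<forall>q\<in>V. regular_zero_at \<A> h q)"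
proof -
  obtain c where c: "c \<in> \<A>" "p \<in> fst c" using atlas_covers[OF A] by blast
  have cs: "c \<in> smooth_charts \<A>" by (rule atlas_in_smooth_charts[OF A c(1)])
  have ch: "is_chart c" by (rule smooth_charts_chart[OF cs])
  let ?F = "nhdsin (Cinf_topology \<A>) h\<^sub>0" and ?x = "snd c p"
  let ?Q = "\<lambda>h x. (\<exists>j. partial_deriv j (h \<circ> chart_inv c) x \<noteq> 0) \<or> h (chart_inv c x) \<noteq> 0"
  note jc = partial_derivs_jointly_continuous[OF A h cs chart_in_image[OF c(2)]]
  have "eventually (\<lambda>z. ?Q (fst z) (snd z)) (?F \<times>\<^sub>F nhds ?x)"
  proof (cases "h\<^sub>0 p = 0")
    case True
    then obtain j where "partial_deriv j (h\<^sub>0 \<circ> chart_inv c) ?x \<noteq> 0"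
      using regular_zero_atD[OF A h cs c(2) P] by blast
    with jc[of "[j]"] have "eventually (\<lambda>z. partial_deriv j (fst z \<circ> chart_inv c) (snd z) \<noteq> 0) (?F \<times>\<^sub>F nhds ?x)"
      using tendsto_imp_eventually_ne by fastforce
    thus ?thesis by (rule eventually_mono) blast
  next
    case False
    hence ne: "(h\<^sub>0 \<circ> chart_inv c) ?x \<noteq> 0" using ch c by simp
    from tendsto_imp_eventually_ne[OF jc[of "[]", unfolded partial_derivs_simps] ne]
    show ?thesis by (rule eventually_mono) simp
  qed
  then obtain O' V where OV: "openin (Cinf_topology \<A>) O'" "h\<^sub>0 \<in> O'" "open V" "p \<in> V" "V \<subseteq> fst c"
    "\<And>h q. h \<in> O' \<Longrightarrow> q \<in> V \<Longrightarrow> ?Q h (snd c q)"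
    using eventually_in_chart[OF A h ch c(2), of ?Q] by blast
  have "regular_zero_at \<A> h q" if "h \<in> O'" "q \<in> V" for h q
  proof (rule regular_zero_atI[OF A _ c(1)])
    show "h \<in> smooth_functions \<A>" using openin_subset[OF OV(1)] topspace_Cinf_topology[OF A] that by auto
    show q: "q \<in> fst c" using OV(5) that by auto
    show "\<not> critical_in_chart c h q" if "h q = 0"
      using OV(6)[OF \<open>h \<in> O'\<close> \<open>q \<in> V\<close>] that q ch by (simp add: critical_in_chart_def)
  qed
  thus ?thesis using OV by blast
qed

text \<open>Near a point at which \<open>h\<^sub>0\<close> is transversal to a coordinate direction, one ball serves to straighten
  all functions close to \<open>h\<^sub>0\<close>.\<close>

lemma straightening_ball:
  fixes \<A> :: "('m::topological_space, 'd::finite) chart set"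
  assumes A: "smooth_atlas \<A>" and h: "h\<^sub>0 \<in> smooth_functions \<A>" and c: "c \<in> smooth_charts \<A>" and p: "p \<in> fst c"
    and g: "riemannian_metric \<A> g" and i: "partial_deriv i (h\<^sub>0 \<circ> chart_inv c) (snd c p) \<noteq> 0"
  obtains O' r where "openin (Cinf_topology \<A>) O'" "h\<^sub>0 \<in> O'" "r > 0" "cball (snd c p) r \<subseteq> chart_image c"
    "\<And>h. h \<in> O' \<Longrightarrow> metric_straightening i (h \<circ> chart_inv c) (ball (snd c p) r) \<A> g c"
proof -
  have ch: "is_chart c" by (rule smooth_charts_chart[OF c])
  let ?F = "nhdsin (Cinf_topology \<A>) h\<^sub>0" and ?x = "snd c p"
  have "eventually (\<lambda>z. partial_deriv i (fst z \<circ> chart_inv c) (snd z) \<noteq> 0) (?F \<times>\<^sub>F nhds ?x)"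
    using tendsto_imp_eventually_ne[OF partial_derivs_jointly_continuous[OF A h c chart_in_image[OF p], of "[i]"]] i by simp
  then obtain O' V where OV: "openin (Cinf_topology \<A>) O'" "h\<^sub>0 \<in> O'" "open V" "p \<in> V" "V \<subseteq> fst c"
    "\<And>h q. h \<in> O' \<Longrightarrow> q \<in> V \<Longrightarrow> partial_deriv i (h \<circ> chart_inv c) (snd c q) \<noteq> 0"
    using eventually_in_chart[OF A h ch p, of "\<lambda>h x. partial_deriv i (h \<circ> chart_inv c) x \<noteq> 0"] by blast
  have "open (chart_inv c -` V \<inter> chart_image c)"
    using continuous_on_open_vimage[OF is_chart_open(2)[OF ch]] is_chart_continuous(2)[OF ch] OV(3) by blast
  moreover have "?x \<in> chart_inv c -` V \<inter> chart_image c" using p OV(4) ch by simp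
  ultimately obtain r where r: "r > 0" "cball ?x r \<subseteq> chart_inv c -` V \<inter> chart_image c"
    using open_contains_cball by blast
  have sub: "ball ?x r \<subseteq> chart_inv c -` V" "ball ?x r \<subseteq> chart_image c"
    using r(2) ball_subset_cball[of ?x r] by blast+
  have "metric_straightening i (h \<circ> chart_inv c) (ball ?x r) \<A> g c" if "h \<in> O'" for h
  proof
    have hs: "h \<in> smooth_functions \<A>" using openin_subset[OF OV(1)] topspace_Cinf_topology[OF A] that by auto
    show "smooth_on (ball ?x r) (h \<circ> chart_inv c)"
      by (rule smooth_on_subset[OF sub(2) smooth_functions_chart[OF A hs c]])
    show "partial_deriv i (h \<circ> chart_inv c) x \<noteq> 0" if "x \<in> ball ?x r" for x
    proof -
      have "chart_inv c x \<in> V" "x \<in> chart_image c" using sub that by blast+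
      thus ?thesis using OV(6)[OF \<open>h \<in> O'\<close>, of "chart_inv c x"] by simp
    qed
  qed (use sub A g c in auto)
  moreover have "cball ?x r \<subseteq> chart_image c" using r(2) by blast
  ultimately show thesis using that[OF OV(1,2) r(1)] by blast
qed

text \<open>The nonzero tangential derivative of the mean curvature in the given slice chart is carried over to the
chart adapted to \<open>h\<^sub>0\<close>, and from there by continuity to the charts adapted to nearby functions at nearby
points.\<close>

lemma open_finite_order_at:
  fixes \<A> :: "('m::topological_space, 'd::finite) chart set"
  assumes A: "smooth_atlas \<A>" and g: "riemannian_metric \<A> g" and h: "h\<^sub>0 \<in> smooth_functions \<A>"
    and reg: "regular_zero_at \<A> h\<^sub>0 p" and P: "finite_order_at \<A> g h\<^sub>0 p"
  shows "\<exists>O' V. openin (Cinf_topology \<A>) O' \<and> h\<^sub>0 \<in> O' \<and> open V \<and> p \<in> V \<and> (\<forall>h\<in>O'. \<forall>q\<in>V. finite_order_at \<A> g h q)"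
proof (cases "h\<^sub>0 p = 0")
  case False
  obtain c where c: "c \<in> \<A>" "p \<in> fst c" using atlas_covers[OF A] by blast
  have cs: "c \<in> smooth_charts \<A>" by (rule atlas_in_smooth_charts[OF A c(1)])
  have ch: "is_chart c" by (rule smooth_charts_chart[OF cs])
  have ne: "(h\<^sub>0 \<circ> chart_inv c) (snd c p) \<noteq> 0" using False ch c by simp
  from tendsto_imp_eventually_ne[OF partial_derivs_jointly_continuous[OF A h cs chart_in_image[OF c(2)], of "[]", unfolded partial_derivs_simps] ne]
  obtain O' V where OV: "openin (Cinf_topology \<A>) O'" "h\<^sub>0 \<in> O'" "open V" "p \<in> V" "V \<subseteq> fst c"
    "\<And>h q. h \<in> O' \<Longrightarrow> q \<in> V \<Longrightarrow> (h \<circ> chart_inv c) (snd c q) \<noteq> 0"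
    using eventually_in_chart[OF A h ch c(2), of "\<lambda>h x. (h \<circ> chart_inv c) x \<noteq> 0"] by blast
  have "h q \<noteq> 0" if "h \<in> O'" "q \<in> V" for h q
    using OV(6)[OF that] OV(5) that ch by auto
  thus ?thesis using OV unfolding finite_order_at_def by blast
next
  case True
  then obtain c i js where slice: "slice_chart \<A> {p. h\<^sub>0 p = 0} c i" and p: "p \<in> fst c"
    and js: "set js \<subseteq> -{i}" and ne: "partial_derivs js (mean_curvature g c i) (snd c p) \<noteq> 0"
    using P unfolding finite_order_at_def mean_curvature_vanishes_to_infinite_order_def by blast
  let ?x = "snd c p" and ?u = "h\<^sub>0 \<circ> chart_inv c"
  have c: "c \<in> smooth_charts \<A>" using slice by (simp add: slice_chart_def)
  have ch: "is_chart c" by (rule smooth_charts_chart[OF c])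
  have slice': "snd c ` (fst c \<inter> {p. h\<^sub>0 p = 0}) = {x \<in> chart_image c. x $ i = 0}"
    using slice by (simp add: slice_chart_def)
  have x0: "?x $ i = 0" using slice' p True by blast
  have zero: "?u x = 0" if x: "x \<in> chart_image c" "x $ i = 0" for x
  proof -
    obtain q where "q \<in> fst c" "h\<^sub>0 q = 0" "x = snd c q" using slice' x by blast
    thus ?thesis using ch by simp
  qed
  have "partial_deriv j ?u ?x = 0" if "j \<noteq> i" for j
    using partial_deriv_slice_cong[OF is_chart_open(2)[OF ch] chart_in_image[OF p] x0 that, of ?u "\<lambda>_. 0"] zero
    by (simp add: partial_deriv_def)
  then have i: "partial_deriv i ?u ?x \<noteq> 0" using regular_zero_atD[OF A h c p reg True] by metis
  obtain O1 r where O1: "openin (Cinf_topology \<A>) O1" "h\<^sub>0 \<in> O1" "r > 0" "cball ?x r \<subseteq> chart_image c"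
    "\<And>h. h \<in> O1 \<Longrightarrow> metric_straightening i (h \<circ> chart_inv c) (ball ?x r) \<A> g c"
    using straightening_ball[OF A h c p g i] by blast
  let ?F = "nhdsin (Cinf_topology \<A>) h\<^sub>0" and ?B = "ball ?x r"
  have sub: "?B \<subseteq> chart_image c" using O1(4) by force
  have def: "deformation ?F O1 h\<^sub>0"
    using O1(1,2) by unfold_locales (auto simp: eventually_nhdsin)
  interpret deformation ?F O1 h\<^sub>0 by (rule def)
  have N: "O1 \<subseteq> smooth_functions \<A>" using openin_subset[OF O1(1)] topspace_Cinf_topology[OF A] by auto
  interpret metric_deformation ?F O1 h\<^sub>0 \<A> g c i "\<lambda>h. h \<circ> chart_inv c" ?B
    by (intro metric_deformation.intro def metric_deformation_axioms.intro O1(5)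
        fam_smooth_subset[OF sub Cinf_fam_smooth[OF A h c def N]])
  interpret base: metric_straightening i ?u ?B \<A> g c by (rule O1(5)[OF O1(2)])
  let ?H = "\<lambda>h. frame_derivs i (h \<circ> chart_inv c) js (level_mean_curvature g c i (h \<circ> chart_inv c))"
  have xB: "?x \<in> ?B" using O1(3) by simp
  have "?H h\<^sub>0 ?x \<noteq> 0"
    using base.mean_curvature_derivs_on_slice[OF _ xB x0 js] zero sub ne by blast
  moreover have "((\<lambda>z. ?H (fst z) (snd z)) \<longlongrightarrow> ?H h\<^sub>0 ?x) (?F \<times>\<^sub>F nhds ?x)"
    using fam_smooth_C0[OF fam_mean_curvature_derivs[of js]] xB unfolding fam_C0_def by blast
  ultimately have "eventually (\<lambda>z. ?H (fst z) (snd z) \<noteq> 0) (?F \<times>\<^sub>F nhds ?x)"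
    using tendsto_imp_eventually_ne by blast
  moreover have "eventually (\<lambda>z. fst z \<in> O1 \<and> snd z \<in> ?B) (?F \<times>\<^sub>F nhds ?x)"
    by (rule eventually_prodI[OF ev_N eventually_nhds_in_open[OF open_ball xB]])
  ultimately have "eventually (\<lambda>z. ?H (fst z) (snd z) \<noteq> 0 \<and> fst z \<in> O1 \<and> snd z \<in> ?B) (?F \<times>\<^sub>F nhds ?x)"
    by (rule eventually_conj)
  then obtain O' V where OV: "openin (Cinf_topology \<A>) O'" "h\<^sub>0 \<in> O'" "open V" "p \<in> V" "V \<subseteq> fst c"
    "\<And>h q. h \<in> O' \<Longrightarrow> q \<in> V \<Longrightarrow> ?H h (snd c q) \<noteq> 0 \<and> h \<in> O1 \<and> snd c q \<in> ?B"
    using eventually_in_chart[OF A h ch p, of "\<lambda>h x. ?H h x \<noteq> 0 \<and> h \<in> O1 \<and> x \<in> ?B"] by blast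
  have "finite_order_at \<A> g h q" if hq: "h \<in> O'" "q \<in> V" for h q
    unfolding finite_order_at_def
  proof (intro impI notI)
    assume flat: "mean_curvature_vanishes_to_infinite_order \<A> g {p. h p = 0} q"
    have "?H h (snd c q) = 0"
      by (rule metric_straightening.flat_mean_curvature_derivs[OF O1(5) _ _ _ flat js]) (use OV(5,6) hq in auto)
    thus False using OV(6)[OF hq] by simp
  qed
  thus ?thesis using OV by blast
qed

section \<open>Density\<close>

subsection \<open>From local to global density\<close>

text \<open>Finitely many of the compact sets cover the manifold.  The function is perturbed for one of them after the
other, each time within the open set of functions that are good on the previous ones.\<close>

lemma dense_from_local:
  fixes P :: "('m::topological_space \<Rightarrow> real) \<Rightarrow> 'm \<Rightarrow> bool"
  assumes comp: "compact (UNIV :: 'm set)" and W: "openin T W"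
    and opn: "\<And>h p. h \<in> W \<Longrightarrow> P h p \<Longrightarrow>
      \<exists>O' V. openin T O' \<and> h \<in> O' \<and> open V \<and> p \<in> V \<and> (\<forall>h\<in>O'. \<forall>q\<in>V. P h q)"
    and loc: "\<And>h p. h \<in> W \<Longrightarrow> \<exists>O' C. openin T O' \<and> h \<in> O' \<and> compact C \<and> p \<in> interior C \<and>
      (\<forall>h\<in>O'. \<forall>U. openin T U \<longrightarrow> h \<in> U \<longrightarrow> (\<exists>h'\<in>U. \<forall>q\<in>C. P h' q))"
  shows "openin T {h\<in>W. \<forall>p. P h p} \<and> (\<forall>h\<in>W. \<forall>U. openin T U \<longrightarrow> h \<in> U \<longrightarrow> (\<exists>h'\<in>U \<inter> W. \<forall>p. P h' p))"
proof (intro conjI ballI allI impI)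
  have WT: "h \<in> topspace T" if "h \<in> W" for h using openin_subset[OF W] that by blast
  have tubeP: "\<exists>O'. openin T O' \<and> h \<in> O' \<and> (\<forall>h\<in>O'. \<forall>q\<in>C. P h q)"
    if "compact C" "h \<in> W" "\<forall>q\<in>C. P h q" for C h
    by (rule tube[OF that(1) WT[OF that(2)]]) (rule opn[OF that(2)], use that(3) in blast)
  show "openin T {h\<in>W. \<forall>p. P h p}"
  proof (subst openin_subopen, intro ballI)
    fix h assume "h \<in> {h\<in>W. \<forall>p. P h p}"
    hence h: "h \<in> W" "\<forall>q\<in>UNIV. P h q" by auto
    obtain O' where O': "openin T O'" "h \<in> O'" "\<forall>h\<in>O'. \<forall>q\<in>UNIV. P h q"
      using tubeP[OF comp h] by (elim exE conjE)
    have "openin T (O' \<inter> W)" by (rule openin_Int[OF O'(1) W])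
    thus "\<exists>O'. openin T O' \<and> h \<in> O' \<and> O' \<subseteq> {h\<in>W. \<forall>p. P h p}"
      using O'(2,3) h(1) by (intro exI[of _ "O' \<inter> W"]) auto
  qed
  fix h U assume h: "h \<in> W" and U: "openin T U" "h \<in> U"
  have "\<exists>OC. openin T (fst OC) \<and> h \<in> fst OC \<and> compact (snd OC) \<and> p \<in> interior (snd OC) \<and>
      (\<forall>h\<in>fst OC. \<forall>U. openin T U \<longrightarrow> h \<in> U \<longrightarrow> (\<exists>h'\<in>U. \<forall>q\<in>snd OC. P h' q))" for p
    using loc[OF h, of p] by simp
  then obtain OC where OC: "openin T (fst (OC p)) \<and> h \<in> fst (OC p) \<and> compact (snd (OC p)) \<and> p \<in> interior (snd (OC p)) \<and>
      (\<forall>h\<in>fst (OC p). \<forall>U. openin T U \<longrightarrow> h \<in> U \<longrightarrow> (\<exists>h'\<in>U. \<forall>q\<in>snd (OC p). P h' q))" for p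
    by (rule that[OF someI_ex])
  define Oh where "Oh p = fst (OC p)" for p
  define C where "C p = snd (OC p)" for p
  have Oh: "openin T (Oh p)" "h \<in> Oh p" and C: "compact (C p)" "p \<in> interior (C p)" for p
    using OC[of p] by (simp_all add: Oh_def C_def)
  have near: "\<exists>h2\<in>U. \<forall>q\<in>C p. P h2 q" if "h1 \<in> Oh p" "openin T U" "h1 \<in> U" for h1 p U
    using OC[of p] that by (simp add: Oh_def C_def)
  have "UNIV \<subseteq> (\<Union>p\<in>UNIV. interior (C p))"
  proof
    fix q show "q \<in> (\<Union>p\<in>UNIV. interior (C p))" using C(2)[of q] by (rule UN_I[OF UNIV_I])
  qed
  then obtain D where D: "finite D" "UNIV \<subseteq> (\<Union>p\<in>D. interior (C p))"
    by (rule compactE_image[OF comp, of UNIV "\<lambda>p. interior (C p)", rotated]) simp_all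
  define U0 where "U0 = (U \<inter> W) \<inter> (\<Inter>p\<in>D. Oh p)"
  have U0: "openin T U0" "h \<in> U0"
    unfolding U0_def using U W h Oh D(1) by (auto intro!: openin_Int_Inter)
  have "\<exists>U'. openin T U' \<and> U' \<subseteq> U0 \<and> U' \<noteq> {} \<and> (\<forall>h\<in>U'. \<forall>p\<in>D'. \<forall>q\<in>C p. P h q)" if "D' \<subseteq> D" for D'
    using finite_subset[OF that D(1)] that
  proof (induction D' rule: finite_induct)
    case empty
    show ?case using U0 by (intro exI[of _ U0]) auto
  next
    case (insert p D')
    have "D' \<subseteq> D" using insert.prems by simp
    from insert.IH[OF this]
    obtain U' where U': "openin T U'" "U' \<subseteq> U0" "U' \<noteq> {}" "\<forall>h\<in>U'. \<forall>p\<in>D'. \<forall>q\<in>C p. P h q"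
      by (elim exE conjE)
    obtain h1 where h1: "h1 \<in> U'" using U'(3) by auto
    have "h1 \<in> Oh p" using h1 U'(2) insert.prems by (auto simp: U0_def)
    from near[OF this U'(1) h1] obtain h2 where h2: "h2 \<in> U'" "\<forall>q\<in>C p. P h2 q" by (elim bexE)
    have "h2 \<in> W" using h2 U'(2) by (auto simp: U0_def)
    from tubeP[OF C(1) this h2(2)]
    obtain O' where O': "openin T O'" "h2 \<in> O'" "\<forall>h\<in>O'. \<forall>q\<in>C p. P h q" by (elim exE conjE)
    have "openin T (U' \<inter> O')" by (rule openin_Int[OF U'(1) O'(1)])
    moreover have "U' \<inter> O' \<subseteq> U0" "U' \<inter> O' \<noteq> {}" using U'(2) h2(1) O'(2) by auto
    moreover have "\<forall>h\<in>U' \<inter> O'. \<forall>p\<in>insert p D'. \<forall>q\<in>C p. P h q" using U'(4) O'(3) by simp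
    ultimately show ?case by (intro exI[of _ "U' \<inter> O'"] conjI)
  qed
  from this[OF order_refl] obtain U' where U': "U' \<subseteq> U0" "U' \<noteq> {}" "\<forall>h\<in>U'. \<forall>p\<in>D. \<forall>q\<in>C p. P h q"
    by (elim exE conjE)
  then obtain h' where h': "h' \<in> U'" by auto
  have "P h' q" for q
  proof -
    obtain p where "p \<in> D" "q \<in> interior (C p)" using D(2) by (auto dest!: subsetD[of UNIV])
    moreover from this have "q \<in> C p" using interior_subset[of "C p"] by auto
    ultimately show ?thesis using U'(3) h' by simp
  qed
  moreover have "h' \<in> U \<inter> W" using h' U'(1) by (auto simp: U0_def)
  ultimately show "\<exists>h'\<in>U \<inter> W. \<forall>p. P h' p" by (intro bexI[of _ h']) auto
qed

subsection \<open>Perturbations supported in a chart\<close>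

definition bumped :: "('m, 'd::finite) chart \<Rightarrow> (real^'d \<Rightarrow> real) \<Rightarrow> (real^'d \<Rightarrow> real) \<Rightarrow> 'm \<Rightarrow> real" where
  "bumped c \<beta> u p = (if p \<in> fst c then \<beta> (snd c p) * u (snd c p) else 0)"

lemma smooth_bumped:
  fixes \<A> :: "('m::t2_space, 'd::finite) chart set"
  assumes A: "smooth_atlas \<A>" and c: "c \<in> smooth_charts \<A>" and R: "cball x\<^sub>0 R \<subseteq> chart_image c"
    and \<beta>: "smooth_on UNIV \<beta>" "\<And>x. x \<notin> ball x\<^sub>0 R \<Longrightarrow> \<beta> x = 0" and u: "smooth_on UNIV u"
  shows "bumped c \<beta> u \<in> smooth_functions \<A>"
  unfolding smooth_functions_def
proof (intro CollectI ballI)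
  fix d assume d: "d \<in> \<A>"
  have ch: "is_chart c" "is_chart d" and comp: "compatible c d"
    using c d A by (auto simp: smooth_charts_def smooth_atlas_def)
  define K where "K = chart_inv c ` cball x\<^sub>0 R"
  have "compact K" unfolding K_def
    by (rule compact_continuous_image[OF continuous_on_subset[OF is_chart_continuous(2)[OF ch(1)] R] compact_cball])
  hence K: "open (- K)" using compact_imp_closed by blast
  show "smooth_on (chart_image d) (bumped c \<beta> u \<circ> chart_inv d)"
  proof (rule smooth_on_local)
    fix x assume x: "x \<in> chart_image d"
    show "\<exists>V. open V \<and> x \<in> V \<and> smooth_on V (bumped c \<beta> u \<circ> chart_inv d)"
    proof (cases "chart_inv d x \<in> fst c")
      case True
      let ?V = "overlap d c"
      have o: "open ?V" by (rule open_overlap[OF ch(2,1)])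
      have "smooth_on ?V (\<lambda>y. (\<lambda>x. \<beta> x * u x) (transition d c y))"
      proof (rule smooth_on_compose[where f = "\<lambda>x. \<beta> x * u x" and g = "transition d c", OF o open_UNIV])
        show "smooth_on UNIV (\<lambda>x. \<beta> x * u x)" by (intro smooth_on_mult open_UNIV \<beta> u)
        show "smooth_on ?V (transition d c)" using comp by (simp add: compatible_def)
      qed simp
      hence "smooth_on ?V (bumped c \<beta> u \<circ> chart_inv d)"
        by (rule smooth_on_cong[OF o, rotated]) (simp add: overlap_iff[OF ch(2)] bumped_def transition_def)
      moreover have "x \<in> ?V" using x True by (simp add: overlap_iff[OF ch(2)])
      ultimately show ?thesis using o by blast
    next
      case False
      let ?V = "chart_inv d -` (- K) \<inter> chart_image d"
      have o: "open ?V"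
        using continuous_on_open_vimage[OF is_chart_open(2)[OF ch(2)]] is_chart_continuous(2)[OF ch(2)] K by blast
      have "K \<subseteq> fst c" using R chart_inv_in by (fastforce simp: K_def)
      hence "x \<in> ?V" using x False by blast
      moreover have "smooth_on ?V (bumped c \<beta> u \<circ> chart_inv d)"
      proof (rule smooth_on_cong[OF o _ smooth_on_const[where c = 0]])
        fix y assume y: "y \<in> ?V"
        have "\<beta> (snd c (chart_inv d y)) = 0" if "chart_inv d y \<in> fst c"
        proof (rule \<beta>(2), rule notI)
          assume "snd c (chart_inv d y) \<in> ball x\<^sub>0 R"
          hence "chart_inv c (snd c (chart_inv d y)) \<in> K" unfolding K_def by (intro imageI) auto
          thus False using y that ch by simp
        qed
        thus "0 = (bumped c \<beta> u \<circ> chart_inv d) y" by (simp add: bumped_def)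
      qed
      ultimately show ?thesis using o by blast
    qed
  qed
qed

lemma partial_derivs_lincomb:
  fixes u :: "real^'d \<Rightarrow> real"
  assumes U: "open U" and u: "smooth_on U u" and v: "\<And>b. b \<in> S \<Longrightarrow> smooth_on U (v b)" and "x \<in> U"
  shows "partial_derivs js (\<lambda>x. u x + (\<Sum>b\<in>S. s b * v b x)) x = partial_derivs js u x + (\<Sum>b\<in>S. s b * partial_derivs js (v b) x)"
  using \<open>x \<in> U\<close>
proof (induction js arbitrary: x)
  case (Cons j js)
  have hu: "(partial_derivs js u has_derivative frechet_derivative (partial_derivs js u) (at x)) (at x)"
    by (rule smooth_on_has_derivative[OF smooth_on_partial_derivs[OF U u] Cons.prems])
  have hv: "(partial_derivs js (v b) has_derivative frechet_derivative (partial_derivs js (v b)) (at x)) (at x)" if "b \<in> S" for b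
    by (rule smooth_on_has_derivative[OF smooth_on_partial_derivs[OF U v[OF that]] Cons.prems])
  have "((\<lambda>x. partial_derivs js u x + (\<Sum>b\<in>S. s b * partial_derivs js (v b) x)) has_derivative
     (\<lambda>y. frechet_derivative (partial_derivs js u) (at x) y + (\<Sum>b\<in>S. s b * frechet_derivative (partial_derivs js (v b)) (at x) y))) (at x)"
    by (intro has_derivative_add has_derivative_sum has_derivative_mult_right hu hv)
  from partial_deriv_has_derivative[OF this, of j]
  have "partial_deriv j (\<lambda>x. partial_derivs js u x + (\<Sum>b\<in>S. s b * partial_derivs js (v b) x)) x
      = partial_deriv j (partial_derivs js u) x + (\<Sum>b\<in>S. s b * partial_deriv j (partial_derivs js (v b)) x)"
    using partial_deriv_has_derivative[OF hu] partial_deriv_has_derivative[OF hv] by simp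
  moreover have "partial_deriv j (partial_derivs js (\<lambda>x. u x + (\<Sum>b\<in>S. s b * v b x))) x
     = partial_deriv j (\<lambda>x. partial_derivs js u x + (\<Sum>b\<in>S. s b * partial_derivs js (v b) x)) x"
    by (rule partial_deriv_cong[OF U Cons.prems]) (rule Cons.IH)
  ultimately show ?case by simp
qed simp

lemma smooth_functions_lincomb:
  assumes "smooth_atlas \<A>" "h \<in> smooth_functions \<A>" "\<And>b. b \<in> S \<Longrightarrow> G b \<in> smooth_functions \<A>"
  shows "(\<lambda>p. h p + (\<Sum>b\<in>S. s b * G b p)) \<in> smooth_functions \<A>"
  unfolding smooth_functions_def
proof (intro CollectI ballI)
  fix c assume c: "c \<in> \<A>"
  have o: "open (chart_image c)" using assms(1) c is_chart_open(2)[of c] by (auto simp: smooth_atlas_def)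
  have "smooth_on (chart_image c) (\<lambda>x. (h \<circ> chart_inv c) x + (\<Sum>b\<in>S. s b * (G b \<circ> chart_inv c) x))"
    using assms c by (intro smooth_on_add smooth_on_sum smooth_on_mult smooth_on_const o) (auto simp: smooth_functions_def comp_def)
  thus "smooth_on (chart_image c) ((\<lambda>p. h p + (\<Sum>b\<in>S. s b * G b p)) \<circ> chart_inv c)" by (simp add: o_def)
qed

text \<open>Only finitely many derivatives on a compact set have to be controlled.\<close>

lemma small_perturbation:
  fixes G :: "'a::euclidean_space \<Rightarrow> 'm::topological_space \<Rightarrow> real" and \<A> :: "('m, 'd::finite) chart set"
  assumes A: "smooth_atlas \<A>" and G: "\<And>b. b \<in> Basis \<Longrightarrow> G b \<in> smooth_functions \<A>"
    and U: "openin (Cinf_topology \<A>) U" and h: "h \<in> U"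
  shows "eventually (\<lambda>a. (\<lambda>p. h p + (\<Sum>b\<in>Basis. (a \<bullet> b) * G b p)) \<in> U) (nhds 0)"
proof -
  let ?S = "{Cinf_nbhd \<A> f c K k \<epsilon> | f c K k \<epsilon>.
        f \<in> smooth_functions \<A> \<and> c \<in> smooth_charts \<A> \<and> compact K \<and> K \<subseteq> chart_image c \<and> \<epsilon> > 0}"
  have "generate_topology_on ?S U"
    using U unfolding Cinf_topology_def openin_topology_generated_by_iff .
  thus ?thesis using h
  proof (induction rule: generate_topology_on.induct)
    case Empty
    thus ?case by simp
  next
    case (Int a b)
    thus ?case by (auto intro: eventually_conj)
  next
    case (UN K)
    then obtain k where k: "k \<in> K" "h \<in> k" by blast
    show ?case by (rule eventually_mono[OF UN.IH[OF k]]) (use k in blast)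
  next
    case (Basis s)
    then obtain f c K k \<epsilon> where s: "s = Cinf_nbhd \<A> f c K k \<epsilon>" and f: "f \<in> smooth_functions \<A>"
      and c: "c \<in> smooth_charts \<A>" and K: "compact K" "K \<subseteq> chart_image c" and e: "\<epsilon> > 0" by blast
    have hs: "h \<in> smooth_functions \<A>" using Basis.prems by (simp add: s Cinf_nbhd_def)
    have o: "open (chart_image c)" using smooth_charts_chart[OF c] is_chart_open by blast
    let ?D = "\<lambda>js f. partial_derivs js (f \<circ> chart_inv c)"
    have cont: "continuous_on K (?D js f)" if "f \<in> smooth_functions \<A>" for js f
      by (rule continuous_on_subset[OF smooth_on_continuous[OF smooth_on_partial_derivs[OF o smooth_functions_chart[OF A that c]]] K(2)])
    have "eventually (\<lambda>a. \<forall>x\<in>K. \<bar>?D js (\<lambda>p. h p + (\<Sum>b\<in>Basis. (a \<bullet> b) * G b p)) x - ?D js f x\<bar> < \<epsilon>) (nhds (0::'a))"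
      if js: "length js \<le> k" for js
    proof (cases "K = {}")
      case False
      have "continuous_on K (\<lambda>x. \<bar>?D js h x - ?D js f x\<bar>)"
        by (intro continuous_intros cont hs f)
      then obtain y where y: "y \<in> K" "\<And>x. x \<in> K \<Longrightarrow> \<bar>?D js h x - ?D js f x\<bar> \<le> \<bar>?D js h y - ?D js f y\<bar>"
        using continuous_attains_sup[OF K(1) False] by blast
      define m where "m = \<bar>?D js h y - ?D js f y\<bar>"
      have m: "m < \<epsilon>" using Basis.prems js y(1) by (simp add: s Cinf_nbhd_def m_def)
      have "continuous_on K (\<lambda>x. \<Sum>b\<in>Basis. \<bar>?D js (G b) x\<bar>)"
        by (intro continuous_intros cont G)
      then obtain z where z: "\<And>x. x \<in> K \<Longrightarrow> (\<Sum>b\<in>Basis. \<bar>?D js (G b) x\<bar>) \<le> (\<Sum>b\<in>Basis. \<bar>?D js (G b) z\<bar>)"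
        using continuous_attains_sup[OF K(1) False] by blast
      define M where "M = (\<Sum>b\<in>Basis. \<bar>?D js (G b) z\<bar>)"
      have "((\<lambda>a::'a. norm a * M) \<longlongrightarrow> norm (0::'a) * M) (nhds 0)"
        by (intro tendsto_intros filterlim_ident)
      hence "eventually (\<lambda>a::'a. norm a * M < \<epsilon> - m) (nhds 0)"
        using m by (intro order_tendstoD(2)) auto
      thus ?thesis
      proof (rule eventually_mono)
        fix a :: 'a assume a: "norm a * M < \<epsilon> - m"
        show "\<forall>x\<in>K. \<bar>?D js (\<lambda>p. h p + (\<Sum>b\<in>Basis. (a \<bullet> b) * G b p)) x - ?D js f x\<bar> < \<epsilon>"
        proof
          fix x assume x: "x \<in> K"
          have "?D js (\<lambda>p. h p + (\<Sum>b\<in>Basis. (a \<bullet> b) * G b p)) x = ?D js h x + (\<Sum>b\<in>Basis. (a \<bullet> b) * ?D js (G b) x)"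
            using partial_derivs_lincomb[OF o smooth_functions_chart[OF A hs c], of Basis "\<lambda>b. G b \<circ> chart_inv c" x js "\<lambda>b. a \<bullet> b"]
              smooth_functions_chart[OF A G c] K(2) x by (auto simp: o_def)
          moreover have "\<bar>\<Sum>b\<in>Basis. (a \<bullet> b) * ?D js (G b) x\<bar> \<le> norm a * M"
          proof -
            have "\<bar>\<Sum>b\<in>Basis. (a \<bullet> b) * ?D js (G b) x\<bar> \<le> (\<Sum>b\<in>Basis. \<bar>(a \<bullet> b) * ?D js (G b) x\<bar>)" by (rule sum_abs)
            also have "\<dots> \<le> (\<Sum>b\<in>Basis. norm a * \<bar>?D js (G b) x\<bar>)"
              by (intro sum_mono) (simp add: abs_mult Basis_le_norm mult_right_mono)
            also have "\<dots> \<le> norm a * M"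
              unfolding sum_distrib_left[symmetric] M_def by (intro mult_left_mono z[OF x]) auto
            finally show ?thesis .
          qed
          moreover have "\<bar>?D js h x - ?D js f x\<bar> \<le> m" using y(2)[OF x] by (simp add: m_def)
          ultimately show "\<bar>?D js (\<lambda>p. h p + (\<Sum>b\<in>Basis. (a \<bullet> b) * G b p)) x - ?D js f x\<bar> < \<epsilon>"
            using a by linarith
        qed
      qed
    qed simp
    moreover have "finite {js :: 'd list. length js \<le> k}"
      using finite_lists_length_le[of "UNIV :: 'd set" k] by simp
    ultimately have "eventually (\<lambda>a. \<forall>js\<in>{js. length js \<le> k}. \<forall>x\<in>K. \<bar>?D js (\<lambda>p. h p + (\<Sum>b\<in>Basis. (a \<bullet> b) * G b p)) x - ?D js f x\<bar> < \<epsilon>) (nhds (0::'a))"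
      by (intro eventually_ball_finite) auto
    thus ?case
      by (rule eventually_mono) (use smooth_functions_lincomb[OF A hs G] in \<open>simp add: s Cinf_nbhd_def\<close>)
  qed
qed

lemma bumped_expand:
  fixes G :: "'a::euclidean_space \<Rightarrow> real^'d \<Rightarrow> real"
  assumes lin: "\<And>x. linear (\<lambda>a. G a x)"
  shows "bumped c \<beta> (G a) p = (\<Sum>b\<in>Basis. (a \<bullet> b) * bumped c \<beta> (G b) p)"
proof -
  have "G a x = (\<Sum>b\<in>Basis. (a \<bullet> b) * G b x)" for x
  proof -
    interpret linear "\<lambda>a. G a x" by (rule lin)
    show ?thesis by (subst (1) euclidean_representation[of a, symmetric]) (simp add: sum scaleR)
  qed
  thus ?thesis by (simp add: bumped_def sum_distrib_left mult.left_commute)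
qed

text \<open>A negligible set has empty interior, so every neighbourhood of the parameter \<open>0\<close> contains good parameters.\<close>

lemma generic_perturbation:
  fixes \<A> :: "('m::t2_space, 'd::finite) chart set" and G :: "'a::euclidean_space \<Rightarrow> real^'d \<Rightarrow> real"
  assumes A: "smooth_atlas \<A>" and c: "c \<in> smooth_charts \<A>" and R: "cball x\<^sub>0 R \<subseteq> chart_image c" and r: "0 < r" "r < R"
    and lin: "\<And>x. linear (\<lambda>a. G a x)" and sm: "\<And>a. smooth_on UNIV (G a)"
    and U: "openin (Cinf_topology \<A>) U" "h \<in> U" and bad: "negligible bad"
  obtains h' a where "h' \<in> U" "h' \<in> smooth_functions \<A>" "a \<notin> bad"
    "\<And>x. x \<in> cball x\<^sub>0 r \<Longrightarrow> (h' \<circ> chart_inv c) x = (h \<circ> chart_inv c) x + G a x"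
proof -
  obtain \<beta> :: "real^'d \<Rightarrow> real" where \<beta>: "smooth_on UNIV \<beta>" "\<And>x. x \<in> cball x\<^sub>0 r \<Longrightarrow> \<beta> x = 1" "\<And>x. x \<notin> ball x\<^sub>0 R \<Longrightarrow> \<beta> x = 0"
    using smooth_bump_exists[OF r] by blast
  have Gs: "bumped c \<beta> (G b) \<in> smooth_functions \<A>" for b
    by (rule smooth_bumped[OF A c R \<beta>(1,3) sm])
  have "eventually (\<lambda>a. (\<lambda>p. h p + bumped c \<beta> (G a) p) \<in> U) (nhds 0)"
  proof -
    have "(\<lambda>p. h p + (\<Sum>b\<in>Basis. (a \<bullet> b) * bumped c \<beta> (G b) p)) = (\<lambda>p. h p + bumped c \<beta> (G a) p)" for a
      by (rule ext) (simp only: bumped_expand[where G = G and a = a, OF lin])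
    thus ?thesis using small_perturbation[where G = "\<lambda>b. bumped c \<beta> (G b)", OF A Gs U] by simp
  qed
  then obtain S where S: "open S" "0 \<in> S" "\<And>a. a \<in> S \<Longrightarrow> (\<lambda>p. h p + bumped c \<beta> (G a) p) \<in> U"
    unfolding eventually_nhds by blast
  have "\<not> S \<subseteq> bad" using S(1,2) bad open_not_negligible negligible_subset by blast
  then obtain a where a: "a \<in> S" "a \<notin> bad" by blast
  show thesis
  proof (rule that[OF S(3)[OF a(1)] _ a(2)])
    show "(\<lambda>p. h p + bumped c \<beta> (G a) p) \<in> smooth_functions \<A>"
      using S(3)[OF a(1)] openin_subset[OF U(1)] topspace_Cinf_topology[OF A] by auto
    fix x assume x: "x \<in> cball x\<^sub>0 r"
    hence "x \<in> chart_image c" using R r by fastforce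
    thus "((\<lambda>p. h p + bumped c \<beta> (G a) p) \<circ> chart_inv c) x = (h \<circ> chart_inv c) x + G a x"
      using \<beta>(2)[OF x] by (simp add: bumped_def)
  qed
qed

lemma chart_ball:
  assumes c: "is_chart c" and p: "p \<in> fst c"
  obtains R where "R > 0" "cball (snd c p) R \<subseteq> chart_image c"
  using is_chart_open(2)[OF c] chart_in_image[OF p] open_contains_cball by blast

lemma chart_compact_nbhd:
  assumes c: "is_chart c" and p: "p \<in> fst c" and r: "r > 0" "cball (snd c p) r \<subseteq> chart_image c"
  shows "compact (chart_inv c ` cball (snd c p) r)" "p \<in> interior (chart_inv c ` cball (snd c p) r)"
    "q \<in> chart_inv c ` cball (snd c p) r \<Longrightarrow> q \<in> fst c \<and> snd c q \<in> cball (snd c p) r"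
proof -
  show "compact (chart_inv c ` cball (snd c p) r)"
    by (rule compact_continuous_image[OF continuous_on_subset[OF is_chart_continuous(2)[OF c] r(2)] compact_cball])
  have "{q \<in> fst c. snd c q \<in> ball (snd c p) r} \<subseteq> chart_inv c ` cball (snd c p) r"
  proof
    fix q assume "q \<in> {q \<in> fst c. snd c q \<in> ball (snd c p) r}"
    hence "q = chart_inv c (snd c q)" "snd c q \<in> cball (snd c p) r" using c by auto
    thus "q \<in> chart_inv c ` cball (snd c p) r" by (rule image_eqI)
  qed
  thus "p \<in> interior (chart_inv c ` cball (snd c p) r)"
    by (rule interiorI[OF open_chart_preimage[OF c open_ball], rotated]) (use p r in simp)
  show "q \<in> fst c \<and> snd c q \<in> cball (snd c p) r" if "q \<in> chart_inv c ` cball (snd c p) r"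
    using that r(2) by auto
qed

subsection \<open>Generic regularity of the zero set\<close>

lemma smooth_on_Pair:
  fixes f :: "'a::euclidean_space \<Rightarrow> 'b::euclidean_space" and g :: "'a \<Rightarrow> 'c::euclidean_space"
  assumes U: "open U" and f: "smooth_on U f" and g: "smooth_on U g"
  shows "smooth_on U (\<lambda>x. (f x, g x))"
proof -
  have "smooth_on U (\<lambda>x. (f x, g x) \<bullet> b)" if "b \<in> Basis" for b
  proof -
    from that consider u where "u \<in> Basis" "b = (u, 0)" | u where "u \<in> Basis" "b = (0, u)"
      by (auto simp: Basis_prod_def)
    thus ?thesis
    proof cases
      case 1
      have "smooth_on U (\<lambda>x. f x \<bullet> u)" using f 1(1) smooth_on_componentwise[OF U, of f] by simp
      thus ?thesis by (simp add: 1(2))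
    next
      case 2
      have "smooth_on U (\<lambda>x. g x \<bullet> u)" using g 2(1) smooth_on_componentwise[OF U, of g] by simp
      thus ?thesis by (simp add: 2(2))
    qed
  qed
  thus ?thesis using smooth_on_componentwise[OF U, of "\<lambda>x. (f x, g x)"] by simp
qed

lemma smooth_on_vecI:
  fixes f :: "'a::euclidean_space \<Rightarrow> 'b::euclidean_space^'d"
  shows "open U \<Longrightarrow> (\<And>j. smooth_on U (\<lambda>x. f x $ j)) \<Longrightarrow> smooth_on U f"
  using smooth_on_vec_iff[of U f] by simp

text \<open>If \<open>u + a \<bullet> x + b\<close> has a singular zero at \<open>x\<close>, then \<open>a\<close> and \<open>b\<close> are determined by \<open>x\<close>.\<close>

lemma negligible_singular_zero:
  fixes u :: "real^'d \<Rightarrow> real"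
  assumes B: "open B" and u: "smooth_on B u"
  shows "negligible {a :: (real^'d) \<times> real. \<exists>x\<in>B. u x + fst a \<bullet> x + snd a = 0 \<and> gradient u x + fst a = 0}"
proof -
  let ?\<Psi> = "\<lambda>x. (- gradient u x, gradient u x \<bullet> x - u x)"
  have pd: "smooth_on B (partial_deriv j u)" for j by (rule smooth_on_partial_deriv[OF B u])
  have "smooth_on B ?\<Psi>"
  proof (rule smooth_on_Pair[OF B])
    show "smooth_on B (\<lambda>x. - gradient u x)"
      by (rule smooth_on_vecI[OF B]) (simp add: gradient_def smooth_on_minus[OF B pd])
    have "smooth_on B (\<lambda>x. (\<Sum>j\<in>UNIV. partial_deriv j u x * x $ j) - u x)"
      by (intro smooth_on_diff smooth_on_sum smooth_on_mult pd smooth_on_nth u B)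
    thus "smooth_on B (\<lambda>x. gradient u x \<bullet> x - u x)" by (simp add: gradient_def inner_vec_def)
  qed
  hence "?\<Psi> differentiable_on B" by (rule smooth_on_differentiable_on)
  hence "negligible (?\<Psi> ` B)"
    by (intro negligible_differentiable_image_lowdim) simp_all
  moreover have "{a :: (real^'d) \<times> real. \<exists>x\<in>B. u x + fst a \<bullet> x + snd a = 0 \<and> gradient u x + fst a = 0} \<subseteq> ?\<Psi> ` B"
  proof
    fix a :: "(real^'d) \<times> real"
    assume "a \<in> {a. \<exists>x\<in>B. u x + fst a \<bullet> x + snd a = 0 \<and> gradient u x + fst a = 0}"
    then obtain x where x: "x \<in> B" "u x + fst a \<bullet> x + snd a = 0" "gradient u x + fst a = 0" by blast
    have "fst a = - gradient u x" using x(3) by (simp add: eq_neg_iff_add_eq_0 add.commute)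
    moreover have "snd a = gradient u x \<bullet> x - u x" using x(2) calculation by simp
    ultimately have "a = ?\<Psi> x" by (simp add: prod_eq_iff)
    thus "a \<in> ?\<Psi> ` B" using x(1) by blast
  qed
  ultimately show ?thesis by (rule negligible_subset)
qed

lemma partial_deriv_add:
  fixes u :: "real^'d \<Rightarrow> real"
  assumes "u differentiable (at x)" "v differentiable (at x)"
  shows "partial_deriv j (\<lambda>x. u x + v x) x = partial_deriv j u x + partial_deriv j v x"
  using partial_deriv_has_derivative[OF has_derivative_add[OF assms[unfolded frechet_derivative_works]], of j]
  by (simp add: partial_deriv_eq_frechet assms)

lemma dense_regular_zero:
  fixes \<A> :: "('m::t2_space, 'd::finite) chart set"
  assumes A: "smooth_atlas \<A>"
  shows "\<exists>C. compact C \<and> p \<in> interior C \<and> (\<forall>h\<in>smooth_functions \<A>. \<forall>U. openin (Cinf_topology \<A>) U \<longrightarrow> h \<in> U \<longrightarrow>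
     (\<exists>h'\<in>U. \<forall>q\<in>C. regular_zero_at \<A> h' q))"
proof -
  obtain c where c: "c \<in> \<A>" "p \<in> fst c" using atlas_covers[OF A] by blast
  have cs: "c \<in> smooth_charts \<A>" by (rule atlas_in_smooth_charts[OF A c(1)])
  have ch: "is_chart c" by (rule smooth_charts_chart[OF cs])
  obtain R where R: "R > 0" "cball (snd c p) R \<subseteq> chart_image c" using chart_ball[OF ch c(2)] by blast
  let ?x = "snd c p" and ?C = "chart_inv c ` cball (snd c p) (R / 3)"
  have sub: "cball ?x (R / 3) \<subseteq> chart_image c" using R by fastforce
  have "R / 3 > 0" using R by simp
  note C = chart_compact_nbhd[OF ch c(2) this sub]
  let ?B = "ball ?x (R / 2)"
  have subB: "?B \<subseteq> chart_image c" using R by fastforce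
  have "\<exists>h'\<in>U. \<forall>q\<in>?C. regular_zero_at \<A> h' q"
    if h: "h \<in> smooth_functions \<A>" and U: "openin (Cinf_topology \<A>) U" "h \<in> U" for h U
  proof -
    let ?u = "h \<circ> chart_inv c" and ?G = "\<lambda>a x. fst a \<bullet> x + snd a :: real"
    have u: "smooth_on ?B ?u" by (rule smooth_on_subset[OF subB smooth_functions_chart[OF A h cs]])
    have lin: "linear (\<lambda>a :: (real^'d) \<times> real. ?G a x)" for x
      by (rule linearI) (auto simp: inner_add_left algebra_simps)
    have dG: "(?G a has_derivative (\<lambda>v. fst a \<bullet> v)) (at x)" for a :: "(real^'d) \<times> real" and x
      by (auto intro!: derivative_eq_intros)
    have sm: "smooth_on UNIV (?G a)" for a :: "(real^'d) \<times> real"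
      by (intro smooth_on_add smooth_on_const smooth_on_linear bounded_linear_inner_right open_UNIV)
    obtain h' a where h': "h' \<in> U" "h' \<in> smooth_functions \<A>"
        "a \<notin> {a. \<exists>x\<in>?B. ?u x + fst a \<bullet> x + snd a = 0 \<and> gradient ?u x + fst a = 0}"
        "\<And>x. x \<in> cball ?x (R / 2) \<Longrightarrow> (h' \<circ> chart_inv c) x = ?u x + ?G a x"
      using generic_perturbation[OF A cs R(2) _ _ lin sm U negligible_singular_zero[OF open_ball u], of "R / 2"] R(1)
      by auto
    have "regular_zero_at \<A> h' q" if q: "q \<in> ?C" for q
    proof (rule regular_zero_atI[OF A h'(2) c(1)])
      show qc: "q \<in> fst c" using C(3)[OF q] by simp
      let ?y = "snd c q"
      have y: "?y \<in> ?B" using C(3)[OF q] R(1) by auto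
      assume "h' q = 0"
      hence "?u ?y + ?G a ?y = 0" using h'(4)[of ?y] y qc ch by simp
      hence "gradient ?u ?y + fst a \<noteq> 0" using h'(3) y by auto
      moreover have "partial_deriv j (h' \<circ> chart_inv c) ?y = (gradient ?u ?y + fst a) $ j" for j
      proof -
        have "partial_deriv j (h' \<circ> chart_inv c) ?y = partial_deriv j (\<lambda>x. ?u x + ?G a x) ?y"
          by (rule partial_deriv_cong[OF open_ball y]) (use h'(4) in auto)
        also have "\<dots> = partial_deriv j ?u ?y + partial_deriv j (?G a) ?y"
          by (rule partial_deriv_add[OF smooth_on_differentiable[OF u y] differentiableI[OF dG]])
        also have "partial_deriv j (?G a) ?y = fst a $ j"
          by (simp add: partial_deriv_has_derivative[OF dG] inner_axis)
        finally show ?thesis by (simp add: gradient_def comp_def)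
      qed
      ultimately show "\<not> critical_in_chart c h' q" by (auto simp: critical_in_chart_def vec_eq_iff)
    qed
    thus ?thesis using h'(1) by blast
  qed
  thus ?thesis using C(1,2) by blast
qed

subsection \<open>Generic nondegeneracy of critical points\<close>

definition hess :: "(real^'d \<Rightarrow> real) \<Rightarrow> real^'d \<Rightarrow> real^'d^'d::finite" where
  "hess u x = (\<chi> j k. partial_deriv j (partial_deriv k u) x)"

lemma smooth_on_fst: 
  fixes K :: "'a::euclidean_space \<Rightarrow> 'c::euclidean_space"
  assumes "open B" "smooth_on B K"
  shows "smooth_on (B \<times> (UNIV :: 'b::euclidean_space set)) (\<lambda>z. K (fst z))"
  by (rule smooth_on_compose[where f = K and g = fst, OF open_Times[OF assms(1) open_UNIV] assms])
     (auto intro: smooth_on_linear bounded_linear_fst)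

text \<open>With \<open>m\<close> for the \<open>k\<close>-th row of \<open>M\<close>, the equation for the kernel reads \<open>m + (m \<bullet> v) *\<^sub>R axis k 1 = w\<close>, and
pairing with \<open>v\<close> gives \<open>2 * (m \<bullet> v) = w \<bullet> v\<close>.\<close>

lemma kernel_row:
  fixes D M :: "real^'d^'d" and v :: "real^'d"
  assumes vk: "v $ k = 1" and ker: "(D + M + transpose M) *v v = 0"
  defines "M' \<equiv> \<chi> l j. if l = k then 0 else M $ l $ j"
  defines "w \<equiv> - ((D + M' + transpose M') *v v)"
  shows "M $ k = w - ((w \<bullet> v) / 2) *\<^sub>R axis k 1"
proof -
  let ?s = "M $ k \<bullet> v"
  have comp: "w $ j = M $ k $ j + (if j = k then ?s else 0)" for j
  proof -
    have "0 = ((D + M + transpose M) *v v) $ j" by (simp add: ker)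
    also have "\<dots> = (\<Sum>l\<in>UNIV. (D $ j $ l + M $ j $ l + M $ l $ j) * v $ l)"
      by (simp add: matrix_vector_mult_def transpose_def)
    also have "\<dots> = (\<Sum>l\<in>UNIV. (D $ j $ l + M' $ j $ l + M' $ l $ j) * v $ l
        + (if j = k then M $ k $ l * v $ l else 0) + (if l = k then M $ k $ j * v $ k else 0))"
      by (intro sum.cong refl) (auto simp: M'_def algebra_simps)
    also have "\<dots> = - w $ j + (if j = k then ?s else 0) + M $ k $ j"
      by (simp add: sum.distrib w_def matrix_vector_mult_def transpose_def inner_vec_def vk)
    finally show ?thesis by simp
  qed
  have "w \<bullet> v = (\<Sum>j\<in>UNIV. M $ k $ j * v $ j + (if j = k then ?s * v $ k else 0))"
    unfolding inner_vec_def[of w] by (intro sum.cong refl) (auto simp: comp algebra_simps)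
  also have "\<dots> = 2 * ?s" by (simp add: sum.distrib vk inner_vec_def)
  finally have "?s = (w \<bullet> v) / 2" by simp
  thus ?thesis using comp by (auto simp: vec_eq_iff axis_def)
qed

text \<open>The bad parameters are determined by the point \<open>x\<close>, the kernel vector \<open>v\<close> and the rows of the matrix other
than the \<open>k\<close>-th.  Storing \<open>v\<close> in the row \<open>k\<close> of a matrix, with \<open>0\<close> in place of the known entry \<open>v $ k = 1\<close>,
exhibits the bad parameters as the image of a hyperplane.\<close>

lemma negligible_degenerate_kernel:
  fixes u :: "real^'d \<Rightarrow> real"
  assumes B: "open B" and u: "smooth_on B u"
  shows "negligible {a :: (real^'d) \<times> (real^'d^'d). \<exists>x\<in>B. \<exists>v. v $ k = 1 \<and>
    gradient u x + fst a + (snd a + transpose (snd a)) *v x = 0 \<and> (hess u x + snd a + transpose (snd a)) *v v = 0}"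
    (is "negligible ?bad")
proof -
  define v :: "(real^'d) \<times> (real^'d^'d) \<Rightarrow> real^'d" where "v z = (\<chi> j. if j = k then 1 else snd z $ k $ j)" for z
  define M' :: "(real^'d) \<times> (real^'d^'d) \<Rightarrow> real^'d^'d" where "M' z = (\<chi> l j. if l = k then 0 else snd z $ l $ j)" for z
  define w where "w z = - ((hess u (fst z) + M' z + transpose (M' z)) *v v z)" for z
  define m where "m z = w z - ((w z \<bullet> v z) / 2) *\<^sub>R axis k 1" for z
  define M :: "(real^'d) \<times> (real^'d^'d) \<Rightarrow> real^'d^'d" where "M z = (\<chi> l. if l = k then m z else snd z $ l)" for z
  define \<Psi> where "\<Psi> z = (- (gradient u (fst z) + (M z + transpose (M z)) *v fst z), M z)" for z
  let ?\<Omega> = "B \<times> (UNIV :: (real^'d^'d) set)"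
  have o: "open ?\<Omega>" by (intro open_Times B open_UNIV)
  have s_entry: "smooth_on ?\<Omega> (\<lambda>z. snd z $ l $ j)" for l j
    by (intro smooth_on_linear bounded_linear_compose[OF bounded_linear_vec_nth] bounded_linear_compose[OF bounded_linear_vec_nth bounded_linear_snd])
  have s_x: "smooth_on ?\<Omega> (\<lambda>z. fst z $ j)" for j
    by (intro smooth_on_linear bounded_linear_compose[OF bounded_linear_vec_nth bounded_linear_fst])
  have s_v: "smooth_on ?\<Omega> (\<lambda>z. v z $ j)" for j
    using s_entry[of k j] by (cases "j = k") (simp_all add: v_def)
  have s_M': "smooth_on ?\<Omega> (\<lambda>z. M' z $ l $ j)" for l j
    using s_entry[of l j] by (cases "l = k") (simp_all add: M'_def)
  have s_h: "smooth_on ?\<Omega> (\<lambda>z. hess u (fst z) $ j $ l)" for j l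
    using smooth_on_fst[OF B smooth_on_partial_deriv[OF B smooth_on_partial_deriv[OF B u]], of j l] by (simp add: hess_def)
  have s_w: "smooth_on ?\<Omega> (\<lambda>z. w z $ j)" for j
  proof -
    have "smooth_on ?\<Omega> (\<lambda>z. - (\<Sum>l\<in>UNIV. (hess u (fst z) $ j $ l + M' z $ j $ l + M' z $ l $ j) * v z $ l))"
      by (intro smooth_on_minus smooth_on_sum smooth_on_mult smooth_on_add s_h s_M' s_v o)
    thus ?thesis by (simp add: w_def matrix_vector_mult_def transpose_def)
  qed
  have s_m: "smooth_on ?\<Omega> (\<lambda>z. m z $ j)" for j
  proof -
    have "smooth_on ?\<Omega> (\<lambda>z. w z $ j - (\<Sum>l\<in>UNIV. w z $ l * v z $ l) / 2 * axis k 1 $ j)"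
      by (intro smooth_on_diff smooth_on_mult smooth_on_divide smooth_on_sum smooth_on_const s_w s_v o) simp
    thus ?thesis by (simp add: m_def inner_vec_def)
  qed
  have s_M: "smooth_on ?\<Omega> (\<lambda>z. M z $ l $ j)" for l j
    using s_m[of j] s_entry[of l j] by (cases "l = k") (simp_all add: M_def)
  have "smooth_on ?\<Omega> \<Psi>"
    unfolding \<Psi>_def
  proof (rule smooth_on_Pair[OF o])
    show "smooth_on ?\<Omega> M" by (intro smooth_on_vecI o s_M)
    have "smooth_on ?\<Omega> (\<lambda>z. - (partial_deriv j u (fst z) + (\<Sum>l\<in>UNIV. (M z $ j $ l + M z $ l $ j) * fst z $ l)))" for j
      by (intro smooth_on_minus smooth_on_sum smooth_on_mult smooth_on_add s_M s_x o smooth_on_fst smooth_on_partial_deriv B u)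
    thus "smooth_on ?\<Omega> (\<lambda>z. - (gradient u (fst z) + (M z + transpose (M z)) *v fst z))"
      by (intro smooth_on_vecI[OF o]) (simp add: gradient_def matrix_vector_mult_def transpose_def)
  qed
  hence d: "\<Psi> differentiable_on (?\<Omega> \<inter> {z. snd z $ k $ k = 0})"
    by (rule differentiable_on_subset[OF smooth_on_differentiable_on]) simp
  have "{z. snd z $ k $ k = 0} = {z :: (real^'d) \<times> (real^'d^'d). (0, axis k (axis k 1)) \<bullet> z = 0}"
    by (auto simp: inner_axis')
  moreover have "negligible {z :: (real^'d) \<times> (real^'d^'d). (0, axis k (axis k 1)) \<bullet> z = 0}"
    by (rule negligible_hyperplane) (simp add: axis_eq_0_iff zero_prod_def)
  ultimately have "negligible (?\<Omega> \<inter> {z. snd z $ k $ k = 0})"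
    by (metis Int_lower2 negligible_subset)
  hence "negligible (\<Psi> ` (?\<Omega> \<inter> {z. snd z $ k $ k = 0}))"
    by (intro negligible_differentiable_image_negligible d) simp_all
  moreover have "?bad \<subseteq> \<Psi> ` (?\<Omega> \<inter> {z. snd z $ k $ k = 0})"
  proof
    fix a :: "(real^'d) \<times> (real^'d^'d)" assume "a \<in> ?bad"
    then obtain x y where x: "x \<in> B" and y: "y $ k = 1"
      and crit: "gradient u x + fst a + (snd a + transpose (snd a)) *v x = 0"
      and ker: "(hess u x + snd a + transpose (snd a)) *v y = 0" by blast
    define L :: "real^'d^'d" where "L = (\<chi> l j. if l = k then if j = k then 0 else y $ j else snd a $ l $ j)"
    define z where "z = (x, L)"
    have vz: "v z = y" by (simp add: v_def z_def L_def vec_eq_iff y)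
    have M'z: "M' z = (\<chi> l j. if l = k then 0 else snd a $ l $ j)" by (simp add: M'_def z_def L_def vec_eq_iff)
    have "m z = snd a $ k"
      unfolding m_def w_def vz M'z using kernel_row[OF y ker] by (simp add: z_def)
    hence Mz: "M z = snd a" by (simp add: M_def z_def L_def vec_eq_iff)
    have "fst a = - (gradient u x + (snd a + transpose (snd a)) *v x)"
      using crit by (simp add: eq_neg_iff_add_eq_0 algebra_simps)
    hence "a = \<Psi> z" by (simp add: \<Psi>_def Mz prod_eq_iff) (simp add: z_def)
    moreover have "z \<in> ?\<Omega> \<inter> {z. snd z $ k $ k = 0}" using x by (simp add: z_def L_def)
    ultimately show "a \<in> \<Psi> ` (?\<Omega> \<inter> {z. snd z $ k $ k = 0})" by blast
  qed
  ultimately show ?thesis by (rule negligible_subset)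
qed

lemma det_zero_kernel:
  fixes A :: "real^'n^'n"
  assumes "det A = 0" obtains v where "v \<noteq> 0" "A *v v = 0"
proof -
  have "\<not> inj ((*v) A)"
    using assms det_nz_iff_inj[of "(*v) A"] by (simp add: matrix_of_matrix_vector_mul)
  thus thesis using that linear_injective_0[of "(*v) A"] by (auto simp: matrix_vector_mul_linear)
qed

lemma negligible_degenerate:
  fixes u :: "real^'d \<Rightarrow> real"
  assumes B: "open B" and u: "smooth_on B u"
  shows "negligible {a :: (real^'d) \<times> (real^'d^'d). \<exists>x\<in>B.
    gradient u x + fst a + (snd a + transpose (snd a)) *v x = 0 \<and> det (hess u x + snd a + transpose (snd a)) = 0}"
proof (rule negligible_subset)
  show "negligible (\<Union>k\<in>UNIV. {a :: (real^'d) \<times> (real^'d^'d). \<exists>x\<in>B. \<exists>v. v $ k = 1 \<and>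
    gradient u x + fst a + (snd a + transpose (snd a)) *v x = 0 \<and> (hess u x + snd a + transpose (snd a)) *v v = 0})"
  proof (rule negligible_Union)
    fix S assume "S \<in> (\<lambda>k. {a :: (real^'d) \<times> (real^'d^'d). \<exists>x\<in>B. \<exists>v. v $ k = 1 \<and>
      gradient u x + fst a + (snd a + transpose (snd a)) *v x = 0 \<and> (hess u x + snd a + transpose (snd a)) *v v = 0}) ` UNIV"
    thus "negligible S" by (elim imageE) (simp only: negligible_degenerate_kernel[OF B u])
  qed simp
  show "{a :: (real^'d) \<times> (real^'d^'d). \<exists>x\<in>B.
    gradient u x + fst a + (snd a + transpose (snd a)) *v x = 0 \<and> det (hess u x + snd a + transpose (snd a)) = 0} \<subseteq>
    (\<Union>k\<in>UNIV. {a :: (real^'d) \<times> (real^'d^'d). \<exists>x\<in>B. \<exists>v. v $ k = 1 \<and>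
    gradient u x + fst a + (snd a + transpose (snd a)) *v x = 0 \<and> (hess u x + snd a + transpose (snd a)) *v v = 0})"
  proof
    fix a :: "(real^'d) \<times> (real^'d^'d)"
    assume "a \<in> {a. \<exists>x\<in>B. gradient u x + fst a + (snd a + transpose (snd a)) *v x = 0 \<and> det (hess u x + snd a + transpose (snd a)) = 0}"
    then obtain x where x: "x \<in> B" "gradient u x + fst a + (snd a + transpose (snd a)) *v x = 0"
      "det (hess u x + snd a + transpose (snd a)) = 0" by blast
    obtain v where v: "v \<noteq> 0" "(hess u x + snd a + transpose (snd a)) *v v = 0" using det_zero_kernel[OF x(3)] by blast
    obtain k where k: "v $ k \<noteq> 0" using v(1) by (auto simp: vec_eq_iff)
    let ?v = "(1 / v $ k) *\<^sub>R v"
    have "?v $ k = 1" "(hess u x + snd a + transpose (snd a)) *v ?v = 0"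
      using k v(2) by (simp_all add: matrix_vector_mult_scaleR)
    thus "a \<in> (\<Union>k\<in>UNIV. {a :: (real^'d) \<times> (real^'d^'d). \<exists>x\<in>B. \<exists>v. v $ k = 1 \<and>
       gradient u x + fst a + (snd a + transpose (snd a)) *v x = 0 \<and> (hess u x + snd a + transpose (snd a)) *v v = 0})"
      using x(1,2) by blast
  qed
qed

lemma smooth_inner_vec:
  fixes f g :: "'a::euclidean_space \<Rightarrow> real^'d"
  assumes "open U" "\<And>j. smooth_on U (\<lambda>x. f x $ j)" "\<And>j. smooth_on U (\<lambda>x. g x $ j)"
  shows "smooth_on U (\<lambda>x. f x \<bullet> g x)"
proof -
  have "smooth_on U (\<lambda>x. \<Sum>j\<in>UNIV. f x $ j * g x $ j)"
    by (intro smooth_on_sum smooth_on_mult assms)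
  thus ?thesis by (simp add: inner_vec_def)
qed

lemma dense_morse:
  fixes \<A> :: "('m::t2_space, 'd::finite) chart set"
  assumes A: "smooth_atlas \<A>"
  shows "\<exists>C. compact C \<and> p \<in> interior C \<and> (\<forall>h\<in>smooth_functions \<A>. \<forall>U. openin (Cinf_topology \<A>) U \<longrightarrow> h \<in> U \<longrightarrow>
     (\<exists>h'\<in>U. \<forall>q\<in>C. morse_at \<A> h' q))"
proof -
  obtain c where c: "c \<in> \<A>" "p \<in> fst c" using atlas_covers[OF A] by blast
  have cs: "c \<in> smooth_charts \<A>" by (rule atlas_in_smooth_charts[OF A c(1)])
  have ch: "is_chart c" by (rule smooth_charts_chart[OF cs])
  obtain R where R: "R > 0" "cball (snd c p) R \<subseteq> chart_image c" using chart_ball[OF ch c(2)] by blast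
  let ?x = "snd c p" and ?C = "chart_inv c ` cball (snd c p) (R / 3)"
  have sub: "cball ?x (R / 3) \<subseteq> chart_image c" using R by fastforce
  have "R / 3 > 0" using R by simp
  note C = chart_compact_nbhd[OF ch c(2) this sub]
  let ?B = "ball ?x (R / 2)"
  have subB: "?B \<subseteq> chart_image c" using R by fastforce
  have "\<exists>h'\<in>U. \<forall>q\<in>?C. morse_at \<A> h' q"
    if h: "h \<in> smooth_functions \<A>" and U: "openin (Cinf_topology \<A>) U" "h \<in> U" for h U
  proof -
    let ?u = "h \<circ> chart_inv c" and ?G = "\<lambda>(a :: (real^'d) \<times> (real^'d^'d)) x. fst a \<bullet> x + x \<bullet> (snd a *v x)"
    have u: "smooth_on ?B ?u" by (rule smooth_on_subset[OF subB smooth_functions_chart[OF A h cs]])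
    have lin: "linear (\<lambda>a. ?G a x)" for x
      by (rule linearI) (auto simp: inner_add_left inner_add_right matrix_vector_mult_add_rdistrib scaleR_matrix_vector_assoc[symmetric] algebra_simps)
    have dG: "(?G a has_derivative (\<lambda>v. (fst a + (snd a + transpose (snd a)) *v x) \<bullet> v)) (at x)" for a x
    proof -
      have "(?G a has_derivative (\<lambda>v. fst a \<bullet> v + (x \<bullet> (snd a *v v) + v \<bullet> (snd a *v x)))) (at x)"
        by (intro has_derivative_add has_derivative_inner has_derivative_inner_right has_derivative_ident
            bounded_linear_imp_has_derivative matrix_vector_mul_bounded_linear)
      moreover have "x \<bullet> (snd a *v v) = (transpose (snd a) *v x) \<bullet> v" for v
        by (metis dot_lmul_matrix transpose_matrix_vector)
      ultimately show ?thesis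
        by (simp add: inner_add_left inner_add_right matrix_vector_mult_add_rdistrib inner_commute add_ac)
    qed
    have pdG: "partial_deriv j (?G a) x = (fst a + (snd a + transpose (snd a)) *v x) $ j" for j a x
      by (simp add: partial_deriv_has_derivative[OF dG] inner_axis)
    have dpG: "((\<lambda>x. (fst a + (snd a + transpose (snd a)) *v x) $ j) has_derivative
        (\<lambda>v. ((snd a + transpose (snd a)) *v v) $ j)) (at x)" for j x and a :: "(real^'d) \<times> (real^'d^'d)"
    proof -
      have "((\<lambda>x. fst a + (snd a + transpose (snd a)) *v x) has_derivative (\<lambda>v. 0 + (snd a + transpose (snd a)) *v v)) (at x)"
        by (intro has_derivative_add has_derivative_const bounded_linear_imp_has_derivative matrix_vector_mul_bounded_linear)
      from bounded_linear.has_derivative[OF bounded_linear_vec_nth this, of j] show ?thesis by simp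
    qed
    have sm: "smooth_on UNIV (?G a)" for a
    proof (intro smooth_on_add smooth_inner_vec smooth_on_const smooth_on_nth open_UNIV)
      show "smooth_on UNIV (\<lambda>x. (snd a *v x) $ j)" for j
        by (intro smooth_on_linear bounded_linear_compose[OF bounded_linear_vec_nth matrix_vector_mul_bounded_linear])
    qed
    obtain h' a where h': "h' \<in> U" "h' \<in> smooth_functions \<A>"
        "a \<notin> {a. \<exists>x\<in>?B. gradient ?u x + fst a + (snd a + transpose (snd a)) *v x = 0 \<and> det (hess ?u x + snd a + transpose (snd a)) = 0}"
        "\<And>x. x \<in> cball ?x (R / 2) \<Longrightarrow> (h' \<circ> chart_inv c) x = ?u x + ?G a x"
      using generic_perturbation[where G = ?G and r = "R / 2", OF A cs R(2) _ _ lin sm U negligible_degenerate[OF open_ball u]] R(1)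
      by auto
    let ?u' = "h' \<circ> chart_inv c"
    have grad: "partial_deriv j ?u' x = (gradient ?u x + fst a + (snd a + transpose (snd a)) *v x) $ j" if x: "x \<in> ?B" for j x
    proof -
      have "partial_deriv j ?u' x = partial_deriv j (\<lambda>x. ?u x + ?G a x) x"
        by (rule partial_deriv_cong[OF open_ball x]) (use h'(4) in auto)
      also have "\<dots> = partial_deriv j ?u x + partial_deriv j (?G a) x"
        by (rule partial_deriv_add[OF smooth_on_differentiable[OF u x] differentiableI[OF dG]])
      finally show ?thesis by (simp add: pdG gradient_def comp_def)
    qed
    have hes: "partial_deriv j (partial_deriv k ?u') x = (hess ?u x + snd a + transpose (snd a)) $ j $ k" if x: "x \<in> ?B" for j k x
    proof -
      have "partial_deriv j (partial_deriv k ?u') x = partial_deriv j (\<lambda>x. partial_deriv k ?u x + (fst a + (snd a + transpose (snd a)) *v x) $ k) x"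
        by (rule partial_deriv_cong[OF open_ball x]) (simp add: grad gradient_def add.assoc)
      also have "\<dots> = partial_deriv j (partial_deriv k ?u) x + partial_deriv j (\<lambda>x. (fst a + (snd a + transpose (snd a)) *v x) $ k) x"
        by (rule partial_deriv_add[OF smooth_on_differentiable[OF smooth_on_partial_deriv[OF open_ball u] x] differentiableI[OF dpG]])
      also have "partial_deriv j (\<lambda>x. (fst a + (snd a + transpose (snd a)) *v x) $ k) x = ((snd a + transpose (snd a)) *v axis j 1) $ k"
        by (rule partial_deriv_has_derivative[OF dpG])
      finally show ?thesis
        by (simp add: hess_def comp_def matrix_vector_mult_basis column_def transpose_def)
    qed
    have "morse_at \<A> h' q" if q: "q \<in> ?C" for q
    proof (rule morse_atI[OF A h'(2) c(1)])
      show qc: "q \<in> fst c" using C(3)[OF q] by simp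
      let ?y = "snd c q"
      have y: "?y \<in> ?B" using C(3)[OF q] R(1) by auto
      assume "critical_in_chart c h' q"
      hence "gradient ?u ?y + fst a + (snd a + transpose (snd a)) *v ?y = 0"
        using grad[OF y] by (simp add: critical_in_chart_def vec_eq_iff)
      hence "det (hess ?u ?y + snd a + transpose (snd a)) \<noteq> 0" using h'(3) y by blast
      moreover have "hessian_in_chart c h' q = hess ?u ?y + snd a + transpose (snd a)"
        using hes[OF y] by (simp add: hessian_in_chart_def vec_eq_iff)
      ultimately show "det (hessian_in_chart c h' q) \<noteq> 0" by simp
    qed
    thus ?thesis using h'(1) by blast
  qed
  thus ?thesis using C(1,2) by blast
qed

subsection \<open>Generic vanishing order of the mean curvature\<close>

text \<open>The quantities of the level frame depend on the function only through its derivatives of order at most two at the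
point.  In order to differentiate with respect to these derivatives, they are made independent variables:
\<open>v\<close> stands for the gradient and \<open>Q\<close> for the Hessian.\<close>

definition jet_frame :: "'d::finite \<Rightarrow> real^'d \<Rightarrow> 'd \<Rightarrow> real^'d" where
  "jet_frame i v j = axis j 1 + (((if j = i then 1 else 0) - v $ j) / v $ i) *\<^sub>R axis i 1"

definition jet_metric :: "('m, 'd::finite) metric \<Rightarrow> ('m, 'd) chart \<Rightarrow> 'd \<Rightarrow> real^'d \<Rightarrow> real^'d \<Rightarrow> real^'d^'d" where
  "jet_metric g c i x v =
     (\<chi> j k. \<Sum>a\<in>UNIV. \<Sum>b\<in>UNIV. jet_frame i v j $ a * g c x $ a $ b * jet_frame i v k $ b)"

definition jet_trace ::
  "('m, 'd::finite) metric \<Rightarrow> ('m, 'd) chart \<Rightarrow> 'd \<Rightarrow> real^'d \<Rightarrow> real^'d \<Rightarrow> real^'d^'d \<Rightarrow> real" where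
  "jet_trace g c i x v Q = (\<Sum>j\<in>-{i}. \<Sum>k\<in>-{i}. matrix_inv (padded i (jet_metric g c i x v)) $ j $ k *
     (\<Sum>a\<in>UNIV. \<Sum>b\<in>UNIV. ((\<Sum>l\<in>UNIV. v $ l * christoffel g c l a b x) - Q $ a $ b)
       * (jet_frame i v j $ a * jet_frame i v k $ b)))"

lemma level_frame_jet: "level_frame i f j x = jet_frame i (gradient f x) j"
  by (simp add: level_frame_def jet_frame_def gradient_def)

lemma level_metric_jet: "level_metric g c i f x = jet_metric g c i x (gradient f x)"
  by (simp add: level_metric_def jet_metric_def level_frame_jet)

lemma level_trace_jet: "level_trace g c i f x = jet_trace g c i x (gradient f x) (hess f x)"
  unfolding level_trace_def jet_trace_def level_metric_jet level_hessian_def level_frame_jet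
  by (simp add: hess_def gradient_def)

type_synonym 'd cubic = "(real^'d) \<times> (real^'d) \<times> (real^'d) \<times> real"

text \<open>A polynomial in the coordinates other than \<open>i\<close> leaves the derivative in the direction \<open>i\<close> unchanged.  With
vectors over \<open>'d\<close> as coefficients, the parameters form a Euclidean space.\<close>

definition cubic :: "'d::finite \<Rightarrow> 'd cubic \<Rightarrow> real^'d \<Rightarrow> real" where
  "cubic i t x = snd (snd (snd t)) +
     (\<Sum>l\<in>-{i}. fst t $ l * x $ l ^ 3 + fst (snd t) $ l * x $ l ^ 2 + fst (snd (snd t)) $ l * x $ l)"

definition cubic1 :: "'d::finite cubic \<Rightarrow> real^'d \<Rightarrow> 'd \<Rightarrow> real" where
  "cubic1 t x l = 3 * fst t $ l * x $ l ^ 2 + 2 * fst (snd t) $ l * x $ l + fst (snd (snd t)) $ l"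

definition cubic2 :: "'d::finite cubic \<Rightarrow> real^'d \<Rightarrow> 'd \<Rightarrow> real" where
  "cubic2 t x l = 6 * fst t $ l * x $ l + 2 * fst (snd t) $ l"

lemma smooth_cubic: "smooth_on UNIV (cubic i t)"
  unfolding cubic_def
  by (intro smooth_on_add smooth_on_sum smooth_on_mult smooth_on_power smooth_on_const smooth_on_nth open_UNIV)

lemma linear_cubic: "linear (\<lambda>t. cubic i t x)"
  by (rule linearI) (simp_all add: cubic_def algebra_simps sum.distrib sum_distrib_left)

lemma has_derivative_nth: "((\<lambda>x::real^'d. x $ l) has_derivative (\<lambda>v. v $ l)) (at x)"
  by (rule bounded_linear_imp_has_derivative) (rule bounded_linear_vec_nth)

lemma cubic_has_derivative:
  "(cubic i t has_derivative (\<lambda>v. \<Sum>l\<in>-{i}. cubic1 t x l * v $ l)) (at x)"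
proof -
  have "(cubic i t has_derivative (\<lambda>v. 0 + (\<Sum>l\<in>-{i}. fst t $ l * (of_nat 3 * v $ l * x $ l ^ (3 - 1)) +
      fst (snd t) $ l * (of_nat 2 * v $ l * x $ l ^ (2 - 1)) + fst (snd (snd t)) $ l * v $ l))) (at x)"
    unfolding cubic_def
    by (intro has_derivative_add has_derivative_const has_derivative_sum has_derivative_mult_right
        has_derivative_power has_derivative_nth)
  moreover have "(\<lambda>v. 0 + (\<Sum>l\<in>-{i}. fst t $ l * (of_nat 3 * v $ l * x $ l ^ (3 - 1)) +
      fst (snd t) $ l * (of_nat 2 * v $ l * x $ l ^ (2 - 1)) + fst (snd (snd t)) $ l * v $ l))
      = (\<lambda>v. \<Sum>l\<in>-{i}. cubic1 t x l * v $ l)"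
    by (rule ext) (simp add: cubic1_def algebra_simps)
  ultimately show ?thesis by simp
qed

lemma cubic1_has_derivative:
  "((\<lambda>x. cubic1 t x l) has_derivative (\<lambda>v. cubic2 t x l * v $ l)) (at x)"
proof -
  have "((\<lambda>x. cubic1 t x l) has_derivative (\<lambda>v. 3 * fst t $ l * (of_nat 2 * v $ l * x $ l ^ (2 - 1)) +
      2 * fst (snd t) $ l * v $ l + 0)) (at x)"
    unfolding cubic1_def
    by (intro has_derivative_add has_derivative_const has_derivative_mult_right has_derivative_power has_derivative_nth)
  moreover have "(\<lambda>v. 3 * fst t $ l * (of_nat 2 * v $ l * x $ l ^ (2 - 1)) + 2 * fst (snd t) $ l * v $ l + 0)
     = (\<lambda>v. cubic2 t x l * v $ l)"
    by (rule ext) (simp add: cubic2_def algebra_simps)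
  ultimately show ?thesis by simp
qed

lemma cubic2_has_derivative:
  "((\<lambda>x. cubic2 t x l) has_derivative (\<lambda>v. 6 * fst t $ l * v $ l)) (at x)"
proof -
  have "((\<lambda>x. cubic2 t x l) has_derivative (\<lambda>v. 6 * fst t $ l * v $ l + 0)) (at x)"
    unfolding cubic2_def by (intro has_derivative_add has_derivative_const has_derivative_mult_right has_derivative_nth)
  thus ?thesis by simp
qed

lemma partial_deriv_cubic: "partial_deriv j (cubic i t) x = (if j = i then 0 else cubic1 t x j)"
proof -
  have "partial_deriv j (cubic i t) x = (\<Sum>l\<in>-{i}. if l = j then cubic1 t x j else 0)"
    unfolding partial_deriv_has_derivative[OF cubic_has_derivative] by (intro sum.cong) (auto simp: axis_def)
  thus ?thesis by simp
qed

lemma partial_deriv_cubic1: "partial_deriv j (\<lambda>x. cubic1 t x l) x = (if j = l then cubic2 t x l else 0)"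
  unfolding partial_deriv_has_derivative[OF cubic1_has_derivative] by (simp add: axis_def)

context metric_straightening
begin

type_synonym 'e jet = "(real^'e) \<times> (real^'e) \<times> (real^'e)"

text \<open>In a jet \<open>(x, s, m)\<close> the vector \<open>s\<close> is the gradient and \<open>m\<close> the diagonal Hessian of a perturbation, at the
point \<open>x\<close> and in the directions other than \<open>i\<close>; \<open>jet_grad\<close> and \<open>jet_hess\<close> belong to the perturbed function.\<close>

definition jet_grad :: "'d jet \<Rightarrow> real^'d" where
  "jet_grad z = (\<chi> l. partial_deriv l f (fst z) + (if l = i then 0 else fst (snd z) $ l))"

definition jet_hess :: "'d jet \<Rightarrow> real^'d^'d" where
  "jet_hess z = (\<chi> a b. partial_deriv a (partial_deriv b f) (fst z) + (if a = b \<and> a \<noteq> i then snd (snd z) $ a else 0))"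

definition trace_at :: "'d jet \<Rightarrow> real" where
  "trace_at z = jet_trace g c i (fst z) (jet_grad z) (jet_hess z)"

definition trace_coef :: "'d jet \<Rightarrow> 'd \<Rightarrow> real" where
  "trace_coef z l = matrix_inv (padded i (jet_metric g c i (fst z) (jet_grad z))) $ l $ l"

abbreviation "\<Omega> \<equiv> B \<times> (UNIV :: (real^'d) set) \<times> (UNIV :: (real^'d) set)"

lemma open_\<Omega>: "open \<Omega>"
  by (intro open_Times open_B open_UNIV)

lemma perturbed: "metric_straightening i (\<lambda>x. f x + cubic i t x) B \<A> g c"
proof
  show "smooth_on B (\<lambda>x. f x + cubic i t x)"
    by (intro smooth_on_add open_B smooth_f smooth_on_subset[OF _ smooth_cubic]) simp
  show "partial_deriv i (\<lambda>x. f x + cubic i t x) x \<noteq> 0" if "x \<in> B" for x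
    using partial_deriv_add[OF smooth_on_differentiable[OF smooth_f that] differentiableI[OF cubic_has_derivative], of i i t]
      transversal[OF that] by (simp add: partial_deriv_cubic)
qed (use open_B convex_B atlas metric c B_image in auto)

text \<open>The entries \<open>i\<close> are constant; they record two of the coefficients with the index \<open>i\<close>, so that these
can be recovered from the jet as well.\<close>

definition jet_at :: "'d cubic \<Rightarrow> real^'d \<Rightarrow> 'd jet" where
  "jet_at t x = (x, (\<chi> l. if l = i then fst t $ i else cubic1 t x l),
     (\<chi> l. if l = i then fst (snd t) $ i else cubic2 t x l))"

lemma gradient_perturbed:
  assumes x: "x \<in> B"
  shows "partial_deriv l (\<lambda>x. f x + cubic i t x) x = partial_deriv l f x + (if l = i then 0 else cubic1 t x l)"
  using partial_deriv_add[OF smooth_on_differentiable[OF smooth_f x] differentiableI[OF cubic_has_derivative], of l i t]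
  by (simp add: partial_deriv_cubic)

lemma gradient_jet: "x \<in> B \<Longrightarrow> gradient (\<lambda>x. f x + cubic i t x) x = jet_grad (jet_at t x)"
  by (simp add: vec_eq_iff gradient_def gradient_perturbed jet_grad_def jet_at_def)

lemma hess_jet:
  assumes x: "x \<in> B" shows "hess (\<lambda>x. f x + cubic i t x) x = jet_hess (jet_at t x)"
proof -
  have "partial_deriv a (partial_deriv b (\<lambda>x. f x + cubic i t x)) x =
      partial_deriv a (partial_deriv b f) x + (if a = b \<and> a \<noteq> i then cubic2 t x a else 0)" for a b
  proof -
    note db = smooth_on_differentiable[OF smooth_on_partial_deriv[OF open_B smooth_f] x]
    have "partial_deriv a (partial_deriv b (\<lambda>x. f x + cubic i t x)) x
        = partial_deriv a (\<lambda>x. partial_deriv b f x + (if b = i then 0 else cubic1 t x b)) x"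
      by (rule partial_deriv_cong[OF open_B x]) (rule gradient_perturbed)
    also have "\<dots> = partial_deriv a (partial_deriv b f) x + (if a = b \<and> a \<noteq> i then cubic2 t x a else 0)"
    proof (cases "b = i")
      case True
      thus ?thesis by auto
    next
      case False
      thus ?thesis
        using partial_deriv_add[OF db differentiableI[OF cubic1_has_derivative], of a b t b]
        by (auto simp: partial_deriv_cubic1)
    qed
    finally show ?thesis .
  qed
  thus ?thesis by (auto simp: vec_eq_iff hess_def jet_hess_def jet_at_def)
qed

lemma level_trace_perturbed: "x \<in> B \<Longrightarrow> level_trace g c i (\<lambda>x. f x + cubic i t x) x = trace_at (jet_at t x)"
  by (simp add: level_trace_jet gradient_jet hess_jet trace_at_def) (simp add: jet_at_def)

text \<open>Every first-order jet is realized by a perturbation, so the metric of the jet is that of an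
  adapted chart.\<close>

lemma pos_def_jet:
  assumes "fst z \<in> B" shows "pos_def (padded i (jet_metric g c i (fst z) (jet_grad z)))"
proof -
  define t :: "'d cubic" where "t = (0, 0, fst (snd z), 0)"
  interpret p: metric_straightening i "\<lambda>x. f x + cubic i t x" B \<A> g c by (rule perturbed)
  have "jet_grad z = jet_grad (jet_at t (fst z))"
    by (simp add: jet_grad_def jet_at_def cubic1_def t_def vec_eq_iff)
  hence "jet_metric g c i (fst z) (jet_grad z) = level_metric g c i (\<lambda>x. f x + cubic i t x) (fst z)"
    by (simp add: level_metric_jet gradient_jet[OF assms])
  thus ?thesis
    using pos_def_padded[OF p.pos_def_c'[OF assms], of i] p.level_metric_eq[OF assms] by simp
qed

lemma trace_coef_pos: "fst z \<in> B \<Longrightarrow> trace_coef z l > 0"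
  unfolding trace_coef_def by (rule pos_def_inv_diag[OF pos_def_jet])

lemma jet_grad_snd: "jet_grad (x, s, m) = jet_grad (x, s, m')"
  unfolding jet_grad_def fst_conv snd_conv ..

lemma trace_coef_snd: "trace_coef (x, s, m) l = trace_coef (x, s, m') l"
  unfolding trace_coef_def jet_grad_snd[of x s m m'] fst_conv ..

text \<open>Second derivatives enter the trace linearly, and a diagonal one in the directions other than \<open>i\<close> only
meets the corresponding diagonal entry of the inverse metric.\<close>

lemma trace_at_affine: "trace_at (x, s, m) = trace_at (x, s, m') - (\<Sum>l\<in>-{i}. trace_coef (x, s, m) l * (m $ l - m' $ l))"
proof -
  let ?v = "jet_grad (x, s, m)" and ?X = "jet_frame i (jet_grad (x, s, m))"
  let ?\<gamma> = "matrix_inv (padded i (jet_metric g c i x ?v))"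
  let ?W = "\<lambda>Q j k. \<Sum>a\<in>UNIV. \<Sum>b\<in>UNIV. ((\<Sum>l\<in>UNIV. ?v $ l * christoffel g c l a b x) - Q $ a $ b) * (?X j $ a * ?X k $ b)"
  have X: "?X j $ a = (if a = j then 1 else 0)" if "a \<noteq> i" for j a
    using that by (simp add: jet_frame_def axis_def)
  have W: "?W (jet_hess (x, s, m)) j k = ?W (jet_hess (x, s, m')) j k - (if j = k then m $ j - m' $ j else 0)"
    if jk: "j \<noteq> i" "k \<noteq> i" for j k
  proof -
    have "?W (jet_hess (x, s, m')) j k - ?W (jet_hess (x, s, m)) j k =
       (\<Sum>a\<in>UNIV. \<Sum>b\<in>UNIV. (if a = b \<and> a \<noteq> i then m $ a - m' $ a else 0) * (?X j $ a * ?X k $ b))"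
      unfolding sum_subtractf[symmetric] by (intro sum.cong refl) (auto simp: jet_hess_def algebra_simps)
    also have "\<dots> = (\<Sum>a\<in>UNIV. \<Sum>b\<in>UNIV. if b = a then (if a = j then (if j = k then m $ j - m' $ j else 0) else 0) else 0)"
      using jk X by (intro sum.cong refl) auto
    also have "\<dots> = (if j = k then m $ j - m' $ j else 0)" by simp
    finally show ?thesis by simp
  qed
  have "trace_at (x, s, m) = (\<Sum>j\<in>-{i}. \<Sum>k\<in>-{i}. ?\<gamma> $ j $ k * ?W (jet_hess (x, s, m)) j k)"
    by (simp add: trace_at_def jet_trace_def)
  also have "\<dots> = (\<Sum>j\<in>-{i}. \<Sum>k\<in>-{i}. ?\<gamma> $ j $ k * ?W (jet_hess (x, s, m')) j k
      - (if k = j then ?\<gamma> $ j $ j * (m $ j - m' $ j) else 0))"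
  proof (intro sum.cong refl)
    fix j k assume "j \<in> -{i}" "k \<in> -{i}"
    hence jk: "j \<noteq> i" "k \<noteq> i" by auto
    show "?\<gamma> $ j $ k * ?W (jet_hess (x, s, m)) j k = ?\<gamma> $ j $ k * ?W (jet_hess (x, s, m')) j k
      - (if k = j then ?\<gamma> $ j $ j * (m $ j - m' $ j) else 0)"
      unfolding W[OF jk] right_diff_distrib by (cases "k = j") (simp_all add: right_diff_distrib)
  qed
  also have "\<dots> = (\<Sum>j\<in>-{i}. \<Sum>k\<in>-{i}. ?\<gamma> $ j $ k * ?W (jet_hess (x, s, m')) j k) - (\<Sum>j\<in>-{i}. ?\<gamma> $ j $ j * (m $ j - m' $ j))"
    by (simp add: sum_subtractf)
  also have "(\<Sum>j\<in>-{i}. \<Sum>k\<in>-{i}. ?\<gamma> $ j $ k * ?W (jet_hess (x, s, m')) j k) = trace_at (x, s, m')"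
    by (simp add: trace_at_def jet_trace_def jet_grad_snd[of x s m m'])
  finally show ?thesis by (simp add: trace_coef_def)
qed

lemma smooth_fst_jet: "smooth_on B K \<Longrightarrow> smooth_on \<Omega> (\<lambda>z. K (fst z))"
  for K :: "real^'d \<Rightarrow> real"
  using smooth_on_fst[OF open_B, of K] by (simp add: UNIV_Times_UNIV)

lemma smooth_jet_grad: "smooth_on \<Omega> (\<lambda>z. jet_grad z $ l)"
proof -
  have "smooth_on \<Omega> (\<lambda>z. fst (snd z) $ l)"
    by (intro smooth_on_linear bounded_linear_compose[OF bounded_linear_vec_nth]
        bounded_linear_compose[OF bounded_linear_fst] bounded_linear_snd)
  hence "smooth_on \<Omega> (\<lambda>z. if l = i then 0 else fst (snd z) $ l)" by (cases "l = i") simp_all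
  thus ?thesis unfolding jet_grad_def vec_lambda_beta
    by (intro smooth_on_add open_\<Omega> smooth_fst_jet smooth_on_partial_deriv open_B smooth_f)
qed

lemma jet_grad_i: "fst z \<in> B \<Longrightarrow> jet_grad z $ i \<noteq> 0"
  by (simp add: jet_grad_def transversal)

lemma smooth_jet_frame: "smooth_on \<Omega> (\<lambda>z. jet_frame i (jet_grad z) j $ a)"
proof -
  have "smooth_on \<Omega> (\<lambda>z. axis j 1 $ a + ((if j = i then 1 else 0) - jet_grad z $ j) / jet_grad z $ i * axis i 1 $ a)"
    by (intro smooth_on_add smooth_on_mult smooth_on_divide smooth_on_diff smooth_on_const smooth_jet_grad open_\<Omega>)
       (auto simp: jet_grad_i)
  thus ?thesis by (simp add: jet_frame_def)
qed

lemma smooth_inv_jet_metric: "smooth_on \<Omega> (\<lambda>z. matrix_inv (padded i (jet_metric g c i (fst z) (jet_grad z))) $ j $ k)"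
proof (rule smooth_on_matrix_inv[OF open_\<Omega>])
  fix j k
  have "smooth_on \<Omega> (\<lambda>z. jet_metric g c i (fst z) (jet_grad z) $ j $ k)"
    unfolding jet_metric_def vec_lambda_beta
    by (intro smooth_on_sum smooth_on_mult smooth_jet_frame smooth_fst_jet smooth_g open_\<Omega>)
  thus "smooth_on \<Omega> (\<lambda>z. padded i (jet_metric g c i (fst z) (jet_grad z)) $ j $ k)"
    by (cases "j = i"; cases "k = i"; cases "j = k") (simp_all add: padded_def)
next
  fix z assume "z \<in> \<Omega>"
  hence "fst z \<in> B" by auto
  thus "det (padded i (jet_metric g c i (fst z) (jet_grad z))) \<noteq> 0" by (rule pos_def_det[OF pos_def_jet])
qed

lemma smooth_trace_coef: "smooth_on \<Omega> (\<lambda>z. trace_coef z l)"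
  unfolding trace_coef_def by (rule smooth_inv_jet_metric)

lemma smooth_trace_at: "smooth_on \<Omega> trace_at"
proof -
  have q: "smooth_on \<Omega> (\<lambda>z. jet_hess z $ a $ b)" for a b
  proof -
    have "smooth_on \<Omega> (\<lambda>z. snd (snd z) $ a)"
      by (intro smooth_on_linear bounded_linear_compose[OF bounded_linear_vec_nth]
        bounded_linear_compose[OF bounded_linear_snd] bounded_linear_snd)
    hence "smooth_on \<Omega> (\<lambda>z. if P then snd (snd z) $ a else 0)" for P by (cases P) simp_all
    thus ?thesis unfolding jet_hess_def vec_lambda_beta
      by (intro smooth_on_add open_\<Omega> smooth_fst_jet smooth_on_partial_deriv open_B smooth_f)
  qed
  have ch: "smooth_on B (christoffel g c l a b)" for l a b
    by (rule smooth_on_subset[OF B_image smooth_christoffel[OF metric c]])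
  show ?thesis
    unfolding trace_at_def[abs_def] jet_trace_def
    by (intro smooth_on_sum smooth_on_mult smooth_on_diff smooth_inv_jet_metric smooth_jet_grad smooth_jet_frame
        smooth_fst_jet ch q open_\<Omega>)
qed

lemma jet_at_has_derivative:
  "(jet_at t has_derivative (\<lambda>v. (v, (\<chi> l. if l = i then 0 else cubic2 t x l * v $ l),
     (\<chi> l. if l = i then 0 else 6 * fst t $ l * v $ l)))) (at x)"
  unfolding jet_at_def
proof (intro has_derivative_Pair has_derivative_ident)
  have vec: "((\<lambda>x. \<chi> l. K l x) has_derivative (\<lambda>v. \<chi> l. K' l v)) (at x)"
    if "\<And>l. (K l has_derivative K' l) (at x)" for K K' :: "'d \<Rightarrow> real^'d \<Rightarrow> real"
    using that by (subst has_derivative_componentwise_within) (auto simp: Basis_vec_def inner_axis)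
  show "((\<lambda>x. \<chi> l. if l = i then fst t $ i else cubic1 t x l) has_derivative
     (\<lambda>v. \<chi> l. if l = i then 0 else cubic2 t x l * v $ l)) (at x)"
  proof (rule vec)
    show "((\<lambda>x. if l = i then fst t $ i else cubic1 t x l) has_derivative
       (\<lambda>v. if l = i then 0 else cubic2 t x l * v $ l)) (at x)" for l
      using cubic1_has_derivative[of t l x] by (cases "l = i") simp_all
  qed
  show "((\<lambda>x. \<chi> l. if l = i then fst (snd t) $ i else cubic2 t x l) has_derivative
     (\<lambda>v. \<chi> l. if l = i then 0 else 6 * fst t $ l * v $ l)) (at x)"
  proof (rule vec)
    show "((\<lambda>x. if l = i then fst (snd t) $ i else cubic2 t x l) has_derivative
       (\<lambda>v. if l = i then 0 else 6 * fst t $ l * v $ l)) (at x)" for l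
      using cubic2_has_derivative[of t l x] by (cases "l = i") simp_all
  qed
qed

lemma trace_at_derivative:
  assumes "z \<in> \<Omega>" "l \<noteq> i"
  shows "frechet_derivative trace_at (at z) (0, 0, axis l 1) = - trace_coef z l"
proof -
  obtain x s m where z: "z = (x, s, m)" by (cases z)
  have dE: "(trace_at has_derivative frechet_derivative trace_at (at z)) (at z)"
    by (rule smooth_on_has_derivative[OF smooth_trace_at assms(1)])
  have "((\<lambda>r::real. z + r *\<^sub>R (0, 0, axis l 1)) has_derivative (\<lambda>r. r *\<^sub>R (0, 0, axis l 1))) (at 0)"
    by (auto intro!: derivative_eq_intros)
  moreover have "(trace_at has_derivative frechet_derivative trace_at (at z)) (at (z + 0 *\<^sub>R (0, 0, axis l 1)))"
    using dE by (simp add: zero_prod_def[symmetric])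
  ultimately have "((\<lambda>r. trace_at (z + r *\<^sub>R (0, 0, axis l 1))) has_derivative (\<lambda>r. frechet_derivative trace_at (at z) (r *\<^sub>R (0, 0, axis l 1)))) (at 0)"
    by (rule has_derivative_compose)
  moreover have "trace_at (z + r *\<^sub>R (0, 0, axis l 1)) = trace_at z - trace_coef z l * r" for r
  proof -
    have "trace_at (z + r *\<^sub>R (0, 0, axis l 1)) = trace_at (x, s, m + r *\<^sub>R axis l 1)" by (simp add: z)
    also have "\<dots> = trace_at z - (\<Sum>k\<in>-{i}. trace_coef z k * (r * axis l 1 $ k))"
      using trace_at_affine[of x s "m + r *\<^sub>R axis l 1" m] trace_coef_snd[of x s m _ "m + r *\<^sub>R axis l 1"] by (simp add: z)
    also have "(\<Sum>k\<in>-{i}. trace_coef z k * (r * axis l 1 $ k)) = (\<Sum>k\<in>-{i}. if k = l then trace_coef z l * r else 0)"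
      by (intro sum.cong refl) (auto simp: axis_def)
    also have "\<dots> = trace_coef z l * r" using assms(2) by simp
    finally show ?thesis .
  qed
  ultimately have "((\<lambda>r. trace_at z - trace_coef z l * r) has_derivative (\<lambda>r. frechet_derivative trace_at (at z) (r *\<^sub>R (0, 0, axis l 1)))) (at 0)"
    by simp
  moreover have "((\<lambda>r. trace_at z - trace_coef z l * r) has_derivative (\<lambda>r. - (trace_coef z l * r))) (at 0)"
    by (auto intro!: derivative_eq_intros)
  ultimately have "(\<lambda>r. frechet_derivative trace_at (at z) (r *\<^sub>R (0, 0, axis l 1))) = (\<lambda>r. - (trace_coef z l * r))"
    by (rule has_derivative_unique)
  from fun_cong[OF this, of 1] show ?thesis by simp
qed

text \<open>Along the frame vector \<open>l\<close> the jet of the perturbation changes in \<open>s\<close> by its second and in \<open>m\<close> by its third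
derivative.  The latter is \<open>6\<close> times the cubic coefficient and is multiplied by \<open>- trace_coef z l\<close>, which is
not zero.\<close>

lemma cubic_coefficient:
  assumes x: "x \<in> B" and l: "l \<noteq> i"
    and flat: "frechet_derivative (level_trace g c i (\<lambda>x. f x + cubic i t x)) (at x) (level_frame i (\<lambda>x. f x + cubic i t x) l x) = 0"
  defines "z \<equiv> jet_at t x"
  shows "fst t $ l = frechet_derivative trace_at (at z) (jet_frame i (jet_grad z) l, (snd (snd z) $ l) *\<^sub>R axis l 1, 0) / (6 * trace_coef z l)"
proof -
  let ?X = "jet_frame i (jet_grad z) l" and ?D = "frechet_derivative trace_at (at z)"
  have z\<Omega>: "z \<in> \<Omega>" using x by (simp add: z_def jet_at_def)
  have dE: "(trace_at has_derivative ?D) (at z)" by (rule smooth_on_has_derivative[OF smooth_trace_at z\<Omega>])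
  have lin: "linear ?D" by (rule has_derivative_linear[OF dE])
  define J where "J v = (v, (\<chi> k. if k = i then 0 else cubic2 t x k * v $ k), (\<chi> k. if k = i then 0 else 6 * fst t $ k * v $ k))" for v :: "real^'d"
  have "(jet_at t has_derivative J) (at x)" using jet_at_has_derivative[of t x] by (simp add: J_def[abs_def])
  hence "((\<lambda>x. trace_at (jet_at t x)) has_derivative (\<lambda>v. ?D (J v))) (at x)"
    by (rule has_derivative_compose) (use dE in \<open>simp add: z_def\<close>)
  hence "(level_trace g c i (\<lambda>x. f x + cubic i t x) has_derivative (\<lambda>v. ?D (J v))) (at x)"
    by (rule has_derivative_transform_within_open[OF _ open_B x]) (simp add: level_trace_perturbed)
  from fun_cong[OF frechet_derivative_at[OF this], of ?X] flat
  have "?D (J ?X) = 0" by (simp add: level_frame_jet gradient_jet[OF x] z_def)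
  moreover have "J ?X = (?X, (snd (snd z) $ l) *\<^sub>R axis l 1, 0) + (6 * fst t $ l) *\<^sub>R (0, 0, axis l 1)"
  proof -
    have X: "?X $ k = (if k = l then 1 else 0)" if "k \<noteq> i" for k
      using that by (simp add: jet_frame_def axis_def)
    have m: "snd (snd z) $ l = cubic2 t x l" using l by (simp add: z_def jet_at_def)
    show ?thesis unfolding J_def using X l by (auto simp: m vec_eq_iff axis_def)
  qed
  ultimately have "?D (?X, (snd (snd z) $ l) *\<^sub>R axis l 1, 0) + 6 * fst t $ l * - trace_coef z l = 0"
    by (simp only: linear_add[OF lin] linear_scale[OF lin] trace_at_derivative[OF z\<Omega> l] real_scaleR_def)
  moreover have "trace_coef z l > 0" by (rule trace_coef_pos) (use x in \<open>simp add: z_def jet_at_def\<close>)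
  ultimately show ?thesis by (simp add: field_simps)
qed

text \<open>The bad parameters are recovered from the jet of the perturbation at the bad point, of which one entry of \<open>m\<close>
is determined by the vanishing of the trace: the cubic coefficients by the derivatives of the trace, the
others by the values of the first and second derivatives, and the constant by the vanishing of the
function.\<close>

lemma negligible_flat:
  assumes d: "2 \<le> CARD('d)"
  shows "negligible {t. \<exists>x\<in>B. f x + cubic i t x = 0 \<and> level_trace g c i (\<lambda>x. f x + cubic i t x) x = 0 \<and>
    (\<forall>l. l \<noteq> i \<longrightarrow> frechet_derivative (level_trace g c i (\<lambda>x. f x + cubic i t x)) (at x)
       (level_frame i (\<lambda>x. f x + cubic i t x) l x) = 0)}" (is "negligible ?bad")
proof -
  obtain j where j: "j \<noteq> i"
  proof -
    have "(UNIV :: 'd set) \<noteq> {i}" using d by (metis One_nat_def card.empty card.insert empty_iff finite.emptyI not_less_eq_eq numeral_2_eq_2 order_refl)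
    thus thesis using that by blast
  qed
  define m0 :: "'d jet \<Rightarrow> real^'d" where "m0 z = (\<chi> l. if l = j then 0 else snd (snd z) $ l)" for z
  \<comment> \<open>The entry \<open>j\<close> of \<open>m\<close> is replaced by the one for which the trace vanishes.\<close>
  define mm :: "'d jet \<Rightarrow> real^'d" where "mm z = (\<chi> l. if l = j then trace_at (fst z, fst (snd z), m0 z) / trace_coef z j else snd (snd z) $ l)" for z
  define zz where "zz z = (fst z, fst (snd z), mm z)" for z
  define a where "a l z = frechet_derivative trace_at (at (zz z)) (jet_frame i (jet_grad z) l, (mm z $ l) *\<^sub>R axis l 1, 0) / (6 * trace_coef z l)" for l z
  define p where "p l z = (if l = i then fst (snd z) $ i else a l z)" for l z
  define q where "q l z = (if l = i then snd (snd z) $ i else (mm z $ l - 6 * a l z * fst z $ l) / 2)" for l z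
  define r where "r l z = (if l = i then snd (snd z) $ j else fst (snd z) $ l - 3 * p l z * fst z $ l ^ 2 - 2 * q l z * fst z $ l)" for l z
  define e where "e z = - f (fst z) - (\<Sum>l\<in>-{i}. p l z * fst z $ l ^ 3 + q l z * fst z $ l ^ 2 + r l z * fst z $ l)" for z
  \<comment> \<open>The coefficients with the index \<open>i\<close> are read off from the entry \<open>i\<close> of \<open>s\<close> and the entries \<open>i\<close> and \<open>j\<close> of \<open>m\<close>.\<close>
  define \<Psi> :: "'d jet \<Rightarrow> 'd cubic" where "\<Psi> z = ((\<chi> l. p l z), (\<chi> l. q l z), (\<chi> l. r l z), e z)" for z
  have sx: "smooth_on \<Omega> (\<lambda>z. fst z $ l)" for l
    by (intro smooth_on_linear bounded_linear_compose[OF bounded_linear_vec_nth] bounded_linear_fst)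
  have ss: "smooth_on \<Omega> (\<lambda>z. fst (snd z) $ l)" for l
    by (intro smooth_on_linear bounded_linear_compose[OF bounded_linear_vec_nth]
        bounded_linear_compose[OF bounded_linear_fst] bounded_linear_snd)
  have sm: "smooth_on \<Omega> (\<lambda>z. snd (snd z) $ l)" for l
    by (intro smooth_on_linear bounded_linear_compose[OF bounded_linear_vec_nth]
        bounded_linear_compose[OF bounded_linear_snd] bounded_linear_snd)
  have coef0: "trace_coef z l \<noteq> 0" if "z \<in> \<Omega>" for z l
    using trace_coef_pos[of z l] that by force
  have triple: "smooth_on \<Omega> (\<lambda>z. (fst z, fst (snd z), w z))" if "\<And>l. smooth_on \<Omega> (\<lambda>z. w z $ l)" for w :: "'d jet \<Rightarrow> real^'d"
    by (intro smooth_on_Pair smooth_on_vecI[OF open_\<Omega>] open_\<Omega> sx ss that)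
  have sm0: "smooth_on \<Omega> (\<lambda>z. m0 z $ l)" for l
    using sm[of l] by (cases "l = j") (simp_all add: m0_def)
  have sE0: "smooth_on \<Omega> (\<lambda>z. trace_at (fst z, fst (snd z), m0 z))"
    by (rule smooth_on_compose[where f = trace_at and g = "\<lambda>z. (fst z, fst (snd z), m0 z)", OF open_\<Omega> open_\<Omega> smooth_trace_at triple[OF sm0]]) auto
  have smm: "smooth_on \<Omega> (\<lambda>z. mm z $ l)" for l
  proof (cases "l = j")
    case True
    have "smooth_on \<Omega> (\<lambda>z. trace_at (fst z, fst (snd z), m0 z) / trace_coef z j)"
      by (intro smooth_on_divide sE0 smooth_trace_coef open_\<Omega> coef0)
    thus ?thesis by (simp add: mm_def True)
  next
    case False
    thus ?thesis using sm[of l] by (simp add: mm_def)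
  qed
  have szz: "smooth_on \<Omega> zz" unfolding zz_def by (rule triple[OF smm])
  have sDE: "smooth_on \<Omega> (\<lambda>z. frechet_derivative trace_at (at (zz z)) b)" for b
    by (rule smooth_on_compose[where f = "\<lambda>z. frechet_derivative trace_at (at z) b" and g = zz, OF open_\<Omega> open_\<Omega> smooth_on_frechet[OF smooth_trace_at] szz])
       (auto simp: zz_def)
  have zz\<Omega>: "zz z \<in> \<Omega>" if "z \<in> \<Omega>" for z using that by (auto simp: zz_def)
  have sa: "smooth_on \<Omega> (\<lambda>z. a l z)" for l
  proof -
    let ?w = "\<lambda>z. (jet_frame i (jet_grad z) l, (mm z $ l) *\<^sub>R axis l 1, 0) :: 'd jet"
    have "smooth_on \<Omega> (\<lambda>z. (mm z $ l) *\<^sub>R axis l (1::real))"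
    proof (rule smooth_on_vecI[OF open_\<Omega>])
      have "smooth_on \<Omega> (\<lambda>z. mm z $ l * axis l 1 $ k)" for k by (intro smooth_on_mult smm smooth_on_const open_\<Omega>)
      thus "smooth_on \<Omega> (\<lambda>z. (mm z $ l *\<^sub>R axis l (1::real)) $ k)" for k by simp
    qed
    hence sw: "smooth_on \<Omega> ?w"
      by (intro smooth_on_Pair open_\<Omega> smooth_on_const smooth_on_vecI[OF open_\<Omega> smooth_jet_frame])
    have "smooth_on \<Omega> (\<lambda>z. \<Sum>b\<in>Basis. (?w z \<bullet> b) * frechet_derivative trace_at (at (zz z)) b)"
      using sw smooth_on_componentwise[OF open_\<Omega>, of ?w] by (intro smooth_on_sum smooth_on_mult sDE open_\<Omega>) simp
    hence "smooth_on \<Omega> (\<lambda>z. frechet_derivative trace_at (at (zz z)) (?w z))"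
      by (rule smooth_on_cong[OF open_\<Omega>, rotated])
         (rule frechet_derivative_Basis_sum[OF smooth_on_differentiable[OF smooth_trace_at zz\<Omega>], symmetric])
    thus ?thesis unfolding a_def
      by (intro smooth_on_divide smooth_on_mult smooth_on_const smooth_trace_coef open_\<Omega>) (simp_all add: coef0)
  qed
  have sp: "smooth_on \<Omega> (p l)" for l
    using ss[of i] sa[of l] by (cases "l = i") (simp_all add: p_def[abs_def])
  have sq: "smooth_on \<Omega> (q l)" for l
  proof (cases "l = i")
    case False
    have "smooth_on \<Omega> (\<lambda>z. (mm z $ l - 6 * a l z * fst z $ l) / 2)"
      by (intro smooth_on_divide smooth_on_diff smooth_on_mult smooth_on_const smm sa sx open_\<Omega>) simp
    thus ?thesis using False by (simp add: q_def[abs_def])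
  qed (use sm[of i] in \<open>simp add: q_def[abs_def]\<close>)
  have sr: "smooth_on \<Omega> (r l)" for l
  proof (cases "l = i")
    case False
    have "smooth_on \<Omega> (\<lambda>z. fst (snd z) $ l - 3 * p l z * fst z $ l ^ 2 - 2 * q l z * fst z $ l)"
      by (intro smooth_on_diff smooth_on_mult smooth_on_power smooth_on_const sp sq ss sx open_\<Omega>)
    thus ?thesis using False by (simp add: r_def[abs_def])
  qed (use sm[of j] in \<open>simp add: r_def[abs_def]\<close>)
  have se: "smooth_on \<Omega> e"
    unfolding e_def[abs_def]
    by (intro smooth_on_diff smooth_on_minus smooth_on_sum smooth_on_add smooth_on_mult smooth_on_power sp sq sr sx
        smooth_fst_jet smooth_f open_\<Omega>)
  have "smooth_on \<Omega> \<Psi>"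
    unfolding \<Psi>_def by (intro smooth_on_Pair smooth_on_vecI[OF open_\<Omega>] open_\<Omega> se)
      (unfold vec_lambda_beta, (rule sp sq sr)+)
  hence "negligible (\<Psi> ` \<Omega>)"
    by (intro negligible_differentiable_image_lowdim smooth_on_differentiable_on) simp_all
  moreover have "?bad \<subseteq> \<Psi> ` \<Omega>"
  proof
    fix t assume "t \<in> ?bad"
    then obtain x where x: "x \<in> B" and zero: "f x + cubic i t x = 0"
      and H0: "level_trace g c i (\<lambda>x. f x + cubic i t x) x = 0"
      and H1: "\<And>l. l \<noteq> i \<Longrightarrow> frechet_derivative (level_trace g c i (\<lambda>x. f x + cubic i t x)) (at x)
       (level_frame i (\<lambda>x. f x + cubic i t x) l x) = 0" by blast
    define y where "y = jet_at t x"
    define z where "z = (x, fst (snd y), (\<chi> l. if l = j then fst (snd (snd t)) $ i else snd (snd y) $ l))"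
    have y: "y = (x, fst (snd y), snd (snd y))" by (simp add: y_def jet_at_def)
    have Ey: "trace_at y = 0" using H0 level_trace_perturbed[OF x] by (simp add: y_def)
    have "trace_at (x, fst (snd y), m0 z) = trace_coef y j * snd (snd y) $ j"
    proof -
      have "trace_at (x, fst (snd y), m0 z) = trace_at y - (\<Sum>l\<in>-{i}. trace_coef y l * (m0 z $ l - snd (snd y) $ l))"
        using trace_at_affine[of x "fst (snd y)" "m0 z" "snd (snd y)"] trace_coef_snd[of x "fst (snd y)" "m0 z" _ "snd (snd y)"] y by simp
      also have "(\<Sum>l\<in>-{i}. trace_coef y l * (m0 z $ l - snd (snd y) $ l)) = (\<Sum>l\<in>-{i}. if l = j then - (trace_coef y j * snd (snd y) $ j) else 0)"
        by (intro sum.cong refl) (auto simp: m0_def z_def)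
      finally show ?thesis using Ey j by simp
    qed
    moreover have cz: "trace_coef z l = trace_coef y l" for l
      by (subst y) (simp only: z_def, rule trace_coef_snd)
    moreover have "trace_coef y j > 0" by (rule trace_coef_pos) (simp add: y_def jet_at_def x)
    ultimately have mmz: "mm z = snd (snd y)"
      by (auto simp: mm_def vec_eq_iff) (auto simp: z_def)
    have zz: "zz z = y" using y mmz by (simp add: zz_def) (simp add: z_def)
    have gz: "jet_grad z = jet_grad y"
    proof -
      have "jet_grad z = jet_grad (x, fst (snd y), snd (snd y))" unfolding z_def by (rule jet_grad_snd)
      also have "\<dots> = jet_grad y" by (rule arg_cong[where f = jet_grad, OF y[symmetric]])
      finally show ?thesis .
    qed
    have fz: "fst z = x" "fst (snd z) = fst (snd y)" by (simp_all add: z_def)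
    have al: "a l z = fst t $ l" if "l \<noteq> i" for l
      using cubic_coefficient[OF x that H1[OF that]] by (simp add: a_def zz gz mmz cz y_def)
    have pl: "p l z = fst t $ l" for l
      using al[of l] by (auto simp: p_def fz y_def jet_at_def)
    have ql: "q l z = fst (snd t) $ l" for l
      using al[of l] j by (auto simp: q_def mmz fz) (auto simp: z_def y_def jet_at_def cubic2_def)
    have rl: "r l z = fst (snd (snd t)) $ l" for l
      by (auto simp: r_def pl ql fz) (auto simp: z_def y_def jet_at_def cubic1_def)
    have "e z = snd (snd (snd t))"
      using zero by (simp add: e_def pl ql rl fz cubic_def)
    hence "t = \<Psi> z" by (simp add: \<Psi>_def pl ql rl prod_eq_iff)
    moreover have "z \<in> \<Omega>" using x by (simp add: z_def)
    ultimately show "t \<in> \<Psi> ` \<Omega>" by blast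
  qed
  ultimately show ?thesis by (rule negligible_subset)
qed

end

lemma metric_straightening_subset:
  assumes "metric_straightening i f B \<A> g c" "open B'" "convex B'" "B' \<subseteq> B"
  shows "metric_straightening i f B' \<A> g c"
proof -
  interpret metric_straightening i f B \<A> g c by (rule assms(1))
  show ?thesis
    using assms(2-4) smooth_on_subset[OF assms(4) smooth_f] transversal atlas metric c B_image
    by unfold_locales auto
qed

text \<open>If \<open>h\<^sub>0 p = 0\<close>, one coordinate direction \<open>i\<close> is transversal to the zero sets of all functions near \<open>h\<^sub>0\<close>, and
the perturbations are polynomials in the other coordinates.\<close>

lemma dense_finite_order:
  fixes \<A> :: "('m::t2_space, 'd::finite) chart set"
  assumes A: "smooth_atlas \<A>" and g: "riemannian_metric \<A> g" and d: "2 \<le> CARD('d)"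
    and h\<^sub>0: "h\<^sub>0 \<in> smooth_functions \<A>" and reg: "regular_zero_at \<A> h\<^sub>0 p"
  shows "\<exists>O' C. openin (Cinf_topology \<A>) O' \<and> h\<^sub>0 \<in> O' \<and> compact C \<and> p \<in> interior C \<and>
    (\<forall>h\<in>O'. \<forall>U. openin (Cinf_topology \<A>) U \<longrightarrow> h \<in> U \<longrightarrow> (\<exists>h'\<in>U. \<forall>q\<in>C. finite_order_at \<A> g h' q))"
proof -
  obtain c where c: "c \<in> \<A>" "p \<in> fst c" using atlas_covers[OF A] by blast
  have cs: "c \<in> smooth_charts \<A>" by (rule atlas_in_smooth_charts[OF A c(1)])
  have ch: "is_chart c" by (rule smooth_charts_chart[OF cs])
  let ?x = "snd c p"
  show ?thesis
  proof (cases "h\<^sub>0 p = 0")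
    case False
    have ne: "(h\<^sub>0 \<circ> chart_inv c) ?x \<noteq> 0" using False ch c by simp
    from tendsto_imp_eventually_ne[OF partial_derivs_jointly_continuous[OF A h\<^sub>0 cs chart_in_image[OF c(2)], of "[]", unfolded partial_derivs_simps] ne]
    obtain O' V where OV: "openin (Cinf_topology \<A>) O'" "h\<^sub>0 \<in> O'" "open V" "p \<in> V" "V \<subseteq> fst c"
      "\<And>h q. h \<in> O' \<Longrightarrow> q \<in> V \<Longrightarrow> (h \<circ> chart_inv c) (snd c q) \<noteq> 0"
      using eventually_in_chart[OF A h\<^sub>0 ch c(2), of "\<lambda>h x. (h \<circ> chart_inv c) x \<noteq> 0"] by blast
    have "open (chart_inv c -` V \<inter> chart_image c)"
      using continuous_on_open_vimage[OF is_chart_open(2)[OF ch]] is_chart_continuous(2)[OF ch] OV(3) by blast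
    moreover have "?x \<in> chart_inv c -` V \<inter> chart_image c" using c OV(4) ch by simp
    ultimately obtain r where r: "r > 0" "cball ?x r \<subseteq> chart_inv c -` V \<inter> chart_image c"
      using open_contains_cball by blast
    have r': "cball ?x r \<subseteq> chart_image c" using r(2) by blast
    note C = chart_compact_nbhd[OF ch c(2) r(1) r']
    have "finite_order_at \<A> g h q" if "h \<in> O'" "q \<in> chart_inv c ` cball ?x r" for h q
    proof -
      have "q \<in> V" using that(2) r(2) by blast
      hence "h q \<noteq> 0" using OV(6)[OF that(1), of q] C(3)[OF that(2)] ch by simp
      thus ?thesis by (simp add: finite_order_at_def)
    qed
    thus ?thesis using OV(1,2) C(1,2) by blast
  next
    case True
    then obtain i where i: "partial_deriv i (h\<^sub>0 \<circ> chart_inv c) ?x \<noteq> 0"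
      using regular_zero_atD[OF A h\<^sub>0 cs c(2) reg] by blast
    obtain O' R where OR: "openin (Cinf_topology \<A>) O'" "h\<^sub>0 \<in> O'" "R > 0" "cball ?x R \<subseteq> chart_image c"
      "\<And>h. h \<in> O' \<Longrightarrow> metric_straightening i (h \<circ> chart_inv c) (ball ?x R) \<A> g c"
      using straightening_ball[OF A h\<^sub>0 cs c(2) g i] by blast
    let ?C = "chart_inv c ` cball ?x (R / 3)" and ?B = "ball ?x (R / 2)"
    have sub: "cball ?x (R / 3) \<subseteq> chart_image c" using OR(3,4) by fastforce
    have "R / 3 > 0" using OR(3) by simp
    note C = chart_compact_nbhd[OF ch c(2) this sub]
    have "\<exists>h'\<in>U. \<forall>q\<in>?C. finite_order_at \<A> g h' q"
      if h: "h \<in> O'" and U: "openin (Cinf_topology \<A>) U" "h \<in> U" for h U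
    proof -
      let ?u = "h \<circ> chart_inv c"
      have half: "0 < R / 2" "R / 2 < R" using OR(3) by auto
      have "?B \<subseteq> ball ?x R" using OR(3) by auto
      then interpret metric_straightening i ?u ?B \<A> g c
        by (intro metric_straightening_subset[OF OR(5)[OF h]] open_ball convex_ball)
      obtain h' t where h': "h' \<in> U" "h' \<in> smooth_functions \<A>"
        "t \<notin> {t. \<exists>x\<in>?B. ?u x + cubic i t x = 0 \<and> level_trace g c i (\<lambda>x. ?u x + cubic i t x) x = 0 \<and>
          (\<forall>l. l \<noteq> i \<longrightarrow> frechet_derivative (level_trace g c i (\<lambda>x. ?u x + cubic i t x)) (at x)
          (level_frame i (\<lambda>x. ?u x + cubic i t x) l x) = 0)}"
        "\<And>x. x \<in> cball ?x (R / 2) \<Longrightarrow> (h' \<circ> chart_inv c) x = ?u x + cubic i t x"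
        using generic_perturbation[where G = "cubic i" and r = "R / 2", OF A cs OR(4) _ _ linear_cubic smooth_cubic U negligible_flat[OF d]] half
        by blast
      interpret new: metric_straightening i "\<lambda>x. ?u x + cubic i t x" ?B \<A> g c by (rule perturbed)
      have eq: "h' (chart_inv c x) = ?u x + cubic i t x" if "x \<in> ?B" for x
        using h'(4)[of x] that by simp
      have "finite_order_at \<A> g h' q" if q: "q \<in> ?C" for q
        unfolding finite_order_at_def
      proof (intro impI notI)
        assume zero: "h' q = 0" and flat: "mean_curvature_vanishes_to_infinite_order \<A> g {p. h' p = 0} q"
        have qc: "q \<in> fst c" and y: "snd c q \<in> ?B" using C(3)[OF q] OR(3) by auto
        have "?u (snd c q) + cubic i t (snd c q) = 0" using eq[OF y] zero qc ch by simp
        thus False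
          using h'(3) y new.flat_level_trace[OF eq qc y flat] by blast
      qed
      thus ?thesis using h'(1) by blast
    qed
    thus ?thesis using OR(1,2) C(1,2) by blast
  qed
qed

section \<open>Morse functions with regular zero set\<close>

text \<open>In a slice chart the Hessian of \<open>h\<close> vanishes on the tangent space of the slice, which is too large
  for a nondegenerate form.\<close>

lemma regular_on_hypersurface:
  fixes \<A> :: "('m::topological_space, 'd::finite) chart set"
  assumes A: "smooth_atlas \<A>" and h: "h \<in> smooth_functions \<A>" and d: "3 \<le> CARD('d)"
    and morse: "morse_at \<A> h p" and slice: "slice_chart \<A> {p. h p = 0} c i" and p: "p \<in> fst c"
  shows "regular_zero_at \<A> h p"
  unfolding regular_zero_at_def
proof (intro impI ballI notI)
  fix e assume zero: "h p = 0" and e: "e \<in> \<A>" "p \<in> fst e" and crit: "critical_in_chart e h p"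
  have c: "c \<in> smooth_charts \<A>" using slice by (simp add: slice_chart_def)
  have ch: "is_chart c" by (rule smooth_charts_chart[OF c])
  let ?x = "snd c p" and ?u = "h \<circ> chart_inv c"
  have slice': "snd c ` (fst c \<inter> {p. h p = 0}) = {x \<in> chart_image c. x $ i = 0}"
    using slice by (simp add: slice_chart_def)
  have x0: "?x $ i = 0" using slice' p zero by blast
  have u0: "?u x = 0" if x: "x \<in> chart_image c" "x $ i = 0" for x
  proof -
    obtain q where "q \<in> fst c" "h q = 0" "x = snd c q" using slice' x by blast
    thus ?thesis using ch by simp
  qed
  note oc = is_chart_open(2)[OF ch]
  have p1: "partial_deriv k ?u x = 0" if "k \<noteq> i" "x \<in> chart_image c" "x $ i = 0" for k x
    using partial_deriv_slice_cong[OF oc that(2,3,1), of ?u "\<lambda>_. 0"] u0 by (simp add: partial_deriv_def)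
  have p2: "partial_deriv j (partial_deriv k ?u) ?x = 0" if "j \<noteq> i" "k \<noteq> i" for j k
    using partial_deriv_slice_cong[OF oc chart_in_image[OF p] x0 that(1), of "partial_deriv k ?u" "\<lambda>_. 0"] p1[OF that(2)]
    by (simp add: partial_deriv_def)
  let ?H = "hessian_in_chart c h p"
  have H0: "?H $ j $ k = 0" if "j \<noteq> i" "k \<noteq> i" for j k
    using p2[OF that] by (simp add: hessian_in_chart_def)
  have critc: "critical_in_chart c h p"
    using critical_in_chart_iff[OF A c e(1) h p e(2)] crit by simp
  have "det ?H \<noteq> 0"
    using nondegenerate_in_chart_iff[OF A c e(1) h p e(2) critc] morse e crit by (simp add: morse_at_def)
  have inj: "w = 0" if "?H *v w = 0" for w
    using matrix_inv_mult_vec(2)[OF \<open>det ?H \<noteq> 0\<close>, of w] that by simp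
  have "card (- {i}) \<ge> 2" using d by (simp add: Compl_eq_Diff_UNIV card_Diff_singleton)
  hence "\<not> card (- {i}) \<le> Suc 0" by simp
  then obtain a b where ab: "a \<noteq> i" "b \<noteq> i" "a \<noteq> b"
    using card_le_Suc0_iff_eq[of "- {i}"] by auto
  have col: "(?H *v axis j r) $ k = (if k = i then ?H $ i $ j * r else 0)" if "j \<noteq> i" for j k r
  proof -
    have "(?H *v axis j r) $ k = (\<Sum>l\<in>UNIV. if l = j then ?H $ k $ j * r else 0)"
      unfolding matrix_vector_mult_def vec_lambda_beta by (intro sum.cong refl) (auto simp: axis_def)
    thus ?thesis using H0[OF _ that] by simp
  qed
  define w where "w = axis a (?H $ i $ b) - axis b (?H $ i $ a)"
  have "?H *v w = 0"
    using col[OF ab(1)] col[OF ab(2)] by (simp add: w_def vec_eq_iff matrix_vector_mult_diff_distrib)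
  hence "w = 0" by (rule inj)
  hence "w $ a = 0" by simp
  hence "?H $ i $ b = 0" using ab by (simp add: w_def axis_def)
  hence "?H *v axis b 1 = 0" using col[OF ab(2)] by (simp add: vec_eq_iff)
  hence "axis b (1::real) = 0" by (rule inj)
  thus False by (simp add: axis_eq_0_iff)
qed

lemma smooth_functions_continuous:
  fixes \<A> :: "('m::t2_space, 'd::finite) chart set"
  assumes A: "smooth_atlas \<A>" and h: "h \<in> smooth_functions \<A>"
  shows "continuous_on UNIV h"
proof (rule continuous_at_imp_continuous_on, rule ballI)
  fix p
  obtain c where c: "c \<in> \<A>" "p \<in> fst c" using atlas_covers[OF A] by blast
  have ch: "is_chart c" by (rule smooth_charts_chart[OF atlas_in_smooth_charts[OF A c(1)]])
  have "continuous_on (chart_image c) (h \<circ> chart_inv c)"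
    using h c by (intro smooth_on_continuous) (simp add: smooth_functions_def)
  hence "continuous_on (fst c) ((h \<circ> chart_inv c) \<circ> snd c)"
    unfolding chart_image_def by (rule continuous_on_compose[OF is_chart_continuous(1)[OF ch]])
  hence "continuous_on (fst c) h"
    by (rule continuous_on_eq) (simp add: ch)
  thus "isCont h p" using c is_chart_open(1)[OF ch] continuous_on_eq_continuous_at by blast
qed

lemma good_functions_eq:
  fixes \<A> :: "('m::t2_space, 'd::finite) chart set"
  assumes A: "smooth_atlas \<A>" and g: "riemannian_metric \<A> g" and d: "3 \<le> CARD('d)" and comp: "compact (UNIV :: 'm set)"
  shows "good_functions \<A> g = {h \<in> smooth_functions \<A>. \<forall>p. morse_at \<A> h p} \<inter>
    {h \<in> {h \<in> smooth_functions \<A>. \<forall>p. regular_zero_at \<A> h p}. \<forall>p. finite_order_at \<A> g h p}" (is "_ = ?R")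
proof (intro equalityI subsetI)
  fix h assume h: "h \<in> good_functions \<A> g"
  have hs: "h \<in> smooth_functions \<A>" and m: "morse_at \<A> h p" and f: "finite_order_at \<A> g h p" for p
    using h by (auto simp: good_functions_def morse_def morse_at_def finite_order_at_def)
  have "regular_zero_at \<A> h p" for p
  proof (cases "h p = 0")
    case True
    then obtain c i where "slice_chart \<A> {p. h p = 0} c i" "p \<in> fst c"
      using h by (auto simp: good_functions_def closed_embedded_hypersurface_def)
    thus ?thesis by (rule regular_on_hypersurface[OF A hs d m])
  qed (simp add: regular_zero_at_def)
  thus "h \<in> ?R" using hs m f by auto
next
  fix h assume "h \<in> ?R"
  hence hs: "h \<in> smooth_functions \<A>" and m: "\<And>p. morse_at \<A> h p" and r: "\<And>p. regular_zero_at \<A> h p"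
    and f: "\<And>p. finite_order_at \<A> g h p" by auto
  have "closed {p. h p = 0}"
    by (intro closed_Collect_eq smooth_functions_continuous[OF A hs] continuous_on_const)
  hence "compact {p. h p = 0}" using compact_Int_closed[OF comp] by simp
  moreover have "\<exists>c i. slice_chart \<A> {p. h p = 0} c i \<and> p \<in> fst c" if p: "h p = 0" for p
  proof -
    obtain c where cp: "c \<in> \<A>" "p \<in> fst c" using atlas_covers[OF A] by blast
    have cs: "c \<in> smooth_charts \<A>" by (rule atlas_in_smooth_charts[OF A cp(1)])
    obtain i where i: "partial_deriv i (h \<circ> chart_inv c) (snd c p) \<noteq> 0"
      using regular_zero_atD[OF A hs cs cp(2) r p] by blast
    obtain O' R where OR: "openin (Cinf_topology \<A>) O'" "h \<in> O'" "R > 0" "cball (snd c p) R \<subseteq> chart_image c"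
      "\<And>h. h \<in> O' \<Longrightarrow> metric_straightening i (h \<circ> chart_inv c) (ball (snd c p) R) \<A> g c"
      using straightening_ball[OF A hs cs cp(2) g i] by blast
    interpret metric_straightening i "h \<circ> chart_inv c" "ball (snd c p) R" \<A> g c by (rule OR(5)[OF OR(2)])
    have "slice_chart \<A> {p. h p = 0} c' i" by (rule slice_chart_level_set) simp
    moreover have "p \<in> fst c'" using cp(2) OR(3) by (simp add: repar.repar_simps)
    ultimately show ?thesis by blast
  qed
  ultimately have "closed_embedded_hypersurface \<A> {p. h p = 0}"
    by (simp add: closed_embedded_hypersurface_def)
  moreover have "morse \<A> h" using hs m by (simp add: morse_def morse_at_def)
  ultimately show "h \<in> good_functions \<A> g"
    using f by (simp add: good_functions_def finite_order_at_def)
qed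

theorem proposition0p2:
  fixes \<A> :: "('m::{t2_space, second_countable_topology}, 'd::finite) chart set"
    and g :: "('m, 'd) metric"
  assumes "3 \<le> CARD('d)" and "CARD('d) \<le> 7"
    and "oriented_smooth_atlas \<A>"
    and "compact (UNIV :: 'm set)"
    and "riemannian_metric \<A> g"
  shows "openin (Cinf_topology \<A>) (good_functions \<A> g) \<and>
         Cinf_topology \<A> closure_of good_functions \<A> g = smooth_functions \<A>"
proof -
  have A: "smooth_atlas \<A>" using assms(3) by (simp add: oriented_smooth_atlas_def)
  let ?T = "Cinf_topology \<A>" and ?S = "smooth_functions \<A>"
  note comp = assms(4) and g = assms(5)
  have ts: "topspace ?T = ?S" by (rule topspace_Cinf_topology[OF A])
  have oS: "openin ?T ?S" using openin_topspace[of ?T] ts by simp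
  let ?M = "{h\<in>?S. \<forall>p. morse_at \<A> h p}" and ?R = "{h\<in>?S. \<forall>p. regular_zero_at \<A> h p}"
  let ?F = "{h\<in>?R. \<forall>p. finite_order_at \<A> g h p}"
  have M: "openin ?T ?M \<and> (\<forall>h\<in>?S. \<forall>U. openin ?T U \<longrightarrow> h \<in> U \<longrightarrow> (\<exists>h'\<in>U \<inter> ?S. \<forall>p. morse_at \<A> h' p))"
  proof (rule dense_from_local[OF comp oS])
    show "\<exists>O' V. openin ?T O' \<and> h \<in> O' \<and> open V \<and> p \<in> V \<and> (\<forall>h\<in>O'. \<forall>q\<in>V. morse_at \<A> h q)"
      if "h \<in> ?S" "morse_at \<A> h p" for h p by (rule open_morse_at[OF A that])
    show "\<exists>O' C. openin ?T O' \<and> h \<in> O' \<and> compact C \<and> p \<in> interior C \<and>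
      (\<forall>h\<in>O'. \<forall>U. openin ?T U \<longrightarrow> h \<in> U \<longrightarrow> (\<exists>h'\<in>U. \<forall>q\<in>C. morse_at \<A> h' q))" if "h \<in> ?S" for h p
      using dense_morse[OF A, of p] oS that by blast
  qed
  have R: "openin ?T ?R \<and> (\<forall>h\<in>?S. \<forall>U. openin ?T U \<longrightarrow> h \<in> U \<longrightarrow> (\<exists>h'\<in>U \<inter> ?S. \<forall>p. regular_zero_at \<A> h' p))"
  proof (rule dense_from_local[OF comp oS])
    show "\<exists>O' V. openin ?T O' \<and> h \<in> O' \<and> open V \<and> p \<in> V \<and> (\<forall>h\<in>O'. \<forall>q\<in>V. regular_zero_at \<A> h q)"
      if "h \<in> ?S" "regular_zero_at \<A> h p" for h p by (rule open_regular_zero_at[OF A that])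
    show "\<exists>O' C. openin ?T O' \<and> h \<in> O' \<and> compact C \<and> p \<in> interior C \<and>
      (\<forall>h\<in>O'. \<forall>U. openin ?T U \<longrightarrow> h \<in> U \<longrightarrow> (\<exists>h'\<in>U. \<forall>q\<in>C. regular_zero_at \<A> h' q))" if "h \<in> ?S" for h p
      using dense_regular_zero[OF A, of p] oS that by blast
  qed
  have F: "openin ?T ?F \<and> (\<forall>h\<in>?R. \<forall>U. openin ?T U \<longrightarrow> h \<in> U \<longrightarrow> (\<exists>h'\<in>U \<inter> ?R. \<forall>p. finite_order_at \<A> g h' p))"
  proof (rule dense_from_local[OF comp conjunct1[OF R]])
    show "\<exists>O' V. openin ?T O' \<and> h \<in> O' \<and> open V \<and> p \<in> V \<and> (\<forall>h\<in>O'. \<forall>q\<in>V. finite_order_at \<A> g h q)"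
      if "h \<in> ?R" "finite_order_at \<A> g h p" for h p
      by (rule open_finite_order_at[OF A g _ _ that(2)]) (use that(1) in auto)
    show "\<exists>O' C. openin ?T O' \<and> h \<in> O' \<and> compact C \<and> p \<in> interior C \<and>
      (\<forall>h\<in>O'. \<forall>U. openin ?T U \<longrightarrow> h \<in> U \<longrightarrow> (\<exists>h'\<in>U. \<forall>q\<in>C. finite_order_at \<A> g h' q))" if "h \<in> ?R" for h p
      by (rule dense_finite_order[OF A g]) (use that assms(1) in auto)
  qed
  have good: "good_functions \<A> g = ?M \<inter> ?F" by (rule good_functions_eq[OF A g assms(1) comp])
  have "openin ?T (good_functions \<A> g)" unfolding good using M F by (intro openin_Int) auto
  moreover have "?T closure_of good_functions \<A> g = ?S"
  proof (intro equalityI subsetI)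
    show "h \<in> ?S" if "h \<in> ?T closure_of good_functions \<A> g" for h
      using closure_of_subset_topspace[of ?T "good_functions \<A> g"] that ts by auto
    fix h assume h: "h \<in> ?S"
    have "\<exists>h'. h' \<in> good_functions \<A> g \<and> h' \<in> U" if U: "openin ?T U" "h \<in> U" for U
    proof -
      have "\<exists>h'\<in>U \<inter> ?S. \<forall>p. regular_zero_at \<A> h' p" using R h U by simp
      then obtain h1 where h1: "h1 \<in> U" "h1 \<in> ?R" by auto
      have "\<exists>h'\<in>U \<inter> ?R. \<forall>p. finite_order_at \<A> g h' p" using F h1 U(1) by simp
      then obtain h2 where h2: "h2 \<in> U" "h2 \<in> ?F" by auto
      have "openin ?T (U \<inter> ?F)" using F U(1) by (intro openin_Int) auto
      moreover have "h2 \<in> U \<inter> ?F" "h2 \<in> ?S" using h2 by auto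
      ultimately have "\<exists>h'\<in>(U \<inter> ?F) \<inter> ?S. \<forall>p. morse_at \<A> h' p" using conjunct2[OF M] by blast
      then obtain h3 where "h3 \<in> U" "h3 \<in> ?F" "h3 \<in> ?M" by auto
      thus ?thesis unfolding good by blast
    qed
    thus "h \<in> ?T closure_of good_functions \<A> g" using h by (auto simp: in_closure_of ts)
  qed
  ultimately show ?thesis by simp
qed

end
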